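(* Let $\mathcal{N}_{A'B'\to AB}$ be a tele-covariant bipartite quantum channel with $|A'|<\infty$. Then $$S[A|B]_{\mathcal{N}}=S(R_AA|R_BB)_{\Phi^{\mathcal{N}}}-\log|A'|,$$ where $\Phi^{\mathcal{N}}_{R_AAR_BB}:=\mathcal{N}(\Phi_{R_AA'}\otimes\Phi_{R_BB'})$ is the Choi state, $R_A\simeq A'$, $R_B\simeq B'$.
   Context: Systems are finite-dimensional. $\Phi_{RX}$ denotes the normalized maximally entangled state. $D(\rho\Vert\sigma)$ is the Umegaki relative entropy; for a channel $\mathcal{K}$ and completely positive map $\mathcal{L}$ from $X'$ to $X$, $D[\mathcal{K}\Vert\mathcal{L}]:=\sup_{\rho_{RX'}}D((\mathrm{id}_R\otimes\mathcal{K})(\rho)\Vert(\mathrm{id}_R\otimes\mathcal{L})(\rho))$. $\mathcal{R}_{A'\to A}(Y)=\operatorname{tr}(Y)\mathbbm{1}_A$. Von Neumann conditional entropy of a bipartite channel: $S[A|B]_{\mathcal{N}}:=-\inf_{\mathcal{M}\in\mathrm{Q}(B',B)}D[\mathcal{N}\Vert\mathcal{R}_{A'\to A}\otimes\mathcal{M}_{B'\to B}]$. For states, $S(X|Y)_\omega=S(XY)_\omega-S(Y)_\omega$. A bipartite channel $\mathcal{N}_{A'B'\to AB}$ is tele-covariant if there are finite groups $G,H$ with unitary representations $g\mapsto U^g_{A'}$, $h\mapsto U^h_{B'}$ that are unitary one-designs ($\frac{1}{|G|}\sum_g U^gXU^{g\dagger}=\operatorname{tr}(X)\mathbbm{1}_{A'}/|A'|$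 and similarly for $B'$), and unitary representations $V^g_A$, $W^h_B$, such that $\mathcal{N}((U^g\otimes U^h)\rho(U^g\otimes U^h)^\dagger)=(V^g\otimes W^h)\mathcal{N}(\rho)(V^g\otimes W^h)^\dagger$ for all states $\rho$ and all $g,h$. *)

theory Defs
  imports "Jordan_Normal_Form.Matrix" "HOL-Algebra.Group" "HOL-Library.Extended_Real"
begin

text \<open>A system of dimension d is C^d; operators on it are complex d x d matrices.
 Composite systems X Y are encoded by the Kronecker convention: basis index
 x * dim(Y) + y corresponds to the basis vector |x>|y>.\<close>

definition q_trace :: "complex mat \<Rightarrow> complex" where
  "q_trace A = (\<Sum>i<dim_row A. A $$ (i,i))"

definition q_adj :: "complex mat \<Rightarrow> complex mat" where
  "q_adj A = mat (dim_col A) (dim_row A) (\<lambda>(i,j). cnj (A $$ (j,i)))"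

definition q_unitary :: "nat \<Rightarrow> complex mat \<Rightarrow> bool" where
  "q_unitary d U \<longleftrightarrow> U \<in> carrier_mat d d \<and> q_adj U * U = 1\<^sub>m d"

definition q_psd :: "nat \<Rightarrow> complex mat \<Rightarrow> bool" where
  "q_psd d A \<longleftrightarrow> A \<in> carrier_mat d d \<and>
     (\<forall>v \<in> carrier_vec d. Im (map_vec cnj v \<bullet> (A *\<^sub>v v)) = 0 \<and> Re (map_vec cnj v \<bullet> (A *\<^sub>v v)) \<ge> 0)"

definition q_state :: "nat \<Rightarrow> complex mat \<Rightarrow> bool" where
  "q_state d \<rho> \<longleftrightarrow> q_psd d \<rho> \<and> q_trace \<rho> = 1"

definition q_kron :: "complex mat \<Rightarrow> complex mat \<Rightarrow> complex mat" where
  "q_kron A B = mat (dim_row A * dim_row B) (dim_col A * dim_col B)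
     (\<lambda>(i,j). A $$ (i div dim_row B, j div dim_col B) * B $$ (i mod dim_row B, j mod dim_col B))"

definition q_maxent :: "nat \<Rightarrow> complex mat" where
  "q_maxent d = mat (d*d) (d*d)
     (\<lambda>(i,j). if i div d = i mod d \<and> j div d = j mod d then 1 / of_nat d else 0)"

definition q_block :: "nat \<Rightarrow> complex mat \<Rightarrow> nat \<Rightarrow> nat \<Rightarrow> complex mat" where
  "q_block d X a b = mat d d (\<lambda>(k,l). X $$ (a*d + k, b*d + l))"

definition q_unit :: "nat \<Rightarrow> nat \<Rightarrow> nat \<Rightarrow> complex mat" where
  "q_unit d i j = mat d d (\<lambda>(k,l). if k = i \<and> l = j then 1 else 0)"

text \<open>Tensor product of linear maps K (C^{d1} \<rightarrow> C^{e1} operators) and M (C^{d2} \<rightarrow> C^{e2}), acting on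
 C^{d1} \<otimes> C^{d2}: (K \<otimes> M)(\<Sum> E_ij \<otimes> X_ij) = \<Sum> K(E_ij) \<otimes> M(X_ij).\<close>
definition q_map_tensor :: "nat \<Rightarrow> nat \<Rightarrow> nat \<Rightarrow> nat \<Rightarrow>
     (complex mat \<Rightarrow> complex mat) \<Rightarrow> (complex mat \<Rightarrow> complex mat) \<Rightarrow> complex mat \<Rightarrow> complex mat" where
  "q_map_tensor d1 d2 e1 e2 K M X = mat (e1 * e2) (e1 * e2) (\<lambda>(p,q).
     \<Sum>i<d1. \<Sum>j<d1. K (q_unit d1 i j) $$ (p div e2, q div e2) * M (q_block d2 X i j) $$ (p mod e2, q mod e2))"

definition q_id_tensor :: "nat \<Rightarrow> nat \<Rightarrow> nat \<Rightarrow> (complex mat \<Rightarrow> complex mat) \<Rightarrow> complex mat \<Rightarrow> complex mat" where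
  "q_id_tensor n din dout L X = q_map_tensor n din n dout (\<lambda>Y. Y) L X"

definition q_linear :: "nat \<Rightarrow> nat \<Rightarrow> (complex mat \<Rightarrow> complex mat) \<Rightarrow> bool" where
  "q_linear din dout L \<longleftrightarrow>
     (\<forall>X \<in> carrier_mat din din. L X \<in> carrier_mat dout dout) \<and>
     (\<forall>X \<in> carrier_mat din din. \<forall>Y \<in> carrier_mat din din. L (X + Y) = L X + L Y) \<and>
     (\<forall>X \<in> carrier_mat din din. \<forall>c. L (c \<cdot>\<^sub>m X) = c \<cdot>\<^sub>m L X)"

definition q_CP :: "nat \<Rightarrow> nat \<Rightarrow> (complex mat \<Rightarrow> complex mat) \<Rightarrow> bool" where
  "q_CP din dout L \<longleftrightarrow> q_linear din dout L \<and>
     (\<forall>n>0. \<forall>X. q_psd (n*din) X \<longrightarrow> q_psd (n*dout) (q_id_tensor n din dout L X))"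

definition q_channel :: "nat \<Rightarrow> nat \<Rightarrow> (complex mat \<Rightarrow> complex mat) \<Rightarrow> bool" where
  "q_channel din dout L \<longleftrightarrow> q_CP din dout L \<and>
     (\<forall>X \<in> carrier_mat din din. q_trace (L X) = q_trace X)"

definition q_diag :: "nat \<Rightarrow> (nat \<Rightarrow> real) \<Rightarrow> complex mat" where
  "q_diag d ev = mat d d (\<lambda>(i,j). if i = j then complex_of_real (ev i) else 0)"

definition q_mfun :: "(real \<Rightarrow> real) \<Rightarrow> complex mat \<Rightarrow> complex mat" where
  "q_mfun f A = (SOME B. \<exists>U ev. q_unitary (dim_row A) U \<and>
       A = U * q_diag (dim_row A) ev * q_adj U \<and>
       B = U * q_diag (dim_row A) (f \<circ> ev) * q_adj U)"

definition q_lnsupp :: "real \<Rightarrow> real" where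
  "q_lnsupp x = (if x > 0 then ln x else 0)"

definition q_xlnx :: "real \<Rightarrow> real" where
  "q_xlnx x = (if x > 0 then x * ln x else 0)"

definition q_entropy :: "complex mat \<Rightarrow> real" where
  "q_entropy \<rho> = - Re (q_trace (q_mfun q_xlnx \<rho>))"

definition q_ptrace1 :: "nat \<Rightarrow> nat \<Rightarrow> complex mat \<Rightarrow> complex mat" where
  "q_ptrace1 d1 d2 X = mat d2 d2 (\<lambda>(i,j). \<Sum>k<d1. X $$ (k*d2 + i, k*d2 + j))"

definition q_cond_entropy :: "nat \<Rightarrow> nat \<Rightarrow> complex mat \<Rightarrow> real" where
  "q_cond_entropy dX dY \<omega> = q_entropy \<omega> - q_entropy (q_ptrace1 dX dY \<omega>)"

text \<open>Umegaki relative entropy (natural log) of a state \<rho> w.r.t. a PSD operator \<sigma>,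
 +\<infinity> unless supp \<rho> \<subseteq> supp \<sigma> (i.e. ker \<sigma> \<subseteq> ker \<rho>).\<close>
definition q_rel_entropy :: "complex mat \<Rightarrow> complex mat \<Rightarrow> ereal" where
  "q_rel_entropy \<rho> \<sigma> =
     (if \<forall>v \<in> carrier_vec (dim_row \<sigma>). \<sigma> *\<^sub>v v = 0\<^sub>v (dim_row \<sigma>) \<longrightarrow> \<rho> *\<^sub>v v = 0\<^sub>v (dim_row \<rho>)
      then ereal (Re (q_trace (\<rho> * q_mfun q_lnsupp \<rho>) - q_trace (\<rho> * q_mfun q_lnsupp \<sigma>)))
      else \<infinity>)"

definition q_channel_div :: "nat \<Rightarrow> nat \<Rightarrow> (complex mat \<Rightarrow> complex mat) \<Rightarrow> (complex mat \<Rightarrow> complex mat) \<Rightarrow> ereal" where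
  "q_channel_div din dout K L =
     (SUP \<rho> \<in> {\<rho>. \<exists>n>0. q_state (n*din) \<rho>}.
        q_rel_entropy (q_id_tensor (dim_row \<rho> div din) din dout K \<rho>) (q_id_tensor (dim_row \<rho> div din) din dout L \<rho>))"

definition q_replace :: "nat \<Rightarrow> complex mat \<Rightarrow> complex mat" where
  "q_replace dA Y = q_trace Y \<cdot>\<^sub>m 1\<^sub>m dA"

definition q_channel_cond_entropy ::
  "nat \<Rightarrow> nat \<Rightarrow> nat \<Rightarrow> nat \<Rightarrow> (complex mat \<Rightarrow> complex mat) \<Rightarrow> ereal" where
  "q_channel_cond_entropy dA' dB' dA dB N =
     - (INF M \<in> {M. q_channel dB' dB M}.
          q_channel_div (dA' * dB') (dA * dB) N (q_map_tensor dA' dB' dA dB (q_replace dA) M))"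

definition q_unitary_rep :: "('g, 'b) monoid_scheme \<Rightarrow> nat \<Rightarrow> ('g \<Rightarrow> complex mat) \<Rightarrow> bool" where
  "q_unitary_rep G d U \<longleftrightarrow>
     (\<forall>g \<in> carrier G. q_unitary d (U g)) \<and>
     (\<forall>g \<in> carrier G. \<forall>h \<in> carrier G. U (g \<otimes>\<^bsub>G\<^esub> h) = U g * U h)"

definition q_one_design :: "('g, 'b) monoid_scheme \<Rightarrow> nat \<Rightarrow> ('g \<Rightarrow> complex mat) \<Rightarrow> bool" where
  "q_one_design G d U \<longleftrightarrow>
     (\<forall>X \<in> carrier_mat d d.
        (1 / of_nat (card (carrier G))) \<cdot>\<^sub>m
          mat d d (\<lambda>(k,l). \<Sum>g \<in> carrier G. (U g * X * q_adj (U g)) $$ (k,l))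
        = (q_trace X / of_nat d) \<cdot>\<^sub>m 1\<^sub>m d)"

definition q_tele_covariant ::
  "nat \<Rightarrow> nat \<Rightarrow> nat \<Rightarrow> nat \<Rightarrow> (complex mat \<Rightarrow> complex mat) \<Rightarrow>
   ('g, 'b) monoid_scheme \<Rightarrow> ('h, 'c) monoid_scheme \<Rightarrow>
   ('g \<Rightarrow> complex mat) \<Rightarrow> ('h \<Rightarrow> complex mat) \<Rightarrow> ('g \<Rightarrow> complex mat) \<Rightarrow> ('h \<Rightarrow> complex mat) \<Rightarrow> bool" where
  "q_tele_covariant dA' dB' dA dB N G H UA UB V W \<longleftrightarrow>
     group G \<and> finite (carrier G) \<and> group H \<and> finite (carrier H) \<and>
     q_unitary_rep G dA' UA \<and> q_unitary_rep H dB' UB \<and>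
     q_one_design G dA' UA \<and> q_one_design H dB' UB \<and>
     q_unitary_rep G dA V \<and> q_unitary_rep H dB W \<and>
     (\<forall>\<rho> g h. q_state (dA' * dB') \<rho> \<longrightarrow> g \<in> carrier G \<longrightarrow> h \<in> carrier H \<longrightarrow>
        N (q_kron (UA g) (UB h) * \<rho> * q_adj (q_kron (UA g) (UB h)))
        = q_kron (V g) (W h) * N \<rho> * q_adj (q_kron (V g) (W h)))"

text \<open>Choi state \<Phi>^N on R_A A R_B B: first N applied to \<Phi>_{R_A A'} \<otimes> \<Phi>_{R_B B'}
 (which in the ordering R_A R_B A' B' is \<Phi> on (R_A R_B)(A'B')), then reordered
 from R_A R_B A B to R_A A R_B B.\<close>
definition q_choi_raw :: "nat \<Rightarrow> nat \<Rightarrow> nat \<Rightarrow> nat \<Rightarrow> (complex mat \<Rightarrow> complex mat) \<Rightarrow> complex mat" where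
  "q_choi_raw dA' dB' dA dB N = q_id_tensor (dA' * dB') (dA' * dB') (dA * dB) N (q_maxent (dA' * dB'))"

definition q_reorder_idx :: "nat \<Rightarrow> nat \<Rightarrow> nat \<Rightarrow> nat \<Rightarrow> nat" where
  "q_reorder_idx dB' dA dB i =
     (let x = i div (dB' * dB); y = i mod (dB' * dB);
          ra = x div dA; a = x mod dA; rb = y div dB; b = y mod dB
      in ((ra * dB' + rb) * dA + a) * dB + b)"

definition q_choi :: "nat \<Rightarrow> nat \<Rightarrow> nat \<Rightarrow> nat \<Rightarrow> (complex mat \<Rightarrow> complex mat) \<Rightarrow> complex mat" where
  "q_choi dA' dB' dA dB N =
     (let C = q_choi_raw dA' dB' dA dB N; n = dA' * dA * dB' * dB
      in mat n n (\<lambda>(i,j). C $$ (q_reorder_idx dB' dA dB i, q_reorder_idx dB' dA dB j)))"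

end

theory Submission
  imports Defs "Jordan_Normal_Form.Spectral_Radius"
begin

text \<open>Evaluating the channel divergence at the maximally entangled input gives the lower bound: the relative
  entropy of the Choi state against \<open>1 \<otimes> \<sigma>\<close> splits into a difference of entropies and a relative entropy
  on \<open>R\<^sub>B B\<close>, which is bounded below by Klein's inequality. It is attained by the reduced channel
  \<open>Y \<mapsto> tr\<^sub>A N(1/|A'| \<otimes> Y)\<close>.

  For that channel no other input does better: both maps are covariant under the same one-design, so a
  teleportation protocol produces \<open>N(\<rho>)\<close> and \<open>(R \<otimes> M)(\<rho>)\<close> from the two Choi matrices by one and the same
  Kraus map, and relative entropy does not increase under it.

  Data processing rests on the forms
  \<open>F\<^sub>t(\<rho>,\<sigma>) = sup\<^sub>Y 2 Re tr(\<rho> Y) - tr(\<sigma> Y Y\<^sup>*) - t tr(\<rho> Y\<^sup>* Y)\<close>, which are monotone by a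
  Schwarz inequality and satisfy \<open>D(\<rho>,\<sigma>) = \<integral> F\<^sub>t(\<rho>,\<sigma>) - 1/(1+t) dt\<close> over \<open>t \<ge> 0\<close>.\<close>

subsection \<open>Matrix preliminaries\<close>

text \<open>The simulating operators are built from the input and the representations alone, so
  whatever they do to the Choi matrix of N they also do to that of R \<otimes> M. They replace the
  reference of the Choi matrix by the reference of the input; this is why they depend on the input,
  and why completeness needs its trace to be 1. The constant log|A'| arises because the normalised
  Choi matrix of R \<otimes> M carries a factor 1/|A'| next to the identity on R_A A. The operator
  compared with the state on R_B B thus has trace 1/|A'|, and the least relative entropy is log|A'|
  instead of 0. In data processing the two operators need not commute. Each F_t is quadratic in Y
  and its maximum splits over pairs of eigenvectors, so that t is integrated in scalars only. The
  subtracted 1/(1+t) removes a logarithmic divergence that is the same before and after the map,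
  because traces are preserved. The support condition of the images is not given in advance: it is
  extracted from boundedness of the forms near t = 0.\<close>

lemma sum_lessThan_mult:
  fixes f :: "nat \<Rightarrow> 'a::comm_monoid_add"
  shows "(\<Sum>i<m*n. f i) = (\<Sum>a<m. \<Sum>b<n. f (a*n + b))"
proof (induction m)
  case (Suc m)
  have split: "(\<Sum>i<k+l. f i) = (\<Sum>i<k. f i) + (\<Sum>b<l. f (k + b))" for k l
    by (induction l) (simp_all add: add.assoc)
  have "(\<Sum>i<Suc m*n. f i) = (\<Sum>i\<in>{..<m*n + n}. f i)" by (simp add: add.commute)
  also have "\<dots> = (\<Sum>i<m*n. f i) + (\<Sum>b<n. f (m*n + b))"
    by (rule split)
  finally show ?case using Suc by simp
qed simp

lemma mult_add_less_mult: "a < m \<Longrightarrow> b < n \<Longrightarrow> a * n + b < m * (n::nat)"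
proof -
  assume "a < m" "b < n"
  then have "a * n + b < Suc a * n" by simp
  also have "\<dots> \<le> m * n" using \<open>a < m\<close> by (intro mult_le_mono1) simp
  finally show ?thesis .
qed

lemma div_mult_add [simp]: "b < n \<Longrightarrow> (a * n + b) div n = (a::nat)"
  by simp

lemma mod_mult_add [simp]: "b < n \<Longrightarrow> (a * n + b) mod n = (b::nat)"
  by simp

lemma less_mult_div_mod:
  assumes "i < m * (n::nat)" shows "i div n < m" "i mod n < n"
proof -
  have "n > 0" using assms by (cases n) auto
  then show "i div n < m" "i mod n < n" using assms by (simp_all add: less_mult_imp_div_less)
qed

lemma sum_if_eq:
  fixes f :: "nat \<Rightarrow> 'a::comm_monoid_add"
  shows "(\<Sum>j<n. if i = j then f j else 0) = (if i < n then f i else 0)"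
    "(\<Sum>j<n. if j = i then f j else 0) = (if i < n then f i else 0)"
  by (simp_all add: sum.delta sum.delta')

text \<open>The default rule turns an entry of a product into a scalar product of a row and a
  column. Without it, entries become explicit finite sums through the lemmas with carrier
  hypotheses, a form in which sums can be swapped and split along tensor factors.\<close>

declare index_mult_mat(1) [simp del]

lemma mult_square_carrier [simp]:
  "A \<in> carrier_mat d d \<Longrightarrow> B \<in> carrier_mat d d \<Longrightarrow> A * B \<in> carrier_mat d d"
  by simp

lemma eq_mat_dimI:
  assumes "\<And>i j. i < n \<Longrightarrow> j < m \<Longrightarrow> A $$ (i,j) = B $$ (i,j)"
    "dim_row A = n" "dim_col A = m" "dim_row B = n" "dim_col B = m"
  shows "A = B"
  using assms by (intro eq_matI) auto

lemma index_mult_carrier: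
  assumes "A \<in> carrier_mat n m" "B \<in> carrier_mat m k" "i < n" "j < k"
  shows "(A * B) $$ (i,j) = (\<Sum>l<m. A $$ (i,l) * B $$ (l,j))"
  using assms by (auto simp: index_mult_mat(1) scalar_prod_def lessThan_atLeast0)

lemma index_mult3_carrier:
  assumes "A \<in> carrier_mat n m" "B \<in> carrier_mat m k" "C \<in> carrier_mat k r" "i < n" "j < r"
  shows "(A * B * C) $$ (i,j) = (\<Sum>x<m. \<Sum>y<k. A $$ (i,x) * B $$ (x,y) * C $$ (y,j))"
proof -
  have "(A * B * C) $$ (i,j) = (\<Sum>y<k. \<Sum>x<m. A $$ (i,x) * B $$ (x,y) * C $$ (y,j))"
    using assms
    by (simp add: index_mult_carrier[of _ n k _ r] index_mult_carrier[of _ n m _ k] mult_carrier_mat[of _ n m _ k]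
        sum_distrib_right del: assoc_mult_mat)
  then show ?thesis by (simp add: sum.swap[of _ "{..<m}" "{..<k}"])
qed

lemma index_mult_vec:
  assumes "A \<in> carrier_mat n m" "v \<in> carrier_vec m" "i < n"
  shows "(A *\<^sub>v v) $ i = (\<Sum>l<m. A $$ (i,l) * v $ l)"
  using assms by (auto simp: scalar_prod_def lessThan_atLeast0)

lemma adj_carrier [simp, intro]: "A \<in> carrier_mat n m \<Longrightarrow> q_adj A \<in> carrier_mat m n"
  by (auto simp: q_adj_def)

lemma adj_dim [simp]: "dim_row (q_adj A) = dim_col A" "dim_col (q_adj A) = dim_row A"
  by (auto simp: q_adj_def)

lemma adj_index [simp]: "i < dim_col A \<Longrightarrow> j < dim_row A \<Longrightarrow> q_adj A $$ (i,j) = cnj (A $$ (j,i))"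
  by (auto simp: q_adj_def)

lemma adj_adj [simp]: "q_adj (q_adj A) = A"
  by (rule eq_matI) auto

lemma adj_mult:
  assumes "A \<in> carrier_mat n m" "B \<in> carrier_mat m k"
  shows "q_adj (A * B) = q_adj B * q_adj A"
proof (rule eq_matI)
  fix i j assume "i < dim_row (q_adj B * q_adj A)" "j < dim_col (q_adj B * q_adj A)"
  then have i: "i < k" and j: "j < n" using assms by auto
  show "q_adj (A * B) $$ (i,j) = (q_adj B * q_adj A) $$ (i,j)"
    using assms i j
    by (simp add: index_mult_carrier[OF adj_carrier[OF assms(2)] adj_carrier[OF assms(1)]]
        index_mult_carrier[OF assms]) (simp add: mult.commute)
qed (use assms in auto)

lemma adj_one [simp]: "q_adj (1\<^sub>m d) = 1\<^sub>m d"
  by (rule eq_matI) auto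

section \<open>Diagonal matrices with real entries\<close>

lemma diag_carrier [simp, intro]: "q_diag d p \<in> carrier_mat d d"
  by (simp add: q_diag_def)

lemma diag_index [simp]:
  "i < d \<Longrightarrow> j < d \<Longrightarrow> q_diag d p $$ (i,j) = (if i = j then complex_of_real (p i) else 0)"
  by (simp add: q_diag_def)

lemma dim_diag [simp]: "dim_row (q_diag d p) = d" "dim_col (q_diag d p) = d"
  by (simp_all add: q_diag_def)

lemma adj_diag [simp]: "q_adj (q_diag d p) = q_diag d p"
  by (rule eq_matI) (auto simp: q_diag_def)

lemma diag_cong: "(\<And>i. i < d \<Longrightarrow> p i = q i) \<Longrightarrow> q_diag d p = q_diag d q"
  by (rule eq_matI) (auto simp: q_diag_def)

lemma mult_diag_index:
  assumes "A \<in> carrier_mat n d" "i < n" "j < d"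
  shows "(A * q_diag d p) $$ (i,j) = A $$ (i,j) * p j"
proof -
  have "(A * q_diag d p) $$ (i,j) = (\<Sum>l<d. if l = j then A $$ (i,l) * p l else 0)"
    unfolding index_mult_carrier[OF assms(1) diag_carrier assms(2,3)]
    using assms by (intro sum.cong) auto
  then show ?thesis using assms by (simp add: sum_if_eq)
qed

lemma diag_mult_index:
  assumes "A \<in> carrier_mat d n" "i < d" "j < n"
  shows "(q_diag d p * A) $$ (i,j) = p i * A $$ (i,j)"
proof -
  have "(q_diag d p * A) $$ (i,j) = (\<Sum>l<d. if i = l then p i * A $$ (l,j) else 0)"
    unfolding index_mult_carrier[OF diag_carrier assms(1,2,3)]
    using assms by (intro sum.cong) auto
  then show ?thesis using assms by (simp add: sum_if_eq)
qed

lemma diag_mult_diag: "q_diag d p * q_diag d q = q_diag d (\<lambda>i. p i * q i)"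
  by (rule eq_matI) (auto simp: mult_diag_index[OF diag_carrier])

lemma sandwich_diag_index:
  assumes "U \<in> carrier_mat n d" "V \<in> carrier_mat n d" "i < n" "j < n"
  shows "(U * q_diag d p * q_adj V) $$ (i,j) = (\<Sum>l<d. p l * U $$ (i,l) * cnj (V $$ (j,l)))"
  using assms
  by (subst index_mult_carrier[of _ n d _ n])
    (auto simp: mult_diag_index intro!: sum.cong)

section \<open>Unitary matrices and traces\<close>

lemma unitaryD:
  assumes "q_unitary d U"
  shows "U \<in> carrier_mat d d" "q_adj U * U = 1\<^sub>m d" "U * q_adj U = 1\<^sub>m d"
  using assms mat_mult_left_right_inverse[of "q_adj U" d U] by (auto simp: q_unitary_def)

lemma unitary_adj: "q_unitary d U \<Longrightarrow> q_unitary d (q_adj U)"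
  by (simp add: q_unitary_def[of d "q_adj U"] unitaryD)

lemma unitary_mult:
  assumes "q_unitary d U" "q_unitary d V" shows "q_unitary d (U * V)"
proof -
  note u = unitaryD[OF assms(1)] and v = unitaryD[OF assms(2)]
  have "q_adj (U * V) * (U * V) = q_adj V * (q_adj U * U) * V"
    using u(1) v(1) by (simp add: adj_mult assoc_mult_mat[of _ d d _ d _ d])
  also have "\<dots> = 1\<^sub>m d" using u v by simp
  finally show ?thesis using u v by (simp add: q_unitary_def)
qed

lemma trace_carrier: "A \<in> carrier_mat d e \<Longrightarrow> q_trace A = (\<Sum>i<d. A $$ (i,i))"
  by (auto simp: q_trace_def)

lemma trace_mult:
  assumes "A \<in> carrier_mat n m" "B \<in> carrier_mat m n"
  shows "q_trace (A * B) = (\<Sum>i<n. \<Sum>j<m. A $$ (i,j) * B $$ (j,i))"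
  using assms by (subst trace_carrier[of _ n n]) (auto simp: index_mult_carrier)

lemma trace_comm:
  assumes "A \<in> carrier_mat n m" "B \<in> carrier_mat m n"
  shows "q_trace (A * B) = q_trace (B * A)"
  unfolding trace_mult[OF assms] trace_mult[OF assms(2,1)]
  by (subst sum.swap) (simp add: mult.commute)

lemma trace_mult_adj:
  assumes "A \<in> carrier_mat n m"
  shows "q_trace (A * q_adj A) = of_real (\<Sum>i<n. \<Sum>j<m. (cmod (A $$ (i,j)))\<^sup>2)"
  using assms unfolding trace_mult[OF assms adj_carrier[OF assms]]
  by (auto simp: complex_norm_square simp del: of_real_power intro!: sum.cong)

lemma trace_smult: "A \<in> carrier_mat d d \<Longrightarrow> q_trace (c \<cdot>\<^sub>m A) = c * q_trace A"
  by (auto simp: q_trace_def sum_distrib_left)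

subsection \<open>Spectral theorem\<close>

text \<open>Complete v to a basis, orthogonalise by Gram-Schmidt, which keeps the head v, and
  normalise. The scalar c absorbs the normalisation; an eigenvector matters only up to a
  factor.\<close>

lemma unitary_with_first_column:
  fixes v :: "complex vec"
  assumes v: "v \<in> carrier_vec n" "v \<noteq> 0\<^sub>v n"
  obtains W c where "q_unitary n W" "\<And>i. i < n \<Longrightarrow> W $$ (i,0) = c * v $ i" "n > 0"
proof -
  have n: "n > 0" using v by (cases n) auto
  define b where "b = basis_completion v"
  define ws where "ws = gram_schmidt n b"
  interpret cof_vec_space n "TYPE(complex)" .
  from basis_completion[OF v, folded b_def]
  have dist_b: "distinct b" and indep: "\<not> lin_dep (set b)" and b: "set b \<subseteq> carrier_vec n"
    and hdb: "hd b = v" and len_b: "length b = n" by auto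
  from hdb len_b n obtain vs where bv: "b = v # vs" by (cases b) auto
  from gram_schmidt_result[OF b dist_b indep refl, folded ws_def]
  have ws: "set ws \<subseteq> carrier_vec n" "corthogonal ws" "length ws = n" by (auto simp: len_b)
  from gram_schmidt_hd[OF v(1), of vs, folded bv] have hdws: "hd ws = v" unfolding ws_def .
  define nr where "nr = (\<lambda>j. \<Sum>i<n. (cmod (ws ! j $ i))\<^sup>2)"
  have sp: "(\<Sum>k<n. ws ! j $ k * cnj (ws ! i $ k)) = ws ! j \<bullet>c ws ! i" if "i < n" "j < n" for i j
  proof -
    have "ws ! i \<in> carrier_vec n" using ws that by auto
    then show ?thesis by (auto simp: scalar_prod_def lessThan_atLeast0)
  qed
  have nr: "of_real (nr j) = ws ! j \<bullet>c ws ! j" if "j < n" for j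
    unfolding sp[OF that that, symmetric] nr_def
    by (simp add: complex_norm_square del: of_real_power)
  have nr0: "nr j > 0" if "j < n" for j
  proof -
    have "nr j \<noteq> 0" using nr[OF that] corthogonalD[OF ws(2), of j j] that ws(3) by auto
    moreover have "nr j \<ge> 0" unfolding nr_def by (intro sum_nonneg) auto
    ultimately show ?thesis by simp
  qed
  define W where "W = mat n n (\<lambda>(i,j). ws ! j $ i / of_real (sqrt (nr j)))"
  have W: "W \<in> carrier_mat n n" by (simp add: W_def)
  have "q_adj W * W = 1\<^sub>m n"
  proof (rule eq_mat_dimI)
    fix i j assume ij: "i < n" "j < n"
    have "(q_adj W * W) $$ (i,j) = (\<Sum>k<n. cnj (W $$ (k,i)) * W $$ (k,j))"
      using W ij by (subst index_mult_carrier[OF adj_carrier[OF W] W]) auto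
    also have "\<dots> = (\<Sum>k<n. ws ! j $ k * cnj (ws ! i $ k) / (of_real (sqrt (nr i)) * of_real (sqrt (nr j))))"
      by (intro sum.cong) (auto simp: W_def ij)
    also have "\<dots> = (\<Sum>k<n. ws ! j $ k * cnj (ws ! i $ k)) / (of_real (sqrt (nr i)) * of_real (sqrt (nr j)))"
      by (simp add: sum_divide_distrib)
    also have "\<dots> = 1\<^sub>m n $$ (i,j)"
    proof (cases "i = j")
      case True
      have "of_real (sqrt (nr j)) * of_real (sqrt (nr j)) = (of_real (nr j) :: complex)"
        using nr0[OF ij(2)] by (simp flip: of_real_mult)
      moreover have "(of_real (nr j) :: complex) \<noteq> 0" using nr0[OF ij(2)] by simp
      ultimately show ?thesis using True ij sp[OF ij] nr[OF ij(2)] by simp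
    next
      case False
      then show ?thesis using corthogonalD[OF ws(2), of j i] ij ws(3) sp[OF ij] by simp
    qed
    finally show "(q_adj W * W) $$ (i,j) = 1\<^sub>m n $$ (i,j)" .
  qed (use W in auto)
  then have "q_unitary n W" using W by (simp add: q_unitary_def)
  moreover have "W $$ (i,0) = (1 / of_real (sqrt (nr 0))) * v $ i" if "i < n" for i
    using that n hdws ws(3) by (simp add: W_def) (metis hd_conv_nth length_0_conv not_less_zero)
  ultimately show ?thesis using that n by blast
qed

text \<open>Deflation: conjugating by a unitary whose first column is an eigenvector makes the first
  column of the matrix a multiple of the first basis vector. Hermiticity clears the first row as
  well and makes the eigenvalue real, so the induction continues with the remaining d x d
  block.\<close>

lemma hermitian_spectral:
  assumes "A \<in> carrier_mat d d" "q_adj A = A"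
  shows "\<exists>U p. q_unitary d U \<and> A = U * q_diag d p * q_adj U"
  using assms
proof (induction d arbitrary: A)
  case 0
  have "q_unitary 0 (1\<^sub>m 0)" by (auto simp: q_unitary_def)
  moreover have "A = 1\<^sub>m 0 * q_diag 0 (\<lambda>_. 0) * q_adj (1\<^sub>m 0)" using 0 by (intro eq_matI) auto
  ultimately show ?case by blast
next
  case (Suc d)
  let ?n = "Suc d"
  note A = Suc.prems(1)
  obtain e where "e \<in> spectrum A" using spectrum_non_empty[OF A] by auto
  then obtain v where v: "v \<in> carrier_vec ?n" "v \<noteq> 0\<^sub>v ?n" "A *\<^sub>v v = e \<cdot>\<^sub>v v"
    using A unfolding spectrum_def eigenvalue_def eigenvector_def by auto
  obtain W c where W: "q_unitary ?n W" and Wc: "\<And>i. i < ?n \<Longrightarrow> W $$ (i,0) = c * v $ i"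
    using unitary_with_first_column[OF v(1,2)] by metis
  note w = unitaryD[OF W]
  define B where "B = q_adj W * A * W"
  have B: "B \<in> carrier_mat ?n ?n" using w A by (simp add: B_def)
  have AB: "A = W * B * q_adj W"
  proof -
    have "W * B * q_adj W = (W * q_adj W) * A * (W * q_adj W)"
      unfolding B_def using w(1) A by (simp add: assoc_mult_mat[of _ ?n ?n _ ?n _ ?n])
    then show ?thesis using w A by simp
  qed
  have Bh: "q_adj B = B"
    unfolding B_def using w(1) A Suc.prems(2)
    by (simp add: adj_mult[of _ ?n ?n _ ?n] assoc_mult_mat[of _ ?n ?n _ ?n _ ?n])
  have B0: "B $$ (i,0) = (if i = 0 then e else 0)" if i: "i < ?n" for i
  proof -
    have "(A * W) $$ (k,0) = e * W $$ (k,0)" if k: "k < ?n" for k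
    proof -
      have "(A * W) $$ (k,0) = (\<Sum>l<?n. A $$ (k,l) * (c * v $ l))"
        using k by (subst index_mult_carrier[OF A w(1)]) (auto simp: Wc intro!: sum.cong)
      also have "\<dots> = c * (A *\<^sub>v v) $ k"
        unfolding index_mult_vec[OF A v(1) k] sum_distrib_left by (simp add: mult_ac)
      also have "\<dots> = e * W $$ (k,0)" using v k by (simp add: Wc)
      finally show ?thesis .
    qed
    then have "(q_adj W * (A * W)) $$ (i,0) = e * (q_adj W * W) $$ (i,0)"
      using i w A
      by (subst (1 2) index_mult_carrier[of _ ?n ?n _ ?n])
        (auto simp: sum_distrib_left mult_ac simp del: sum.lessThan_Suc)
    then show ?thesis using w A i by (simp add: B_def assoc_mult_mat[of _ ?n ?n _ ?n _ ?n])
  qed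
  have Bcnj: "B $$ (i,j) = cnj (B $$ (j,i))" if "i < ?n" "j < ?n" for i j
    using that B adj_index[of i B j] by (simp add: Bh)
  have B0': "B $$ (0,j) = (if j = 0 then e else 0)" if "j < ?n" for j
    using Bcnj[of 0 j] B0[of j] B0[of 0] that Bcnj[of 0 0] by (auto split: if_splits)
  have e: "of_real (Re e) = e" using Bcnj[of 0 0] B0[of 0] by (auto simp: complex_eq_iff)
  define A3 where "A3 = mat d d (\<lambda>(i,j). B $$ (Suc i, Suc j))"
  have "q_adj A3 = A3"
    by (rule eq_matI) (auto simp: A3_def simp flip: Bcnj)
  then obtain P p where P: "q_unitary d P" and A3P: "A3 = P * q_diag d p * q_adj P"
    using Suc.IH[of A3] by (auto simp: A3_def)
  note pp = unitaryD[OF P]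
  \<comment> \<open>The block sum of the 1 x 1 identity and \<open>P\<close>; the eigenvalue list
    \<open>q\<close> is shifted by one to match.\<close>
  define Q where "Q = mat ?n ?n (\<lambda>(i,j). if i = 0 \<or> j = 0 then (if i = j then 1 else 0) else P $$ (i - 1, j - 1))"
  define q where "q = (\<lambda>i. case i of 0 \<Rightarrow> Re e | Suc i \<Rightarrow> p i)"
  have Q: "Q \<in> carrier_mat ?n ?n" by (simp add: Q_def)
  have Q00: "Q $$ (0,0) = 1" "\<And>i. i < d \<Longrightarrow> Q $$ (Suc i,0) = 0" "\<And>i. i < d \<Longrightarrow> Q $$ (0,Suc i) = 0"
     "\<And>i j. i < d \<Longrightarrow> j < d \<Longrightarrow> Q $$ (Suc i,Suc j) = P $$ (i,j)"
    by (auto simp: Q_def)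
  have "q_adj Q * Q = 1\<^sub>m ?n"
  proof (rule eq_mat_dimI)
    fix i j assume ij: "i < ?n" "j < ?n"
    have "(q_adj Q * Q) $$ (i,j) = (\<Sum>k<?n. cnj (Q $$ (k,i)) * Q $$ (k,j))"
      using Q ij by (subst index_mult_carrier[OF adj_carrier[OF Q] Q]) auto
    also have "\<dots> = cnj (Q $$ (0,i)) * Q $$ (0,j) + (\<Sum>k<d. cnj (Q $$ (Suc k,i)) * Q $$ (Suc k,j))"
      by (rule sum.lessThan_Suc_shift)
    also have "\<dots> = 1\<^sub>m ?n $$ (i,j)"
    proof (cases i; cases j)
      fix i' j' assume s: "i = Suc i'" "j = Suc j'"
      then have ij': "i' < d" "j' < d" using ij by auto
      have "(\<Sum>k<d. cnj (Q $$ (Suc k,i)) * Q $$ (Suc k,j)) = (q_adj P * P) $$ (i',j')"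
        using pp ij' by (subst index_mult_carrier[of _ d d _ d]) (auto simp: s Q00)
      then show ?thesis using pp(2) ij' s by (simp add: Q00)
    qed (use ij in \<open>auto simp: Q00\<close>)
    finally show "(q_adj Q * Q) $$ (i,j) = 1\<^sub>m ?n $$ (i,j)" .
  qed (use Q in auto)
  then have Qu: "q_unitary ?n Q" using Q by (simp add: q_unitary_def)
  have BQ: "B = Q * q_diag ?n q * q_adj Q"
  proof (rule eq_mat_dimI)
    fix i j assume ij: "i < ?n" "j < ?n"
    have "(Q * q_diag ?n q * q_adj Q) $$ (i,j) = (\<Sum>l<?n. q l * Q $$ (i,l) * cnj (Q $$ (j,l)))"
      by (rule sandwich_diag_index[OF Q Q ij])
    also have "\<dots> = Re e * Q $$ (i,0) * cnj (Q $$ (j,0)) + (\<Sum>l<d. p l * Q $$ (i,Suc l) * cnj (Q $$ (j,Suc l)))"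
      by (subst sum.lessThan_Suc_shift) (simp add: q_def)
    also have "\<dots> = B $$ (i,j)"
    proof (cases i; cases j)
      fix i' j' assume s: "i = Suc i'" "j = Suc j'"
      then have ij': "i' < d" "j' < d" using ij by auto
      have "(\<Sum>l<d. p l * Q $$ (i,Suc l) * cnj (Q $$ (j,Suc l))) = A3 $$ (i',j')"
        unfolding A3P sandwich_diag_index[OF pp(1) pp(1) ij'] using ij' by (auto simp: s Q00)
      then show ?thesis using ij' s by (simp add: Q00 A3_def)
    qed (use ij B0 B0' e in \<open>auto simp: Q00\<close>)
    finally show "B $$ (i,j) = (Q * q_diag ?n q * q_adj Q) $$ (i,j)" by simp
  qed (use Q B in auto)
  have "A = (W * Q) * q_diag ?n q * q_adj (W * Q)"
    unfolding AB BQ using w(1) Q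
    by (simp add: adj_mult[of _ ?n ?n _ ?n] assoc_mult_mat[of _ ?n ?n _ ?n _ ?n])
  from this unitary_mult[OF W Qu] show ?case
    by (intro exI[of _ "W * Q"] exI[of _ q] conjI)
qed

text \<open>The definition chooses some diagonalisation, so the result must be shown independent of
  the choice. The unitary between two eigenbases has a nonzero entry (i,j) only where the
  eigenvalues p_i and q_j agree; hence it also intertwines the diagonals after f is applied.\<close>

lemma mfun_eq:
  assumes U: "q_unitary d U" and A: "A = U * q_diag d p * q_adj U"
  shows "q_mfun f A = U * q_diag d (f \<circ> p) * q_adj U"
proof -
  note u = unitaryD[OF U]
  have d: "dim_row A = d" using A u by auto
  have "V * q_diag d (f \<circ> q) * q_adj V = U * q_diag d (f \<circ> p) * q_adj U"
    if V: "q_unitary d V" and AV: "A = V * q_diag d q * q_adj V" for V q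
  proof -
    note v = unitaryD[OF V]
    define W where "W = q_adj U * V"
    have W: "W \<in> carrier_mat d d" using u v by (simp add: W_def)
    note as = assoc_mult_mat[of _ d d _ d _ d]
    have 1: "q_diag d p * W = q_adj U * A * V"
    proof -
      have "q_adj U * A * V = (q_adj U * U) * q_diag d p * W"
        unfolding A W_def using u(1) v(1) by (simp add: as)
      then show ?thesis using u by simp
    qed
    have 2: "W * q_diag d q = q_adj U * A * V"
    proof -
      have "q_adj U * A * V = W * q_diag d q * (q_adj V * V)"
        unfolding AV W_def using u(1) v(1) by (simp add: as)
      then show ?thesis using v W by simp
    qed
    have "q_diag d (f \<circ> p) * W = W * q_diag d (f \<circ> q)"
    proof (rule eq_mat_dimI)
      fix i j assume ij: "i < d" "j < d"
      have "p i * W $$ (i,j) = W $$ (i,j) * q j"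
        using 1 2 ij W by (metis diag_mult_index mult_diag_index)
      then have "W $$ (i,j) = 0 \<or> p i = q j" by auto
      then show "(q_diag d (f \<circ> p) * W) $$ (i,j) = (W * q_diag d (f \<circ> q)) $$ (i,j)"
        using ij W by (auto simp: diag_mult_index mult_diag_index)
    qed (use W in auto)
    then have "U * (q_diag d (f \<circ> p) * W) * q_adj V = U * (W * q_diag d (f \<circ> q)) * q_adj V" by simp
    moreover have "U * (q_diag d (f \<circ> p) * W) * q_adj V = U * q_diag d (f \<circ> p) * q_adj U * (V * q_adj V)"
      unfolding W_def using u(1) v(1) by (simp add: as)
    moreover have "U * (W * q_diag d (f \<circ> q)) * q_adj V = (U * q_adj U) * V * q_diag d (f \<circ> q) * q_adj V"
      unfolding W_def using u(1) v(1) by (simp add: as)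
    ultimately show ?thesis using u v by simp
  qed
  note uniq = this
  show ?thesis
    unfolding q_mfun_def d
  proof (rule some_equality)
    from U A show "\<exists>V q. q_unitary d V \<and> A = V * q_diag d q * q_adj V \<and>
        U * q_diag d (f \<circ> p) * q_adj U = V * q_diag d (f \<circ> q) * q_adj V"
      by (intro exI[of _ U] exI[of _ p] conjI refl)
  next
    fix B assume "\<exists>V q. q_unitary d V \<and> A = V * q_diag d q * q_adj V \<and> B = V * q_diag d (f \<circ> q) * q_adj V"
    then obtain V q where V: "q_unitary d V" "A = V * q_diag d q * q_adj V"
      and B: "B = V * q_diag d (f \<circ> q) * q_adj V" by (elim exE conjE)
    show "B = U * q_diag d (f \<circ> p) * q_adj U" unfolding B by (rule uniq[OF V])
  qed
qed

subsection \<open>Positive semidefinite matrices\<close>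

lemma quadratic_form_eq:
  assumes "A \<in> carrier_mat d d" "v \<in> carrier_vec d"
  shows "map_vec cnj v \<bullet> (A *\<^sub>v v) = (\<Sum>i<d. \<Sum>j<d. cnj (v $ i) * A $$ (i,j) * v $ j)"
proof -
  have "map_vec cnj v \<bullet> (A *\<^sub>v v) = (\<Sum>i<d. cnj (v $ i) * (A *\<^sub>v v) $ i)"
    using assms by (auto simp: scalar_prod_def lessThan_atLeast0)
  also have "\<dots> = (\<Sum>i<d. \<Sum>j<d. cnj (v $ i) * A $$ (i,j) * v $ j)"
    using assms by (intro sum.cong refl) (simp add: index_mult_vec sum_distrib_left mult.assoc del: index_mult_mat_vec)
  finally show ?thesis .
qed

lemma psdI:
  assumes "A \<in> carrier_mat d d"
    and "\<And>v. \<exists>r\<ge>0. (\<Sum>i<d. \<Sum>j<d. cnj (v i) * A $$ (i,j) * v j) = complex_of_real r"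
  shows "q_psd d A"
  unfolding q_psd_def
proof (intro conjI ballI)
  fix v :: "complex vec" assume v: "v \<in> carrier_vec d"
  obtain r where "r \<ge> 0" "map_vec cnj v \<bullet> (A *\<^sub>v v) = complex_of_real r"
    using assms(2)[of "\<lambda>i. v $ i"] quadratic_form_eq[OF assms(1) v] by auto
  then show "Im (map_vec cnj v \<bullet> (A *\<^sub>v v)) = 0" "Re (map_vec cnj v \<bullet> (A *\<^sub>v v)) \<ge> 0" by simp_all
qed fact

lemma psdD:
  assumes "q_psd d A"
  shows "A \<in> carrier_mat d d"
    "\<exists>r\<ge>0. (\<Sum>i<d. \<Sum>j<d. cnj (v i) * A $$ (i,j) * v j) = complex_of_real r"
proof -
  show A: "A \<in> carrier_mat d d" using assms by (simp add: q_psd_def)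
  let ?v = "vec d v"
  have "Im (map_vec cnj ?v \<bullet> (A *\<^sub>v ?v)) = 0" "Re (map_vec cnj ?v \<bullet> (A *\<^sub>v ?v)) \<ge> 0"
    using assms unfolding q_psd_def by auto
  moreover have "map_vec cnj ?v \<bullet> (A *\<^sub>v ?v) = (\<Sum>i<d. \<Sum>j<d. cnj (v i) * A $$ (i,j) * v j)"
    using quadratic_form_eq[OF A, of ?v] by simp
  ultimately show "\<exists>r\<ge>0. (\<Sum>i<d. \<Sum>j<d. cnj (v i) * A $$ (i,j) * v j) = complex_of_real r"
    by (intro exI[of _ "Re (map_vec cnj ?v \<bullet> (A *\<^sub>v ?v))"]) (simp add: complex_eq_iff)
qed

lemma gram_index:
  assumes "S \<in> carrier_mat d m" "i < d" "j < d"
  shows "(S * q_adj S) $$ (i,j) = (\<Sum>l<m. S $$ (i,l) * cnj (S $$ (j,l)))"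
  using assms by (subst index_mult_carrier[of _ d m _ d]) auto

lemma gram_quadratic_form:
  assumes "S \<in> carrier_mat d m"
  shows "(\<Sum>i<d. \<Sum>j<d. cnj (v i) * (S * q_adj S) $$ (i,j) * v j)
    = complex_of_real (\<Sum>l<m. (cmod (\<Sum>i<d. cnj (v i) * S $$ (i,l)))\<^sup>2)"
proof -
  have "(\<Sum>i<d. \<Sum>j<d. cnj (v i) * (S * q_adj S) $$ (i,j) * v j)
      = (\<Sum>i<d. \<Sum>j<d. \<Sum>l<m. (cnj (v i) * S $$ (i,l)) * cnj (cnj (v j) * S $$ (j,l)))"
    by (intro sum.cong refl) (simp add: gram_index[OF assms] sum_distrib_left sum_distrib_right mult_ac)
  also have "\<dots> = (\<Sum>l<m. \<Sum>i<d. \<Sum>j<d. (cnj (v i) * S $$ (i,l)) * cnj (cnj (v j) * S $$ (j,l)))"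
    by (simp add: sum.swap[of _ "{..<m}" "{..<d}"])
  also have "\<dots> = (\<Sum>l<m. (\<Sum>i<d. cnj (v i) * S $$ (i,l)) * cnj (\<Sum>i<d. cnj (v i) * S $$ (i,l)))"
    by (simp add: sum_product cnj_sum)
  also have "\<dots> = complex_of_real (\<Sum>l<m. (cmod (\<Sum>i<d. cnj (v i) * S $$ (i,l)))\<^sup>2)"
    by (simp add: complex_norm_square del: of_real_power cnj_sum)
  finally show ?thesis .
qed

lemma psd_gramI:
  assumes "S \<in> carrier_mat d m" shows "q_psd d (S * q_adj S)"
  using assms by (intro psdI) (auto simp: gram_quadratic_form simp del: of_real_sum intro!: sum_nonneg)

text \<open>Only the quadratic form is assumed real. Polarisation with the test vectors e_i + c e_j
  recovers the entries.\<close>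

lemma psd_hermitian:
  assumes "q_psd d A" shows "q_adj A = A"
proof (rule eq_mat_dimI)
  note A = psdD(1)[OF assms]
  have form: "Im (A $$ (i,i) + c * A $$ (i,j) + cnj c * A $$ (j,i) + cnj c * c * A $$ (j,j)) = 0"
    if "i < d" "j < d" for i j c
  proof -
    define v where "v = (\<lambda>k. (if k = i then 1 else 0) + (if k = j then c else 0))"
    obtain r where r: "(\<Sum>i<d. \<Sum>j<d. cnj (v i) * A $$ (i,j) * v j) = complex_of_real r"
      using psdD(2)[OF assms] by blast
    have inner: "(\<Sum>l<d. x l * v l) = x i + x j * c" for x
      unfolding v_def using that
      by (simp add: distrib_left sum.distrib if_distrib[of "\<lambda>y. _ * y"] sum_if_eq cong: if_cong)
    have outer: "(\<Sum>l<d. cnj (v l) * x l) = x i + cnj c * x j" for x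
      unfolding v_def using that
      by (simp add: distrib_right sum.distrib if_distrib[of cnj] if_distrib[of "\<lambda>y. y * _"] sum_if_eq cong: if_cong)
    have "(\<Sum>i<d. \<Sum>j<d. cnj (v i) * A $$ (i,j) * v j) = (\<Sum>i<d. cnj (v i) * (\<Sum>j<d. A $$ (i,j) * v j))"
      by (simp add: sum_distrib_left mult.assoc)
    also have "\<dots> = A $$ (i,i) + A $$ (i,j) * c + cnj c * (A $$ (j,i) + A $$ (j,j) * c)"
      unfolding inner outer ..
    finally have "A $$ (i,i) + c * A $$ (i,j) + cnj c * A $$ (j,i) + cnj c * c * A $$ (j,j) = of_real r"
      using r by (simp add: algebra_simps)
    then show ?thesis by simp
  qed
  fix i j assume ij: "i < d" "j < d"
  \<comment> \<open>The choice c = 0 makes the diagonal entries real; then c = 1 makes the imaginary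
    parts of the (i,j) and (j,i) entries opposite, and c = i makes their real parts equal.\<close>
  show "q_adj A $$ (i,j) = A $$ (i,j)"
    using ij A form[OF ij, of 0] form[OF ij(2,1), of 0] form[OF ij, of 1] form[OF ij, of \<i>]
    by (auto simp: complex_eq_iff)
qed (use psdD(1)[OF assms] in auto)

text \<open>The diagonalisation is carried as explicit data: once one is fixed for each of two
  matrices, traces, supports and entropies become finite sums over pairs of eigenvalues.\<close>

definition psd_decomp :: "nat \<Rightarrow> complex mat \<Rightarrow> complex mat \<Rightarrow> (nat \<Rightarrow> real) \<Rightarrow> bool" where
  "psd_decomp d A U p \<longleftrightarrow> q_unitary d U \<and> A = U * q_diag d p * q_adj U \<and> (\<forall>i<d. 0 \<le> p i)"

lemma psd_decompD:
  assumes "psd_decomp d A U p"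
  shows "U \<in> carrier_mat d d" "q_adj U * U = 1\<^sub>m d" "U * q_adj U = 1\<^sub>m d"
    "A = U * q_diag d p * q_adj U" "\<And>i. i < d \<Longrightarrow> 0 \<le> p i" "A \<in> carrier_mat d d"
    "q_mfun f A = U * q_diag d (f \<circ> p) * q_adj U"
proof -
  show U: "U \<in> carrier_mat d d" "q_adj U * U = 1\<^sub>m d" "U * q_adj U = 1\<^sub>m d"
    and A: "A = U * q_diag d p * q_adj U" and "\<And>i. i < d \<Longrightarrow> 0 \<le> p i"
    using assms unitaryD[of d U] by (auto simp: psd_decomp_def)
  show "A \<in> carrier_mat d d" unfolding A using U by simp
  show "q_mfun f A = U * q_diag d (f \<circ> p) * q_adj U"
    using mfun_eq[OF _ A] assms by (simp add: psd_decomp_def)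
qed

lemma psd_decomp_exists:
  assumes "q_psd d A" obtains U p where "psd_decomp d A U p"
proof -
  note A = psdD(1)[OF assms]
  obtain U p where U: "q_unitary d U" and Ap: "A = U * q_diag d p * q_adj U"
    using hermitian_spectral[OF A psd_hermitian[OF assms]] by blast
  note u = unitaryD[OF U]
  have nonneg: "0 \<le> p i" if i: "i < d" for i
  proof -
    have "q_adj U * A * U = (q_adj U * U) * q_diag d p * (q_adj U * U)"
      unfolding Ap using u(1) by (simp add: assoc_mult_mat[of _ d d _ d _ d])
    then have "(q_adj U * A * U) $$ (i,i) = p i" using u i by simp
    moreover have "(q_adj U * A * U) $$ (i,i) = (\<Sum>k<d. \<Sum>l<d. cnj (U $$ (k,i)) * A $$ (k,l) * U $$ (l,i))"
      using u(1) A i by (subst index_mult3_carrier[of _ d d _ d _ d]) auto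
    moreover obtain r where "r \<ge> 0" "(\<Sum>k<d. \<Sum>l<d. cnj (U $$ (k,i)) * A $$ (k,l) * U $$ (l,i)) = of_real r"
      using psdD(2)[OF assms, of "\<lambda>k. U $$ (k,i)"] by blast
    ultimately show ?thesis
      by (metis of_real_eq_iff)
  qed
  have "psd_decomp d A U p" unfolding psd_decomp_def by (intro conjI allI impI U Ap nonneg)
  then show ?thesis by (rule that)
qed

lemma psd_decomp_gramE:
  assumes "psd_decomp d A U p" obtains S where "S \<in> carrier_mat d d" "A = S * q_adj S"
proof -
  note u = psd_decompD[OF assms]
  let ?R = "q_diag d (\<lambda>i. sqrt (p i))"
  have "?R * ?R = q_diag d p"
    unfolding diag_mult_diag by (rule diag_cong) (simp add: u(5))
  then have "A = U * (?R * ?R) * q_adj U" using u(4) by simp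
  also have "\<dots> = (U * ?R) * q_adj (U * ?R)"
    using u(1) by (simp add: adj_mult[of _ d d _ d] assoc_mult_mat[of _ d d _ d _ d])
  finally show ?thesis using that[of "U * ?R"] u(1) by simp
qed

lemma psd_gramE:
  assumes "q_psd d A" obtains S where "S \<in> carrier_mat d d" "A = S * q_adj S"
  using psd_decomp_exists[OF assms] psd_decomp_gramE by metis

lemma psd_decomp_psd: "psd_decomp d A U p \<Longrightarrow> q_psd d A"
  using psd_decomp_gramE psd_gramI by metis

text \<open>With A the product of S and its adjoint, the form at v is the squared norm of the
  adjoint of S applied to v. This lets vanishing expectation values yield kernel vectors when the
  supports of a matrix and of its partial trace are compared.\<close>

lemma psd_kernel:
  assumes "q_psd d A" "v \<in> carrier_vec d"
    and "(\<Sum>i<d. \<Sum>j<d. cnj (v $ i) * A $$ (i,j) * v $ j) = 0"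
  shows "A *\<^sub>v v = 0\<^sub>v d"
proof -
  obtain S where S: "S \<in> carrier_mat d d" and A: "A = S * q_adj S" using psd_gramE[OF assms(1)] .
  have "(\<Sum>l<d. (cmod (\<Sum>i<d. cnj (v $ i) * S $$ (i,l)))\<^sup>2) = 0"
    using assms(3) unfolding A gram_quadratic_form[OF S] by (simp only: of_real_eq_0_iff)
  then have z: "(\<Sum>i<d. cnj (v $ i) * S $$ (i,l)) = 0" if "l < d" for l
    using that by (subst (asm) sum_nonneg_eq_0_iff) auto
  have "(q_adj S *\<^sub>v v) $ l = 0" if "l < d" for l
  proof -
    have "(q_adj S *\<^sub>v v) $ l = cnj (\<Sum>i<d. cnj (v $ i) * S $$ (i,l))"
      using that S assms(2) by (subst index_mult_vec[of _ d d]) (auto simp: mult.commute)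
    then show ?thesis using z[OF that] by simp
  qed
  then have "q_adj S *\<^sub>v v = 0\<^sub>v d" using S by (intro eq_vecI) auto
  moreover have "A *\<^sub>v v = S *\<^sub>v (q_adj S *\<^sub>v v)"
    unfolding A using S assms(2) by (intro assoc_mult_mat_vec) auto
  ultimately show ?thesis using S by (intro eq_vecI) auto
qed

text \<open>By cyclicity the trace is the squared Frobenius norm of the product of
  \<open>q_adj S\<close> and B, where S is a factor of A. B may be rectangular, as the Schwarz
  inequality for Kraus maps requires.\<close>

lemma psd_trace_mult_gram_nonneg:
  assumes "q_psd d A" "B \<in> carrier_mat d m"
  shows "0 \<le> Re (q_trace (A * (B * q_adj B)))"
proof -
  obtain S where S: "S \<in> carrier_mat d d" and A: "A = S * q_adj S" using psd_gramE[OF assms(1)] .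
  have "A * (B * q_adj B) = S * (q_adj S * (B * q_adj B))"
    unfolding A using S assms(2) by (intro assoc_mult_mat) auto
  then have "q_trace (A * (B * q_adj B)) = q_trace (q_adj S * (B * q_adj B) * S)"
    using S assms(2) trace_comm[of S d d "q_adj S * (B * q_adj B)"] by simp
  also have "q_adj S * (B * q_adj B) * S = (q_adj S * B) * (q_adj B * S)"
    using S assms(2) by (simp add: assoc_mult_mat[of _ d d _ m _ d] assoc_mult_mat[of _ d d _ d _ d]
        assoc_mult_mat[of _ d m _ d _ d] mult_carrier_mat[of _ d m _ d] mult_carrier_mat[of _ d d _ m] mult_carrier_mat[of _ m d _ d])
  also have "\<dots> = (q_adj S * B) * q_adj (q_adj S * B)"
    using S assms(2) by (simp add: adj_mult[of _ d d _ m])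
  also have "q_trace \<dots> = of_real (\<Sum>i<d. \<Sum>j<m. (cmod ((q_adj S * B) $$ (i,j)))\<^sup>2)"
    using S assms(2) by (intro trace_mult_adj) auto
  finally show ?thesis by (simp del: of_real_sum add: sum_nonneg)
qed

subsection \<open>Traces in terms of spectral decompositions\<close>

lemma trace_spectral_mult:
  assumes "U \<in> carrier_mat d d" "X \<in> carrier_mat d d"
  shows "q_trace (U * q_diag d p * q_adj U * X) = (\<Sum>i<d. p i * (q_adj U * X * U) $$ (i,i))"
proof -
  have "U * q_diag d p * q_adj U * X = U * (q_diag d p * (q_adj U * X))"
    using assms by (simp add: assoc_mult_mat[of _ d d _ d _ d])
  then have "q_trace (U * q_diag d p * q_adj U * X) = q_trace (q_diag d p * (q_adj U * X) * U)"
    using assms trace_comm[of U d d "q_diag d p * (q_adj U * X)"] by simp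
  also have "q_diag d p * (q_adj U * X) * U = q_diag d p * (q_adj U * X * U)"
    using assms by (simp add: assoc_mult_mat[of _ d d _ d _ d])
  finally have "q_trace (U * q_diag d p * q_adj U * X) = (\<Sum>i<d. (q_diag d p * (q_adj U * X * U)) $$ (i,i))"
    using assms by (simp add: trace_carrier[of _ d d])
  also have "\<dots> = (\<Sum>i<d. p i * (q_adj U * X * U) $$ (i,i))"
    using assms by (intro sum.cong refl) (simp add: diag_mult_index[of _ d d])
  finally show ?thesis .
qed

lemma unitary_row_norm:
  assumes "q_unitary d W" "i < d" shows "(\<Sum>j<d. (cmod (W $$ (i,j)))\<^sup>2) = 1"
proof -
  note w = unitaryD[OF assms(1)]
  have "complex_of_real (\<Sum>j<d. (cmod (W $$ (i,j)))\<^sup>2) = (W * q_adj W) $$ (i,i)"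
    unfolding gram_index[OF w(1) assms(2) assms(2)]
    by (simp add: complex_norm_square del: of_real_power)
  also have "\<dots> = 1" using w assms by simp
  finally show ?thesis by (simp only: of_real_eq_1_iff)
qed

lemma unitary_col_norm:
  assumes "q_unitary d W" "j < d" shows "(\<Sum>i<d. (cmod (W $$ (i,j)))\<^sup>2) = 1"
  using unitary_row_norm[OF unitary_adj[OF assms(1)] assms(2)] unitaryD(1)[OF assms(1)] assms(2) by simp

text \<open>The squared moduli form a doubly stochastic matrix w. Multiplying it by p_i or by q_j
  gives the Nussbaum-Szkola pair of distributions, whose classical relative entropy equals the
  quantum one; every estimate below is a statement about this pair.\<close>

definition overlap :: "complex mat \<Rightarrow> complex mat \<Rightarrow> nat \<Rightarrow> nat \<Rightarrow> complex" where
  "overlap U V i j = (q_adj U * V) $$ (i,j)"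

abbreviation weight :: "complex mat \<Rightarrow> complex mat \<Rightarrow> nat \<Rightarrow> nat \<Rightarrow> real" where
  "weight U V i j \<equiv> (cmod (overlap U V i j))\<^sup>2"

lemma overlap_sums:
  assumes "psd_decomp d \<rho> U p" "psd_decomp d \<sigma> V q"
  shows "i < d \<Longrightarrow> (\<Sum>j<d. weight U V i j) = 1"
    "j < d \<Longrightarrow> (\<Sum>i<d. weight U V i j) = 1"
proof -
  have "q_unitary d (q_adj U * V)"
    using assms by (auto simp: psd_decomp_def intro!: unitary_mult unitary_adj)
  then show "i < d \<Longrightarrow> (\<Sum>j<d. weight U V i j) = 1"
    "j < d \<Longrightarrow> (\<Sum>i<d. weight U V i j) = 1"
    by (simp_all add: overlap_def unitary_row_norm unitary_col_norm)
qed

lemma trace_spectral_overlap: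
  assumes "psd_decomp d \<rho> U p" "psd_decomp d \<sigma> V q"
  shows "q_trace (\<rho> * (V * q_diag d g * q_adj V))
    = of_real (\<Sum>i<d. \<Sum>j<d. weight U V i j * (p i * g j))"
proof -
  note u = psd_decompD[OF assms(1)] and v = psd_decompD[OF assms(2)]
  let ?W = "q_adj U * V"
  have W: "?W \<in> carrier_mat d d" using u v by simp
  have eq: "q_adj U * (V * q_diag d g * q_adj V) * U = ?W * q_diag d g * q_adj ?W"
    using u(1) v(1) by (simp add: assoc_mult_mat[of _ d d _ d _ d] adj_mult[of _ d d _ d])
  have "q_trace (\<rho> * (V * q_diag d g * q_adj V)) = (\<Sum>i<d. p i * (?W * q_diag d g * q_adj ?W) $$ (i,i))"
    unfolding u(4) using u(1) v(1) by (subst trace_spectral_mult) (simp_all add: eq)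
  also have "\<dots> = (\<Sum>i<d. \<Sum>j<d. of_real (weight U V i j * (p i * g j)))"
    using sandwich_diag_index[OF W W] 
    by (intro sum.cong refl)
       (simp add: overlap_def sum_distrib_left complex_norm_square mult_ac del: of_real_power)
  finally show ?thesis by simp
qed

lemma trace_psd_decomp:
  assumes "psd_decomp d \<rho> U p" shows "q_trace \<rho> = of_real (\<Sum>i<d. p i)"
proof -
  note u = psd_decompD[OF assms]
  have "q_trace \<rho> = q_trace (\<rho> * 1\<^sub>m d)" using u(6) by simp
  also have "\<dots> = (\<Sum>i<d. p i * (q_adj U * 1\<^sub>m d * U) $$ (i,i))"
    unfolding u(4) by (rule trace_spectral_mult[OF u(1)]) simp
  also have "\<dots> = of_real (\<Sum>i<d. p i)" using u by (simp add: adj_carrier[OF u(1)])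
  finally show ?thesis .
qed

lemma trace_mult_mfun_self:
  assumes "psd_decomp d \<rho> U p"
  shows "q_trace (\<rho> * q_mfun f \<rho>) = of_real (\<Sum>i<d. p i * f (p i))"
proof -
  note u = psd_decompD[OF assms]
  have "(\<Sum>j<d. weight U U i j * (p i * (f \<circ> p) j)) = p i * f (p i)" if "i < d" for i
  proof -
    have "(\<Sum>j<d. weight U U i j * (p i * (f \<circ> p) j))
        = (\<Sum>j<d. if i = j then p i * f (p j) else 0)"
      using that u by (intro sum.cong refl) (simp add: overlap_def)
    then show ?thesis using that by (simp add: sum_if_eq)
  qed
  then show ?thesis
    unfolding u(7) trace_spectral_overlap[OF assms assms] by simp
qed

text \<open>The kernel of sigma is spanned by the columns of V with eigenvalue 0. In the eigenbasis
  of rho the image of column j under rho has components p_i times the overlap (i,j), so the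
  inclusion of kernels is a condition on pairs of indices.\<close>

lemma support_iff_overlap:
  assumes "psd_decomp d \<rho> U p" "psd_decomp d \<sigma> V q"
  shows "(\<forall>v \<in> carrier_vec d. \<sigma> *\<^sub>v v = 0\<^sub>v d \<longrightarrow> \<rho> *\<^sub>v v = 0\<^sub>v d) \<longleftrightarrow>
    (\<forall>i<d. \<forall>j<d. q j = 0 \<longrightarrow> p i = 0 \<or> overlap U V i j = 0)" (is "?L \<longleftrightarrow> ?R")
proof -
  note u = psd_decompD[OF assms(1)] and v = psd_decompD[OF assms(2)]
  note as = assoc_mult_mat[of _ d d _ d _ d]
  let ?W = "q_adj U * V"
  have dU: "q_adj U *\<^sub>v (\<rho> *\<^sub>v x) = q_diag d p *\<^sub>v (q_adj U *\<^sub>v x)" if x: "x \<in> carrier_vec d" for x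
  proof -
    have "q_adj U * \<rho> = (q_adj U * U) * q_diag d p * q_adj U" unfolding u(4) using u(1) by (simp add: as)
    then have "q_adj U * \<rho> = q_diag d p * q_adj U" using u(2) adj_carrier[OF u(1)] by simp
    then show ?thesis
      by (metis assoc_mult_mat_vec adj_carrier diag_carrier u(1,6) x)
  qed
  have dV: "q_adj V *\<^sub>v (\<sigma> *\<^sub>v x) = q_diag d q *\<^sub>v (q_adj V *\<^sub>v x)" if x: "x \<in> carrier_vec d" for x
  proof -
    have "q_adj V * \<sigma> = (q_adj V * V) * q_diag d q * q_adj V" unfolding v(4) using v(1) by (simp add: as)
    then have "q_adj V * \<sigma> = q_diag d q * q_adj V" using v(2) adj_carrier[OF v(1)] by simp
    then show ?thesis
      by (metis assoc_mult_mat_vec adj_carrier diag_carrier v(1,6) x)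
  qed
  have dg: "(q_diag d r *\<^sub>v x) $ i = r i * x $ i" if "x \<in> carrier_vec d" "i < d" for r x i
  proof -
    have "(q_diag d r *\<^sub>v x) $ i = (\<Sum>l<d. if i = l then r l * x $ l else 0)"
      unfolding index_mult_vec[OF diag_carrier that] using that by (intro sum.cong) auto
    then show ?thesis using that by (simp add: sum_if_eq)
  qed
  have restore: "\<rho> *\<^sub>v x = U *\<^sub>v (q_adj U *\<^sub>v (\<rho> *\<^sub>v x))" if "x \<in> carrier_vec d" for x
  proof -
    have "U *\<^sub>v (q_adj U *\<^sub>v (\<rho> *\<^sub>v x)) = (U * q_adj U) *\<^sub>v (\<rho> *\<^sub>v x)"
      using u(1,6) that by (intro assoc_mult_mat_vec[symmetric]) auto
    then show ?thesis using u(3) mult_mat_vec_carrier[OF u(6) that] by simp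
  qed
  have kerU: "\<rho> *\<^sub>v x = 0\<^sub>v d \<longleftrightarrow> (\<forall>i<d. p i * (q_adj U *\<^sub>v x) $ i = 0)" if "x \<in> carrier_vec d" for x
  proof -
    have "\<rho> *\<^sub>v x = 0\<^sub>v d \<longleftrightarrow> q_adj U *\<^sub>v (\<rho> *\<^sub>v x) = 0\<^sub>v d"
    proof
      assume "\<rho> *\<^sub>v x = 0\<^sub>v d"
      then show "q_adj U *\<^sub>v (\<rho> *\<^sub>v x) = 0\<^sub>v d" using u(1) by (intro eq_vecI) auto
    next
      assume "q_adj U *\<^sub>v (\<rho> *\<^sub>v x) = 0\<^sub>v d"
      then have "\<rho> *\<^sub>v x = U *\<^sub>v 0\<^sub>v d" using restore[OF that] by simp
      then show "\<rho> *\<^sub>v x = 0\<^sub>v d" using u(1) by (intro eq_vecI) auto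
    qed
    also have "\<dots> \<longleftrightarrow> (\<forall>i<d. p i * (q_adj U *\<^sub>v x) $ i = 0)"
    proof -
      have c: "q_adj U *\<^sub>v x \<in> carrier_vec d" using adj_carrier[OF u(1)] that by (rule mult_mat_vec_carrier)
      show ?thesis unfolding dU[OF that] vec_eq_iff
        using dg[OF c] by (simp del: index_mult_mat_vec)
    qed
    finally show ?thesis .
  qed
  show ?thesis
  proof
    assume L: ?L
    show ?R
    proof (intro allI impI)
      fix i j assume ij: "i < d" "j < d" and qj: "q j = 0"
      \<comment> \<open>The eigenvector of sigma for the eigenvalue q_j = 0 serves as test
        vector.\<close>
      let ?x = "col V j"
      have x: "?x \<in> carrier_vec d" using v(1) ij by auto
      have Vx: "(q_adj V *\<^sub>v ?x) $ k = (q_adj V * V) $$ (k,j)" if "k < d" for k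
        using that v(1) ij by (simp add: index_mult_mat(1))
      have Ux: "(q_adj U *\<^sub>v ?x) $ k = overlap U V k j" if "k < d" for k
        using that u(1) v(1) ij by (simp add: index_mult_mat(1) overlap_def)
      have "q_adj V *\<^sub>v (\<sigma> *\<^sub>v ?x) = 0\<^sub>v d"
        unfolding dV[OF x]
      proof (rule eq_vecI)
        fix k assume "k < dim_vec (0\<^sub>v d :: complex vec)"
        then have k: "k < d" by simp
        have c: "q_adj V *\<^sub>v ?x \<in> carrier_vec d" using adj_carrier[OF v(1)] x by (rule mult_mat_vec_carrier)
        show "(q_diag d q *\<^sub>v (q_adj V *\<^sub>v ?x)) $ k = 0\<^sub>v d $ k"
          unfolding dg[OF c k] Vx[OF k] using v(2) k ij qj by simp
      qed simp
      then have "V *\<^sub>v (q_adj V *\<^sub>v (\<sigma> *\<^sub>v ?x)) = 0\<^sub>v d" using v(1) by (intro eq_vecI) auto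
      moreover have "V *\<^sub>v (q_adj V *\<^sub>v (\<sigma> *\<^sub>v ?x)) = (V * q_adj V) *\<^sub>v (\<sigma> *\<^sub>v ?x)"
        using v(1,6) x by (intro assoc_mult_mat_vec[symmetric]) (auto intro: mult_mat_vec_carrier)
      ultimately have "\<sigma> *\<^sub>v ?x = 0\<^sub>v d" using v(3) mult_mat_vec_carrier[OF v(6) x] by simp
      then have "\<rho> *\<^sub>v ?x = 0\<^sub>v d" using L x by blast
      then show "p i = 0 \<or> overlap U V i j = 0" using kerU[OF x] ij Ux[OF ij(1)] by auto
    qed
  next
    assume R: ?R
    show ?L
    proof (intro ballI impI)
      fix x assume x: "x \<in> carrier_vec d" and z: "\<sigma> *\<^sub>v x = 0\<^sub>v d"
      let ?y = "q_adj V *\<^sub>v x"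
      have y: "?y \<in> carrier_vec d" using adj_carrier[OF v(1)] x by (rule mult_mat_vec_carrier)
      have qy: "q j * ?y $ j = 0" if "j < d" for j
      proof -
        have "q_adj V *\<^sub>v (\<sigma> *\<^sub>v x) = 0\<^sub>v d" unfolding z using v(1) by (intro eq_vecI) auto
        then have "(q_diag d q *\<^sub>v ?y) $ j = 0" using that unfolding dV[OF x] by simp
        then show ?thesis unfolding dg[OF y that] .
      qed
      have "x = (V * q_adj V) *\<^sub>v x" using v(3) x by simp
      also have "\<dots> = V *\<^sub>v ?y" using v(1) x by (intro assoc_mult_mat_vec) auto
      finally have "q_adj U *\<^sub>v x = q_adj U *\<^sub>v (V *\<^sub>v ?y)" by simp
      also have "\<dots> = ?W *\<^sub>v ?y" using u(1) v(1) y by (intro assoc_mult_mat_vec[symmetric]) auto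
      finally have Ux: "q_adj U *\<^sub>v x = ?W *\<^sub>v ?y" .
      show "\<rho> *\<^sub>v x = 0\<^sub>v d"
        unfolding kerU[OF x]
      proof (intro allI impI)
        fix i assume i: "i < d"
        have W: "?W \<in> carrier_mat d d" using u v by simp
        have "of_real (p i) * (q_adj U *\<^sub>v x) $ i = (\<Sum>j<d. p i * overlap U V i j * ?y $ j)"
          unfolding Ux index_mult_vec[OF W y i] by (simp add: overlap_def sum_distrib_left mult.assoc)
        also have "\<dots> = 0"
        proof (intro sum.neutral ballI)
          fix j assume "j \<in> {..<d}"
          then have j: "j < d" by simp
          show "p i * overlap U V i j * ?y $ j = 0"
            using qy[OF j] R i j by (cases "q j = 0") auto
        qed
        finally show "p i * (q_adj U *\<^sub>v x) $ i = 0" .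
      qed
    qed
  qed
qed

lemma rel_entropy_spectral:
  assumes "psd_decomp d \<rho> U p" "psd_decomp d \<sigma> V q"
  shows "q_rel_entropy \<rho> \<sigma> =
    (if \<forall>i<d. \<forall>j<d. q j = 0 \<longrightarrow> p i = 0 \<or> overlap U V i j = 0
     then ereal (\<Sum>i<d. \<Sum>j<d. weight U V i j * (p i * (q_lnsupp (p i) - q_lnsupp (q j)))) else \<infinity>)"
proof -
  note u = psd_decompD[OF assms(1)] and v = psd_decompD[OF assms(2)]
  have dims: "dim_row \<rho> = d" "dim_row \<sigma> = d" using u(6) v(6) by auto
  \<comment> \<open>The weights in each row sum to 1, which spreads the entropy term over all pairs
    so that it can be merged with the cross term.\<close>
  have "(\<Sum>i<d. p i * q_lnsupp (p i))
      = (\<Sum>i<d. \<Sum>j<d. weight U V i j * (p i * q_lnsupp (p i)))"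
    by (intro sum.cong refl) (simp add: overlap_sums(1)[OF assms] flip: sum_distrib_right)
  then show ?thesis
    unfolding q_rel_entropy_def dims support_iff_overlap[OF assms] trace_mult_mfun_self[OF assms(1)]
    unfolding v(7) trace_spectral_overlap[OF assms]
    by (simp add: sum_subtractf[symmetric] right_diff_distrib del: of_real_sum)
qed

subsection \<open>Data processing for Kraus maps\<close>

text \<open>The quadratic form of the inverse of (left multiplication by sigma) + t (right
  multiplication by rho), evaluated at rho: this superoperator has the eigenvalues q_j + t p_i.
  Where the denominator vanishes, division by zero gives 0.\<close>

definition resolvent_form :: "nat \<Rightarrow> complex mat \<Rightarrow> (nat \<Rightarrow> real) \<Rightarrow> complex mat \<Rightarrow> (nat \<Rightarrow> real) \<Rightarrow> real \<Rightarrow> real" where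
  "resolvent_form d U p V q t = (\<Sum>i<d. \<Sum>j<d. weight U V i j * ((p i)\<^sup>2 / (q j + t * p i)))"

text \<open>Writing Y in the eigenbasis of sigma on the left and of rho on the right makes both
  quadratic terms diagonal in the entries of y at once. Maximising over Y thereby splits into one
  scalar problem per entry.\<close>

lemma variational_traces:
  assumes "psd_decomp d \<rho> U p" "psd_decomp d \<sigma> V q" "Y \<in> carrier_mat d d" and y: "y = q_adj V * Y * U"
  shows "q_trace (\<rho> * Y) = (\<Sum>i<d. \<Sum>j<d. p i * (overlap U V i j * y $$ (j,i)))"
    "Re (q_trace (\<sigma> * (Y * q_adj Y))) = (\<Sum>i<d. \<Sum>j<d. q j * (cmod (y $$ (j,i)))\<^sup>2)"
    "Re (q_trace (\<rho> * (q_adj Y * Y))) = (\<Sum>i<d. \<Sum>j<d. p i * (cmod (y $$ (j,i)))\<^sup>2)"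
proof -
  note u = psd_decompD[OF assms(1)] and v = psd_decompD[OF assms(2)] and Y = assms(3)
  note as = assoc_mult_mat[of _ d d _ d _ d]
  have yc: "y \<in> carrier_mat d d" unfolding y using u v Y by simp
  have W: "q_adj U * V \<in> carrier_mat d d" using u v by simp
  have ins: "q_adj U * Y * U = (q_adj U * V) * y"
  proof -
    have "(q_adj U * V) * y = q_adj U * (V * q_adj V) * Y * U"
      unfolding y using u(1) v(1) Y by (simp add: as)
    then show ?thesis using u(1) v(3) Y adj_carrier[OF u(1)] by (simp add: as)
  qed
  show "q_trace (\<rho> * Y) = (\<Sum>i<d. \<Sum>j<d. p i * (overlap U V i j * y $$ (j,i)))"
    unfolding u(4) trace_spectral_mult[OF u(1) Y] ins
    by (intro sum.cong refl) (simp add: index_mult_carrier[OF W yc] overlap_def sum_distrib_left)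
  have "q_adj V * (Y * q_adj Y) * V = y * q_adj y"
  proof -
    have "y * q_adj y = q_adj V * Y * (U * q_adj U) * q_adj Y * V"
      unfolding y using u(1) v(1) Y by (simp add: as adj_mult[of _ d d _ d])
    then show ?thesis using u(3) v(1) Y by (simp add: as)
  qed
  then have "q_trace (\<sigma> * (Y * q_adj Y)) = (\<Sum>j<d. q j * (y * q_adj y) $$ (j,j))"
    unfolding v(4) using trace_spectral_mult[OF v(1), of "Y * q_adj Y"] Y by simp
  also have "\<dots> = of_real (\<Sum>j<d. \<Sum>i<d. q j * (cmod (y $$ (j,i)))\<^sup>2)"
    unfolding of_real_sum
    by (intro sum.cong refl) (simp add: gram_index[OF yc] sum_distrib_left complex_norm_square del: of_real_power)
  finally show "Re (q_trace (\<sigma> * (Y * q_adj Y))) = (\<Sum>i<d. \<Sum>j<d. q j * (cmod (y $$ (j,i)))\<^sup>2)"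
    by (subst sum.swap) (simp only: Re_complex_of_real)
  have "q_adj U * (q_adj Y * Y) * U = q_adj y * y"
  proof -
    have "q_adj y * y = q_adj U * q_adj Y * (V * q_adj V) * Y * U"
      unfolding y using u(1) v(1) Y by (simp add: as adj_mult[of _ d d _ d])
    then show ?thesis using v(3) u(1) Y by (simp add: as)
  qed
  then have "q_trace (\<rho> * (q_adj Y * Y)) = (\<Sum>i<d. p i * (q_adj y * y) $$ (i,i))"
    unfolding u(4) using trace_spectral_mult[OF u(1), of "q_adj Y * Y"] Y by simp
  also have "\<dots> = of_real (\<Sum>i<d. \<Sum>j<d. p i * (cmod (y $$ (j,i)))\<^sup>2)"
    unfolding of_real_sum
  proof (intro sum.cong refl)
    fix i assume "i \<in> {..<d}"
    then have i: "i < d" by simp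
    have "(q_adj y * y) $$ (i,i) = (\<Sum>j<d. of_real ((cmod (y $$ (j,i)))\<^sup>2))"
      unfolding index_mult_carrier[OF adj_carrier[OF yc] yc i i] using yc i
      by (intro sum.cong refl) (simp add: complex_norm_square mult.commute del: of_real_power)
    then show "p i * (q_adj y * y) $$ (i,i) = (\<Sum>j<d. of_real (p i * (cmod (y $$ (j,i)))\<^sup>2))"
      by (simp add: sum_distrib_left)
  qed
  finally show "Re (q_trace (\<rho> * (q_adj Y * Y))) = (\<Sum>i<d. \<Sum>j<d. p i * (cmod (y $$ (j,i)))\<^sup>2)"
    by simp
qed

abbreviation variational :: "complex mat \<Rightarrow> complex mat \<Rightarrow> real \<Rightarrow> complex mat \<Rightarrow> real" where
  "variational \<rho> \<sigma> t Y \<equiv>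
    2 * Re (q_trace (\<rho> * Y)) - Re (q_trace (\<sigma> * (Y * q_adj Y))) - t * Re (q_trace (\<rho> * (q_adj Y * Y)))"

lemma variational_value:
  assumes "psd_decomp d \<rho> U p" "psd_decomp d \<sigma> V q" "Y \<in> carrier_mat d d" and y: "y = q_adj V * Y * U"
  shows "variational \<rho> \<sigma> t Y
    = (\<Sum>i<d. \<Sum>j<d. 2 * p i * Re (overlap U V i j * y $$ (j,i)) - (q j + t * p i) * (cmod (y $$ (j,i)))\<^sup>2)"
proof -
  have "Re (q_trace (\<rho> * Y)) = (\<Sum>i<d. \<Sum>j<d. p i * Re (overlap U V i j * y $$ (j,i)))"
    unfolding variational_traces(1)[OF assms] by simp
  then show ?thesis
    unfolding variational_traces(2,3)[OF assms]
    by (simp add: sum_distrib_left sum_subtractf sum.distrib distrib_right mult.assoc del: times_complex.sel)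
qed

lemma complete_square_bound:
  fixes w z :: complex and a c :: real
  assumes "c > 0"
  shows "2 * a * Re (w * z) - c * (cmod z)\<^sup>2 \<le> (cmod w)\<^sup>2 * (a\<^sup>2 / c)"
proof -
  have "2 * a * Re (w * z) \<le> 2 * \<bar>a\<bar> * (cmod w * cmod z)"
  proof -
    have "2 * a * Re (w * z) \<le> \<bar>2 * a * Re (w * z)\<bar>" by (rule abs_ge_self)
    also have "\<dots> = 2 * \<bar>a\<bar> * \<bar>Re (w * z)\<bar>" unfolding abs_mult by simp
    also have "\<dots> \<le> 2 * \<bar>a\<bar> * cmod (w * z)" by (intro mult_left_mono abs_Re_le_cmod) simp
    finally show ?thesis unfolding norm_mult .
  qed
  moreover have "0 \<le> (\<bar>a\<bar> * cmod w - c * cmod z)\<^sup>2 / c" using assms by simp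
  moreover have "(\<bar>a\<bar> * cmod w - c * cmod z)\<^sup>2 / c
      = (cmod w)\<^sup>2 * (a\<^sup>2 / c) - 2 * \<bar>a\<bar> * (cmod w * cmod z) + c * (cmod z)\<^sup>2"
    using assms by (simp add: power2_diff field_simps power2_eq_square)
  ultimately show ?thesis by linarith
qed

lemma variational_upper:
  assumes dec: "psd_decomp d \<rho> U p" "psd_decomp d \<sigma> V q" and Y: "Y \<in> carrier_mat d d" and t: "t \<ge> 0"
    and supp: "\<And>i j. i < d \<Longrightarrow> j < d \<Longrightarrow> q j = 0 \<Longrightarrow> p i = 0 \<or> overlap U V i j = 0"
  shows "variational \<rho> \<sigma> t Y
    \<le> resolvent_form d U p V q t"
  unfolding variational_value[OF dec Y refl] resolvent_form_def
proof (intro sum_mono)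
  fix i j assume "i \<in> {..<d}" "j \<in> {..<d}"
  then have ij: "i < d" "j < d" by auto
  have pq: "0 \<le> p i" "0 \<le> q j" using psd_decompD(5)[OF dec(1)] psd_decompD(5)[OF dec(2)] ij by auto
  let ?z = "(q_adj V * Y * U) $$ (j,i)"
  show "2 * p i * Re (overlap U V i j * ?z) - (q j + t * p i) * (cmod ?z)\<^sup>2
      \<le> weight U V i j * ((p i)\<^sup>2 / (q j + t * p i))"
  proof (cases "q j + t * p i = 0")
    \<comment> \<open>Here q_j = 0, so the support condition kills the linear term just where the
      quadratic one is missing; otherwise the supremum would be infinite.\<close>
    case True
    then have "q j = 0" using pq t by (smt (verit) mult_nonneg_nonneg)
    then show ?thesis using supp[OF ij] True by auto
  next
    case False
    then have "q j + t * p i > 0" using pq t by (smt (verit) mult_nonneg_nonneg)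
    then show ?thesis by (rule complete_square_bound)
  qed
qed

text \<open>Free of any support condition: entries with zero denominator are set to 0 and contribute
  0 on both sides. It can therefore be applied to the images under a Kraus map before their supports
  are known.\<close>

lemma variational_attained:
  assumes dec: "psd_decomp d \<rho> U p" "psd_decomp d \<sigma> V q"
  obtains Y where "Y \<in> carrier_mat d d"
    "variational \<rho> \<sigma> t Y
    = resolvent_form d U p V q t"
proof -
  note u = psd_decompD[OF dec(1)] and v = psd_decompD[OF dec(2)]
  \<comment> \<open>The maximiser of 2 a Re(w z) - c |z|^2 is z = (a/c) times the conjugate of
    w.\<close>
  define y where "y = mat d d (\<lambda>(j,i). of_real (p i / (q j + t * p i)) * cnj (overlap U V i j))"
  have y: "y \<in> carrier_mat d d" by (simp add: y_def)
  define Y where "Y = V * y * q_adj U"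
  have Y: "Y \<in> carrier_mat d d" using u v y by (simp add: Y_def)
  have "q_adj V * Y * U = (q_adj V * V) * y * (q_adj U * U)"
    unfolding Y_def using u(1) v(1) y by (simp add: assoc_mult_mat[of _ d d _ d _ d])
  then have yY: "y = q_adj V * Y * U" using u v y by simp
  have "2 * p i * Re (overlap U V i j * y $$ (j,i)) - (q j + t * p i) * (cmod (y $$ (j,i)))\<^sup>2
      = weight U V i j * ((p i)\<^sup>2 / (q j + t * p i))" if "i < d" "j < d" for i j
  proof -
    let ?w = "overlap U V i j" and ?r = "p i / (q j + t * p i)"
    have yij: "y $$ (j,i) = of_real ?r * cnj ?w" using that by (simp add: y_def)
    have "?w * y $$ (j,i) = of_real (?r * (cmod ?w)\<^sup>2)"
      unfolding yij of_real_mult complex_norm_square by simp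
    then have 1: "Re (?w * y $$ (j,i)) = ?r * (cmod ?w)\<^sup>2" by (simp only: Re_complex_of_real)
    have 2: "(cmod (y $$ (j,i)))\<^sup>2 = ?r\<^sup>2 * (cmod ?w)\<^sup>2"
      unfolding yij norm_mult complex_mod_cnj norm_of_real power_mult_distrib power2_abs ..
    have 3: "2 * a * (a / s * w) - s * ((a / s)\<^sup>2 * w) = w * (a\<^sup>2 / s)" for a s w :: real
      by (cases "s = 0") (simp_all add: field_simps power2_eq_square)
    show ?thesis unfolding 1 2 by (rule 3)
  qed
  then have "variational \<rho> \<sigma> t Y
    = resolvent_form d U p V q t"
    unfolding variational_value[OF dec Y yY] resolvent_form_def by simp
  then show ?thesis using that Y by blast
qed

text \<open>The size is passed explicitly so that an empty sum is still a matrix of definite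
  dimensions.\<close>

definition mat_sum :: "nat \<Rightarrow> nat \<Rightarrow> ('i \<Rightarrow> complex mat) \<Rightarrow> 'i set \<Rightarrow> complex mat" where
  "mat_sum r c M I = mat r c (\<lambda>(a,b). \<Sum>i\<in>I. M i $$ (a,b))"

lemma mat_sum_carrier [simp]: "mat_sum r c M I \<in> carrier_mat r c"
  by (simp add: mat_sum_def)

lemma mat_sum_index: "a < r \<Longrightarrow> b < c \<Longrightarrow> mat_sum r c M I $$ (a,b) = (\<Sum>i\<in>I. M i $$ (a,b))"
  by (simp add: mat_sum_def)

lemma trace_mult_mat_sum:
  assumes "A \<in> carrier_mat n m" "\<And>i. i \<in> I \<Longrightarrow> M i \<in> carrier_mat m n"
  shows "q_trace (A * mat_sum m n M I) = (\<Sum>i\<in>I. q_trace (A * M i))"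
proof -
  have "q_trace (A * mat_sum m n M I) = (\<Sum>a<n. \<Sum>b<m. \<Sum>i\<in>I. A $$ (a,b) * M i $$ (b,a))"
    by (simp add: trace_mult[OF assms(1) mat_sum_carrier] mat_sum_index sum_distrib_left)
  also have "\<dots> = (\<Sum>i\<in>I. \<Sum>a<n. \<Sum>b<m. A $$ (a,b) * M i $$ (b,a))"
    by (simp add: sum.swap[of _ I])
  also have "\<dots> = (\<Sum>i\<in>I. q_trace (A * M i))"
    by (intro sum.cong refl) (simp add: trace_mult[OF assms(1) assms(2)])
  finally show ?thesis .
qed

lemma adj_mat_sum:
  assumes "\<And>i. i \<in> I \<Longrightarrow> M i \<in> carrier_mat r c"
  shows "q_adj (mat_sum r c M I) = mat_sum c r (\<lambda>i. q_adj (M i)) I"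
proof (rule eq_mat_dimI)
  fix a b assume ab: "a < c" "b < r"
  have "q_adj (M i) $$ (a,b) = cnj (M i $$ (b,a))" if "i \<in> I" for i
    using assms[OF that] ab by simp
  then show "q_adj (mat_sum r c M I) $$ (a,b) = mat_sum c r (\<lambda>i. q_adj (M i)) I $$ (a,b)"
    using ab by (simp add: mat_sum_def)
qed (auto simp: mat_sum_def)

section \<open>Kraus maps and their duals\<close>

definition kraus :: "nat \<Rightarrow> ('i \<Rightarrow> complex mat) \<Rightarrow> 'i set \<Rightarrow> complex mat \<Rightarrow> complex mat" where
  "kraus e K I X = mat_sum e e (\<lambda>i. K i * X * q_adj (K i)) I"

lemma kraus_carrier [simp]: "kraus e K I X \<in> carrier_mat e e"
  by (simp add: kraus_def)

text \<open>Cyclicity moves the map to the other factor and thereby exhibits the dual map, along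
  which test operators are pulled back.\<close>

lemma trace_kraus_mult:
  assumes "\<And>i. i \<in> I \<Longrightarrow> K i \<in> carrier_mat e d" "X \<in> carrier_mat d d" "Y \<in> carrier_mat e e"
  shows "q_trace (kraus e K I X * Y) = (\<Sum>i\<in>I. q_trace (X * (q_adj (K i) * Y * K i)))"
proof -
  have "q_trace (kraus e K I X * Y) = q_trace (Y * kraus e K I X)"
    using assms by (intro trace_comm[of _ e e]) auto
  also have "\<dots> = (\<Sum>i\<in>I. q_trace (Y * (K i * X * q_adj (K i))))"
    unfolding kraus_def using assms by (intro trace_mult_mat_sum) (auto intro!: mult_carrier_mat)
  also have "\<dots> = (\<Sum>i\<in>I. q_trace (X * (q_adj (K i) * Y * K i)))"
  proof (intro sum.cong refl)
    fix i assume "i \<in> I"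
    note k = assms(1)[OF this]
    have "Y * (K i * X * q_adj (K i)) = (Y * K i * X) * q_adj (K i)"
      using k assms(2,3) by (auto simp: assoc_mult_mat[of _ e e _ d _ d] assoc_mult_mat[of _ e e _ d _ e]
         assoc_mult_mat[of _ e d _ d _ e] mult_carrier_mat[of _ e e _ d] mult_carrier_mat[of _ e d _ d] mult_carrier_mat[of _ d d _ e])
    then have "q_trace (Y * (K i * X * q_adj (K i))) = q_trace (q_adj (K i) * (Y * K i * X))"
      using k assms(2,3) trace_comm[of "Y * K i * X" e d "q_adj (K i)"]
      by (simp add: mult_carrier_mat[of _ e e _ d] mult_carrier_mat[of _ e d _ d])
    also have "q_adj (K i) * (Y * K i * X) = (q_adj (K i) * Y * K i) * X"
      using k assms(2,3) by (auto simp: assoc_mult_mat[of _ d e _ e _ d] assoc_mult_mat[of _ d e _ d _ d]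
         assoc_mult_mat[of _ e e _ d _ d] mult_carrier_mat[of _ e e _ d] mult_carrier_mat[of _ e d _ d])
    also have "q_trace \<dots> = q_trace (X * (q_adj (K i) * Y * K i))"
      using k assms(2,3) by (intro trace_comm[of _ d d]) (auto intro!: mult_carrier_mat)
    finally show "q_trace (Y * (K i * X * q_adj (K i))) = q_trace (X * (q_adj (K i) * Y * K i))" .
  qed
  finally show ?thesis .
qed

lemma trace_sesquilinear:
  assumes \<sigma>: "\<sigma> \<in> carrier_mat d d" and X: "X \<in> carrier_mat d e" and V: "V \<in> carrier_mat d e"
  shows "q_trace (\<sigma> * ((X - V) * q_adj (X - V))) = q_trace (\<sigma> * (X * q_adj X)) - q_trace (\<sigma> * (X * q_adj V))
     - q_trace (\<sigma> * (V * q_adj X)) + q_trace (\<sigma> * (V * q_adj V))"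
proof -
  have idx: "(A * q_adj B) $$ (i,j) = (\<Sum>l<e. A $$ (i,l) * cnj (B $$ (j,l)))"
    if "A \<in> carrier_mat d e" "B \<in> carrier_mat d e" "i < d" "j < d" for A B i j
    using that by (subst index_mult_carrier[of _ d e _ d]) auto
  have XV: "X - V \<in> carrier_mat d e" using X V by auto
  have "\<sigma> $$ (i,j) * ((X - V) * q_adj (X - V)) $$ (j,i) = \<sigma> $$ (i,j) * (X * q_adj X) $$ (j,i)
    - \<sigma> $$ (i,j) * (X * q_adj V) $$ (j,i) - \<sigma> $$ (i,j) * (V * q_adj X) $$ (j,i)
    + \<sigma> $$ (i,j) * (V * q_adj V) $$ (j,i)" if "i < d" "j < d" for i j
    using that X V by (simp add: idx XV algebra_simps sum_subtractf sum.distrib)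
  then have "(\<Sum>i<d. \<Sum>j<d. \<sigma> $$ (i,j) * ((X - V) * q_adj (X - V)) $$ (j,i))
     = (\<Sum>i<d. \<Sum>j<d. \<sigma> $$ (i,j) * (X * q_adj X) $$ (j,i)) - (\<Sum>i<d. \<Sum>j<d. \<sigma> $$ (i,j) * (X * q_adj V) $$ (j,i))
      - (\<Sum>i<d. \<Sum>j<d. \<sigma> $$ (i,j) * (V * q_adj X) $$ (j,i)) + (\<Sum>i<d. \<Sum>j<d. \<sigma> $$ (i,j) * (V * q_adj V) $$ (j,i))"
    unfolding sum_subtractf[symmetric] sum.distrib[symmetric] by (intro sum.cong refl) simp
  then show ?thesis
    using trace_mult[OF \<sigma>, of "(X - V) * q_adj (X - V)"] trace_mult[OF \<sigma>, of "X * q_adj X"]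
      trace_mult[OF \<sigma>, of "X * q_adj V"] trace_mult[OF \<sigma>, of "V * q_adj X"] trace_mult[OF \<sigma>, of "V * q_adj V"]
      X V XV by (auto simp: mult_carrier_mat[of _ d e _ d])
qed

lemma adj_kraus_dual:
  assumes K: "\<And>i. i \<in> I \<Longrightarrow> K i \<in> carrier_mat e d" and Y: "Y \<in> carrier_mat e e"
  shows "q_adj (mat_sum d d (\<lambda>i. q_adj (K i) * Y * K i) I) = mat_sum d d (\<lambda>i. q_adj (K i) * q_adj Y * K i) I"
proof -
  have "q_adj (q_adj (K i) * Y * K i) = q_adj (K i) * q_adj Y * K i" if "i \<in> I" for i
    using K[OF that] Y by (simp add: adj_mult[of _ d e _ d] adj_mult[of _ e e _ d] mult_carrier_mat[of _ e e _ d]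
        assoc_mult_mat[of _ d e _ e _ d])
  then show ?thesis
    using K Y by (subst adj_mat_sum) (auto intro!: mult_carrier_mat eq_matI simp: mat_sum_def)
qed

text \<open>With \<open>B\<^sub>i = K\<^sub>i\<^sup>* Y - Z K\<^sub>i\<^sup>*\<close> this is the positivity of \<open>\<Sum>\<^sub>i tr (\<sigma> B\<^sub>i B\<^sub>i\<^sup>*)\<close>.\<close>
lemma kraus_Schwarz:
  assumes K: "\<And>i. i \<in> I \<Longrightarrow> K i \<in> carrier_mat e d"
    and complete: "mat_sum d d (\<lambda>i. q_adj (K i) * K i) I = 1\<^sub>m d"
    and \<sigma>: "q_psd d \<sigma>" and Y: "Y \<in> carrier_mat e e"
    and Z: "Z = mat_sum d d (\<lambda>i. q_adj (K i) * Y * K i) I"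
  shows "Re (q_trace (\<sigma> * (Z * q_adj Z))) \<le> Re (q_trace (kraus e K I \<sigma> * (Y * q_adj Y)))"
proof -
  note \<sigma>c = psdD(1)[OF \<sigma>]
  have Zc: "Z \<in> carrier_mat d d" by (simp add: Z)
  have Zadj: "q_adj Z = mat_sum d d (\<lambda>i. q_adj (K i) * q_adj Y * K i) I"
    unfolding Z by (rule adj_kraus_dual[OF K Y])
  let ?X = "\<lambda>i. q_adj (K i) * Y" and ?V = "\<lambda>i. Z * q_adj (K i)"
  \<comment> \<open>Each of the four terms is rearranged by cyclicity until the index i occurs in a
    single factor with a known sum: the dual map at Y and at its adjoint give Z and its adjoint, and
    completeness gives the identity.\<close>
  have split: "q_trace (\<sigma> * ((?X i - ?V i) * q_adj (?X i - ?V i)))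
     = q_trace (\<sigma> * (q_adj (K i) * (Y * q_adj Y) * K i)) - q_trace ((q_adj Z * \<sigma>) * (q_adj (K i) * Y * K i))
       - q_trace ((\<sigma> * Z) * (q_adj (K i) * q_adj Y * K i)) + q_trace ((q_adj Z * \<sigma> * Z) * (q_adj (K i) * K i))"
    if i: "i \<in> I" for i
  proof -
    note k = K[OF i]
    note car = mult_carrier_mat[of _ d e _ e] mult_carrier_mat[of _ d d _ e] mult_carrier_mat[of _ e e _ d]
      mult_carrier_mat[of _ d e _ d] mult_carrier_mat[of _ e d _ d]
    note as = assoc_mult_mat[of _ d e _ e _ d] assoc_mult_mat[of _ d e _ e _ e] assoc_mult_mat[of _ e e _ e _ d]
      assoc_mult_mat[of _ d d _ d _ d] assoc_mult_mat[of _ d d _ e _ d] assoc_mult_mat[of _ d d _ e _ e]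
      assoc_mult_mat[of _ d e _ d _ d] assoc_mult_mat[of _ e d _ d _ d] assoc_mult_mat[of _ e e _ d _ d]
    have X: "?X i \<in> carrier_mat d e" and V: "?V i \<in> carrier_mat d e" using k Y Zc by (auto intro!: mult_carrier_mat)
    have Xa: "q_adj (?X i) = q_adj Y * K i" using k Y by (simp add: adj_mult[of _ d e _ e])
    have Va: "q_adj (?V i) = K i * q_adj Z" using k Zc by (simp add: adj_mult[of _ d d _ e])
    have 1: "?X i * q_adj (?X i) = q_adj (K i) * (Y * q_adj Y) * K i"
      unfolding Xa using k Y by (simp add: as car)
    have 2: "?X i * q_adj (?V i) = q_adj (K i) * Y * K i * q_adj Z"
      unfolding Va using k Y Zc by (simp add: as car)
    have 3: "?V i * q_adj (?X i) = Z * (q_adj (K i) * q_adj Y * K i)"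
      unfolding Xa using k Y Zc by (simp add: as car)
    have 4: "?V i * q_adj (?V i) = Z * (q_adj (K i) * K i) * q_adj Z"
      unfolding Va using k Y Zc by (simp add: as car)
    have cyc: "q_trace (\<sigma> * (B * q_adj Z)) = q_trace ((q_adj Z * \<sigma>) * B)" if "B \<in> carrier_mat d d" for B
    proof -
      have "q_trace (\<sigma> * (B * q_adj Z)) = q_trace ((\<sigma> * B) * q_adj Z)" using that Zc \<sigma>c by (simp add: as)
      also have "\<dots> = q_trace (q_adj Z * (\<sigma> * B))" using that Zc \<sigma>c by (intro trace_comm[of _ d d]) auto
      finally show ?thesis using that Zc \<sigma>c by (simp add: as)
    qed
    have c1: "q_adj (K i) * Y * K i \<in> carrier_mat d d" and c2: "Z * (q_adj (K i) * K i) \<in> carrier_mat d d"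
      and c3: "q_adj (K i) * q_adj Y * K i \<in> carrier_mat d d" and c4: "q_adj (K i) * K i \<in> carrier_mat d d"
      using k Y Zc by (auto intro!: mult_carrier_mat)
    show ?thesis
      unfolding trace_sesquilinear[OF \<sigma>c X V] 1 2 3 4 cyc[OF c1] cyc[OF c2]
      using assoc_mult_mat[OF \<sigma>c Zc c3] assoc_mult_mat[of "q_adj Z * \<sigma>" d d Z d, OF _ Zc c4] Zc \<sigma>c by simp
  qed
  have "0 \<le> (\<Sum>i\<in>I. Re (q_trace (\<sigma> * ((?X i - ?V i) * q_adj (?X i - ?V i)))))"
    using K Y Zc \<sigma> by (intro sum_nonneg psd_trace_mult_gram_nonneg[of d _ _ e]) (auto intro!: minus_carrier_mat mult_carrier_mat)
  also have "\<dots> = Re ((\<Sum>i\<in>I. q_trace (\<sigma> * (q_adj (K i) * (Y * q_adj Y) * K i)))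
      - (\<Sum>i\<in>I. q_trace ((q_adj Z * \<sigma>) * (q_adj (K i) * Y * K i)))
      - (\<Sum>i\<in>I. q_trace ((\<sigma> * Z) * (q_adj (K i) * q_adj Y * K i)))
      + (\<Sum>i\<in>I. q_trace ((q_adj Z * \<sigma> * Z) * (q_adj (K i) * K i))))"
    unfolding sum.distrib[symmetric] sum_subtractf[symmetric] Re_sum
    by (intro sum.cong refl arg_cong[of _ _ Re] split)
  also have "(\<Sum>i\<in>I. q_trace (\<sigma> * (q_adj (K i) * (Y * q_adj Y) * K i))) = q_trace (kraus e K I \<sigma> * (Y * q_adj Y))"
    using K \<sigma>c Y by (intro trace_kraus_mult[symmetric]) auto
  also have "(\<Sum>i\<in>I. q_trace ((q_adj Z * \<sigma>) * (q_adj (K i) * Y * K i))) = q_trace ((q_adj Z * \<sigma>) * Z)"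
    unfolding Z using K Y \<sigma>c by (intro trace_mult_mat_sum[symmetric]) (auto intro!: mult_carrier_mat)
  also have "(\<Sum>i\<in>I. q_trace ((\<sigma> * Z) * (q_adj (K i) * q_adj Y * K i))) = q_trace ((\<sigma> * Z) * q_adj Z)"
    unfolding Zadj using K Y \<sigma>c Zc by (intro trace_mult_mat_sum[symmetric]) (auto intro!: mult_carrier_mat)
  also have "(\<Sum>i\<in>I. q_trace ((q_adj Z * \<sigma> * Z) * (q_adj (K i) * K i))) = q_trace ((q_adj Z * \<sigma> * Z) * 1\<^sub>m d)"
    unfolding complete[symmetric] using K Y \<sigma>c Zc by (intro trace_mult_mat_sum[symmetric]) (auto intro!: mult_carrier_mat)
  finally show ?thesis using Zc \<sigma>c by (simp add: assoc_mult_mat[of _ d d _ d _ d])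
qed

lemma kraus_psd:
  assumes K: "\<And>i. i \<in> I \<Longrightarrow> K i \<in> carrier_mat e d" and \<sigma>: "q_psd d \<sigma>"
  shows "q_psd e (kraus e K I \<sigma>)"
proof (rule psdI)
  fix v :: "nat \<Rightarrow> complex"
  obtain S where S: "S \<in> carrier_mat d d" and \<sigma>S: "\<sigma> = S * q_adj S" using psd_gramE[OF \<sigma>] .
  let ?B = "\<lambda>i. K i * S"
  have B: "?B i \<in> carrier_mat e d" "K i * \<sigma> * q_adj (K i) = ?B i * q_adj (?B i)" if "i \<in> I" for i
    unfolding \<sigma>S using K[OF that] S
    by (simp_all add: adj_mult[of _ e d _ d] assoc_mult_mat[of _ e d _ d _ d] assoc_mult_mat[of _ e d _ d _ e]
         assoc_mult_mat[of _ d d _ d _ e] mult_carrier_mat[of _ e d _ d] mult_carrier_mat[of _ d d _ e])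
  have "(\<Sum>a<e. \<Sum>b<e. cnj (v a) * kraus e K I \<sigma> $$ (a,b) * v b)
     = (\<Sum>a<e. \<Sum>b<e. \<Sum>i\<in>I. cnj (v a) * (?B i * q_adj (?B i)) $$ (a,b) * v b)"
    by (intro sum.cong refl) (simp add: kraus_def mat_sum_index sum_distrib_left sum_distrib_right B(2))
  also have "\<dots> = (\<Sum>i\<in>I. \<Sum>a<e. \<Sum>b<e. cnj (v a) * (?B i * q_adj (?B i)) $$ (a,b) * v b)"
    by (simp add: sum.swap[of _ I])
  also have "\<dots> = of_real (\<Sum>i\<in>I. \<Sum>l<d. (cmod (\<Sum>a<e. cnj (v a) * ?B i $$ (a,l)))\<^sup>2)"
    unfolding of_real_sum[of _ I] by (intro sum.cong refl gram_quadratic_form B(1))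
  finally show "\<exists>r\<ge>0. (\<Sum>a<e. \<Sum>b<e. cnj (v a) * kraus e K I \<sigma> $$ (a,b) * v b) = complex_of_real r"
    by (intro exI[of _ "\<Sum>i\<in>I. \<Sum>l<d. (cmod (\<Sum>a<e. cnj (v a) * ?B i $$ (a,l)))\<^sup>2"]) (auto intro!: sum_nonneg)
qed simp

lemma trace_kraus:
  assumes K: "\<And>i. i \<in> I \<Longrightarrow> K i \<in> carrier_mat e d"
    and complete: "mat_sum d d (\<lambda>i. q_adj (K i) * K i) I = 1\<^sub>m d"
    and X: "X \<in> carrier_mat d d"
  shows "q_trace (kraus e K I X) = q_trace X"
proof -
  have "q_trace (kraus e K I X) = q_trace (kraus e K I X * 1\<^sub>m e)"
    by (simp add: right_mult_one_mat[OF kraus_carrier])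
  also have "\<dots> = (\<Sum>i\<in>I. q_trace (X * (q_adj (K i) * 1\<^sub>m e * K i)))"
    by (rule trace_kraus_mult[OF K X]) auto
  also have "\<dots> = (\<Sum>i\<in>I. q_trace (X * (q_adj (K i) * K i)))"
    using K by (intro sum.cong refl) (simp add: right_mult_one_mat[OF adj_carrier[OF K]])
  also have "\<dots> = q_trace (X * mat_sum d d (\<lambda>i. q_adj (K i) * K i) I)"
    using K X by (intro trace_mult_mat_sum[symmetric]) (auto intro!: mult_carrier_mat)
  finally show ?thesis using X by (simp add: complete)
qed

text \<open>The optimal Y for the images is pulled back to Z along the dual map. The linear term
  stays the same, and the two subtracted quadratic terms can only shrink: one by the Schwarz
  inequality for Y and sigma, the other for the adjoint of Y and rho. So Z does at least as well for
  the original pair.\<close>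

lemma resolvent_form_kraus_le:
  assumes K: "\<And>i. i \<in> I \<Longrightarrow> K i \<in> carrier_mat e d"
    and complete: "mat_sum d d (\<lambda>i. q_adj (K i) * K i) I = 1\<^sub>m d"
    and psd: "q_psd d \<rho>" "q_psd d \<sigma>"
    and dec: "psd_decomp d \<rho> U p" "psd_decomp d \<sigma> V q"
    and dec': "psd_decomp e (kraus e K I \<rho>) U' p'" "psd_decomp e (kraus e K I \<sigma>) V' q'"
    and supp: "\<And>i j. i < d \<Longrightarrow> j < d \<Longrightarrow> q j = 0 \<Longrightarrow> p i = 0 \<or> overlap U V i j = 0"
    and t: "t \<ge> 0"
  shows "resolvent_form e U' p' V' q' t \<le> resolvent_form d U p V q t"
proof -
  obtain Y where Y: "Y \<in> carrier_mat e e"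
    and att: "variational (kraus e K I \<rho>) (kraus e K I \<sigma>) t Y = resolvent_form e U' p' V' q' t"
    using variational_attained[OF dec'] .
  define Z where "Z = mat_sum d d (\<lambda>i. q_adj (K i) * Y * K i) I"
  have Z: "Z \<in> carrier_mat d d" by (simp add: Z_def)
  have "q_trace (kraus e K I \<rho> * Y) = (\<Sum>i\<in>I. q_trace (\<rho> * (q_adj (K i) * Y * K i)))"
    by (rule trace_kraus_mult[OF K psdD(1)[OF psd(1)] Y])
  also have "\<dots> = q_trace (\<rho> * Z)"
    unfolding Z_def
    using K Y psdD(1)[OF psd(1)] by (intro trace_mult_mat_sum[symmetric]) (auto intro!: mult_carrier_mat)
  finally have 1: "q_trace (kraus e K I \<rho> * Y) = q_trace (\<rho> * Z)" .
  have 2: "Re (q_trace (\<sigma> * (Z * q_adj Z))) \<le> Re (q_trace (kraus e K I \<sigma> * (Y * q_adj Y)))"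
    by (rule kraus_Schwarz[OF K complete psd(2) Y Z_def])
  have "q_adj Z = mat_sum d d (\<lambda>i. q_adj (K i) * q_adj Y * K i) I"
    unfolding Z_def by (rule adj_kraus_dual[OF K Y])
  from kraus_Schwarz[OF K complete psd(1) adj_carrier[OF Y] this]
  have 3: "Re (q_trace (\<rho> * (q_adj Z * Z))) \<le> Re (q_trace (kraus e K I \<rho> * (q_adj Y * Y)))" by simp
  have "resolvent_form e U' p' V' q' t \<le> variational \<rho> \<sigma> t Z"
    unfolding att[symmetric] 1 using 2 mult_left_mono[OF 3 t] by linarith
  also have "\<dots> \<le> resolvent_form d U p V q t" by (rule variational_upper[OF dec Z t supp])
  finally show ?thesis .
qed

text \<open>The primitive of \<open>t \<mapsto> p\<^sup>2 / (q + t p)\<close>; compared with \<open>p ln (1 + T)\<close> it tends to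
  \<open>p (ln p - ln q)\<close>, which recovers the relative entropy from the resolvent forms.\<close>
definition log_potential :: "nat \<Rightarrow> complex mat \<Rightarrow> (nat \<Rightarrow> real) \<Rightarrow> complex mat \<Rightarrow> (nat \<Rightarrow> real) \<Rightarrow> real \<Rightarrow> real" where
  "log_potential d U p V q T =
    (\<Sum>i<d. \<Sum>j<d. weight U V i j * (p i * (ln (q j + T * p i) - ln (q j))))"

lemma log_potential_deriv:
  assumes dec: "psd_decomp d \<rho> U p" "psd_decomp d \<sigma> V q"
    and supp: "\<And>i j. i < d \<Longrightarrow> j < d \<Longrightarrow> q j = 0 \<Longrightarrow> p i = 0 \<or> overlap U V i j = 0"
    and T: "T \<ge> 0"
  shows "(log_potential d U p V q has_real_derivative resolvent_form d U p V q T) (at T)"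
  unfolding log_potential_def[abs_def] resolvent_form_def
proof (intro DERIV_sum)
  fix i j assume "i \<in> {..<d}" "j \<in> {..<d}"
  then have ij: "i < d" "j < d" by auto
  have pq: "0 \<le> p i" "0 \<le> q j" using psd_decompD(5)[OF dec(1)] psd_decompD(5)[OF dec(2)] ij by auto
  show "((\<lambda>T. weight U V i j * (p i * (ln (q j + T * p i) - ln (q j)))) has_real_derivative
      weight U V i j * ((p i)\<^sup>2 / (q j + T * p i))) (at T)"
  proof (cases "p i = 0 \<or> overlap U V i j = 0")
    case True
    then show ?thesis by auto
  next
    case False
    then have "q j > 0" using supp[OF ij] pq by linarith
    then have "q j + T * p i > 0" using T pq by (simp add: add_pos_nonneg)
    then show ?thesis
      by (auto intro!: derivative_eq_intros simp: power2_eq_square)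
  qed
qed

lemma log_potential_limit:
  assumes dec: "psd_decomp d \<rho> U p" "psd_decomp d \<sigma> V q"
    and supp: "\<And>i j. i < d \<Longrightarrow> j < d \<Longrightarrow> q j = 0 \<Longrightarrow> p i = 0 \<or> overlap U V i j = 0"
  shows "((\<lambda>T. log_potential d U p V q T - (\<Sum>i<d. p i) * ln (1 + T)) \<longlongrightarrow>
    (\<Sum>i<d. \<Sum>j<d. weight U V i j * (p i * (q_lnsupp (p i) - q_lnsupp (q j))))) at_top"
proof -
  have "(\<Sum>i<d. p i) * ln (1 + T) = (\<Sum>i<d. \<Sum>j<d. weight U V i j * (p i * ln (1 + T)))" for T
    unfolding sum_distrib_right
    by (intro sum.cong refl) (simp add: overlap_sums(1)[OF dec] flip: sum_distrib_right)
  then have eq: "log_potential d U p V q T - (\<Sum>i<d. p i) * ln (1 + T)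
    = (\<Sum>i<d. \<Sum>j<d. weight U V i j * (p i * (ln (q j + T * p i) - ln (q j) - ln (1 + T))))" for T
    unfolding log_potential_def by (simp add: sum_subtractf[symmetric] right_diff_distrib)
  show ?thesis unfolding eq
  proof (intro tendsto_sum)
    fix i j assume "i \<in> {..<d}" "j \<in> {..<d}"
    then have ij: "i < d" "j < d" by auto
    have pq: "0 \<le> p i" "0 \<le> q j" using psd_decompD(5)[OF dec(1)] psd_decompD(5)[OF dec(2)] ij by auto
    show "((\<lambda>T. weight U V i j * (p i * (ln (q j + T * p i) - ln (q j) - ln (1 + T)))) \<longlongrightarrow>
      weight U V i j * (p i * (q_lnsupp (p i) - q_lnsupp (q j)))) at_top"
    proof (cases "p i = 0 \<or> overlap U V i j = 0")
      case True
      then show ?thesis by auto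
    next
      case False
      then have q: "q j > 0" and p: "p i > 0" using supp[OF ij] pq by linarith+
      \<comment> \<open>The quotient (q + T p)/(1 + T) equals p + (q - p)/(1 + T), which tends to p;
        its logarithm is the difference of the two divergent logarithms.\<close>
      have "((\<lambda>T. p i + (q j - p i) / (1 + T)) \<longlongrightarrow> p i + 0) at_top"
        by (intro tendsto_add tendsto_const tendsto_divide_0[OF tendsto_const] filterlim_at_top_imp_at_infinity
            filterlim_tendsto_add_at_top[OF tendsto_const] filterlim_ident)
      then have "((\<lambda>T. ln (p i + (q j - p i) / (1 + T)) - ln (q j)) \<longlongrightarrow> ln (p i) - ln (q j)) at_top"
        using p by (intro tendsto_intros) auto
      moreover have "\<forall>\<^sub>F T in at_top. ln (p i + (q j - p i) / (1 + T)) - ln (q j) = ln (q j + T * p i) - ln (q j) - ln (1 + T)"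
        using eventually_gt_at_top[of 0]
      proof eventually_elim
        case (elim T)
        have "p i + (q j - p i) / (1 + T) = (q j + T * p i) / (1 + T)" using elim by (simp add: field_simps)
        moreover have "ln ((q j + T * p i) / (1 + T)) = ln (q j + T * p i) - ln (1 + T)"
          using elim p q by (intro ln_divide_pos add_pos_pos mult_pos_pos) auto
        ultimately show ?case by simp
      qed
      ultimately have "((\<lambda>T. ln (q j + T * p i) - ln (q j) - ln (1 + T)) \<longlongrightarrow> ln (p i) - ln (q j)) at_top"
        by (rule Lim_transform_eventually)
      then show ?thesis using p q by (auto simp: q_lnsupp_def intro!: tendsto_intros)
    qed
  qed
qed

theorem rel_entropy_kraus_le:
  assumes K: "\<And>i. i \<in> I \<Longrightarrow> K i \<in> carrier_mat e d"
    and complete: "mat_sum d d (\<lambda>i. q_adj (K i) * K i) I = 1\<^sub>m d"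
    and psd: "q_psd d \<rho>" "q_psd d \<sigma>"
  shows "q_rel_entropy (kraus e K I \<rho>) (kraus e K I \<sigma>) \<le> q_rel_entropy \<rho> \<sigma>"
proof -
  obtain U p where dU: "psd_decomp d \<rho> U p" using psd_decomp_exists[OF psd(1)] .
  obtain V q where dV: "psd_decomp d \<sigma> V q" using psd_decomp_exists[OF psd(2)] .
  obtain U' p' where dU': "psd_decomp e (kraus e K I \<rho>) U' p'"
    using psd_decomp_exists[OF kraus_psd[OF K psd(1)]] .
  obtain V' q' where dV': "psd_decomp e (kraus e K I \<sigma>) V' q'"
    using psd_decomp_exists[OF kraus_psd[OF K psd(2)]] .
  show ?thesis
  proof (cases "\<forall>i<d. \<forall>j<d. q j = 0 \<longrightarrow> p i = 0 \<or> overlap U V i j = 0")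
    case False
    then have "q_rel_entropy \<rho> \<sigma> = \<infinity>" unfolding rel_entropy_spectral[OF dU dV] by (rule if_not_P)
    then show ?thesis by simp
  next
    case True
    then have supp: "\<And>i j. i < d \<Longrightarrow> j < d \<Longrightarrow> q j = 0 \<Longrightarrow> p i = 0 \<or> overlap U V i j = 0" by blast
    have le: "resolvent_form e U' p' V' q' t \<le> resolvent_form d U p V q t" if "t \<ge> 0" for t
      by (rule resolvent_form_kraus_le[OF K complete psd dU dV dU' dV' supp that])
    \<comment> \<open>The forms decrease in t, so the value at t = 0 bounds them all. This value is
      meaningful because the support condition removes every term with q_j = 0.\<close>
    have bounded: "resolvent_form d U p V q t \<le> resolvent_form d U p V q 0" if "t \<ge> 0" for t
      unfolding resolvent_form_def
    proof (intro sum_mono)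
      fix i j assume "i \<in> {..<d}" "j \<in> {..<d}"
      then have ij: "i < d" "j < d" by auto
      have pq: "0 \<le> p i" "0 \<le> q j" using psd_decompD(5)[OF dU] psd_decompD(5)[OF dV] ij by auto
      show "weight U V i j * ((p i)\<^sup>2 / (q j + t * p i)) \<le> weight U V i j * ((p i)\<^sup>2 / (q j + 0 * p i))"
      proof (cases "p i = 0 \<or> overlap U V i j = 0")
        case False
        then have "q j > 0" using supp[OF ij] pq by linarith
        then show ?thesis using pq that by (intro mult_left_mono divide_left_mono) (auto intro!: mult_pos_pos add_pos_nonneg)
      qed auto
    qed
    \<comment> \<open>A violation of the support condition would make the resolvent form blow up as \<open>t \<rightarrow> 0\<close>.\<close>
    have supp': "p' i = 0 \<or> overlap U' V' i j = 0" if ij: "i < e" "j < e" and qj: "q' j = 0" for i j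
    proof (rule ccontr)
      assume neg: "\<not> (p' i = 0 \<or> overlap U' V' i j = 0)"
      have nn: "\<And>i. i < e \<Longrightarrow> 0 \<le> p' i" "\<And>j. j < e \<Longrightarrow> 0 \<le> q' j"
        using psd_decompD(5)[OF dU'] psd_decompD(5)[OF dV'] by auto
      define c where "c = weight U' V' i j * p' i"
      have c: "c > 0" unfolding c_def using neg nn(1)[OF ij(1)] by (intro mult_pos_pos) auto
      define B where "B = resolvent_form d U p V q 0"
      \<comment> \<open>With q'_j = 0 the (i,j) term alone equals c/t; this t makes it |B| + 1,
        above the uniform bound B.\<close>
      define t where "t = c / (\<bar>B\<bar> + 1)"
      have t: "t > 0" using c by (simp add: t_def)
      have term_nn: "0 \<le> weight U' V' i j * ((p' i)\<^sup>2 / (q' j + t * p' i))" if "i < e" "j < e" for i j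
        using nn(1)[OF that(1)] nn(2)[OF that(2)] t by simp
      have "c / t = weight U' V' i j * ((p' i)\<^sup>2 / (q' j + t * p' i))"
        using neg t by (simp add: c_def qj power2_eq_square)
      also have "\<dots> \<le> (\<Sum>j<e. weight U' V' i j * ((p' i)\<^sup>2 / (q' j + t * p' i)))"
        using ij term_nn by (intro member_le_sum) (auto simp del: times_divide_eq_right)
      also have "\<dots> \<le> resolvent_form e U' p' V' q' t"
        unfolding resolvent_form_def
        using ij by (intro member_le_sum[where f = "\<lambda>i. \<Sum>j<e. weight U' V' i j * ((p' i)\<^sup>2 / (q' j + t * p' i))"])
          (auto intro!: sum_nonneg term_nn simp del: times_divide_eq_right)
      also have "\<dots> \<le> B" unfolding B_def using le[of t] bounded[of t] t by linarith
      finally have "c / t \<le> B" .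
      moreover have "c / t = \<bar>B\<bar> + 1" using c by (simp add: t_def)
      ultimately show False by linarith
    qed
    \<comment> \<open>Equal traces make the coefficients of ln (1 + T) agree, so the divergent terms
      cancel in the comparison.\<close>
    have sums: "(\<Sum>i<e. p' i) = (\<Sum>i<d. p i)"
      using trace_kraus[OF K complete psdD(1)[OF psd(1)]]
      unfolding trace_psd_decomp[OF dU] trace_psd_decomp[OF dU'] by (simp only: of_real_eq_iff)
    have pot_le: "log_potential e U' p' V' q' T \<le> log_potential d U p V q T" if T: "T \<ge> 0" for T
    proof -
      \<comment> \<open>The integral inequality in differential form: both potentials vanish at T =
        0 and the derivative of the difference is nonnegative.\<close>
      let ?g = "\<lambda>T. log_potential d U p V q T - log_potential e U' p' V' q' T"
      have "?g 0 \<le> ?g T"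
      proof (rule DERIV_nonneg_imp_nondecreasing[OF T])
        fix x :: real assume x: "0 \<le> x" "x \<le> T"
        have "(?g has_real_derivative (resolvent_form d U p V q x - resolvent_form e U' p' V' q' x)) (at x)"
          by (intro DERIV_diff log_potential_deriv[OF dU dV supp x(1)] log_potential_deriv[OF dU' dV' supp' x(1)])
        then show "\<exists>y. (?g has_real_derivative y) (at x) \<and> 0 \<le> y" using le[OF x(1)] by force
      qed
      then show ?thesis by (simp add: log_potential_def)
    qed
    have "(\<Sum>i<e. \<Sum>j<e. weight U' V' i j * (p' i * (q_lnsupp (p' i) - q_lnsupp (q' j))))
       \<le> (\<Sum>i<d. \<Sum>j<d. weight U V i j * (p i * (q_lnsupp (p i) - q_lnsupp (q j))))"
    proof (rule tendsto_le[OF trivial_limit_at_top_linorder log_potential_limit[OF dU dV supp] log_potential_limit[OF dU' dV' supp']])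
      show "\<forall>\<^sub>F T in at_top. log_potential e U' p' V' q' T - (\<Sum>i<e. p' i) * ln (1 + T)
          \<le> log_potential d U p V q T - (\<Sum>i<d. p i) * ln (1 + T)"
        using eventually_ge_at_top[of 0] by eventually_elim (simp add: sums pot_le)
    qed
    then show ?thesis
      unfolding rel_entropy_spectral[OF dU dV] rel_entropy_spectral[OF dU' dV'] using True supp' by simp
  qed
qed

subsection \<open>Linear maps and their Choi matrices\<close>

lemma unit_carrier [simp]: "q_unit d i j \<in> carrier_mat d d"
  by (simp add: q_unit_def)

lemma unit_index: "k < d \<Longrightarrow> l < d \<Longrightarrow> q_unit d i j $$ (k,l) = (if k = i \<and> l = j then 1 else 0)"
  by (simp add: q_unit_def)

lemma trace_unit: "i < d \<Longrightarrow> q_trace (q_unit d i j) = (if i = j then 1 else 0)"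
proof -
  assume i: "i < d"
  have "q_trace (q_unit d i j) = (\<Sum>k<d. if i = k then (if i = j then 1 else 0) else 0)"
    unfolding trace_carrier[OF unit_carrier] by (intro sum.cong refl) (auto simp: unit_index)
  then show ?thesis using i by (simp add: sum_if_eq)
qed

lemma block_carrier [simp]: "q_block d X a b \<in> carrier_mat d d"
  by (simp add: q_block_def)

lemma block_index: "k < d \<Longrightarrow> l < d \<Longrightarrow> q_block d X a b $$ (k,l) = X $$ (a*d + k, b*d + l)"
  by (simp add: q_block_def)

lemma sum_unit_pick:
  fixes f :: "nat \<Rightarrow> nat \<Rightarrow> complex"
  assumes "r < n" "s < n"
  shows "(\<Sum>i<n. \<Sum>j<n. (if r = i \<and> s = j then 1 else 0) * f i j) = f r s"
proof -
  have "(\<Sum>i<n. \<Sum>j<n. (if r = i \<and> s = j then 1 else 0) * f i j)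
      = (\<Sum>i<n. if r = i then (\<Sum>j<n. if s = j then f i j else 0) else 0)"
    by (intro sum.cong refl) (simp add: if_distrib[of "\<lambda>x. x * _"] cong: if_cong)
  also have "\<dots> = f r s" using assms by (simp only: sum_if_eq if_True)
  finally show ?thesis .
qed

lemma id_tensor_carrier [simp]: "q_id_tensor n D E L X \<in> carrier_mat (n*E) (n*E)"
  by (simp add: q_id_tensor_def q_map_tensor_def)

lemma id_tensor_index:
  assumes "r < n" "s < n" "a < E" "b < E"
  shows "q_id_tensor n D E L X $$ (r*E + a, s*E + b) = L (q_block D X r s) $$ (a,b)"
  using assms sum_unit_pick[OF assms(1,2), of "\<lambda>i j. L (q_block D X i j) $$ (a,b)"]
  by (simp add: q_id_tensor_def q_map_tensor_def mult_add_less_mult unit_index)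

lemma linearD:
  assumes "q_linear d e L"
  shows "X \<in> carrier_mat d d \<Longrightarrow> L X \<in> carrier_mat e e"
    "X \<in> carrier_mat d d \<Longrightarrow> Y \<in> carrier_mat d d \<Longrightarrow> L (X + Y) = L X + L Y"
    "X \<in> carrier_mat d d \<Longrightarrow> L (c \<cdot>\<^sub>m X) = c \<cdot>\<^sub>m L X"
  using assms by (auto simp: q_linear_def)

lemma linear_mat_sum:
  assumes L: "q_linear d e L" and "finite I" and "\<And>i. i \<in> I \<Longrightarrow> M i \<in> carrier_mat d d"
  shows "L (mat_sum d d M I) = mat_sum e e (\<lambda>i. L (M i)) I"
  using assms(2,3)
proof (induction I rule: finite_induct)
  case empty
  have z: "mat_sum d d M {} = 0 \<cdot>\<^sub>m 0\<^sub>m d d" by (rule eq_matI) (auto simp: mat_sum_def)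
  have "L (mat_sum d d M {}) = 0 \<cdot>\<^sub>m L (0\<^sub>m d d)" unfolding z by (rule linearD(3)[OF L]) simp
  also have "\<dots> = mat_sum e e (\<lambda>i. L (M i)) {}"
    using linearD(1)[OF L, of "0\<^sub>m d d"] by (intro eq_matI) (auto simp: mat_sum_def)
  finally show ?case .
next
  case (insert i I)
  have "mat_sum d d M (insert i I) = M i + mat_sum d d M I"
    using insert by (intro eq_matI) (auto simp: mat_sum_def)
  then have "L (mat_sum d d M (insert i I)) = L (M i) + L (mat_sum d d M I)"
    using insert by (simp add: linearD(2)[OF L])
  also have "\<dots> = mat_sum e e (\<lambda>i. L (M i)) (insert i I)"
    using insert linearD(1)[OF L, of "M i"] by (intro eq_matI) (auto simp: mat_sum_def)
  finally show ?case .
qed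

lemma linear_expand:
  assumes L: "q_linear d e L" and X: "X \<in> carrier_mat d d" and "a < e" "b < e"
  shows "L X $$ (a,b) = (\<Sum>x<d. \<Sum>y<d. X $$ (x,y) * L (q_unit d x y) $$ (a,b))"
proof -
  let ?I = "{..<d} \<times> {..<d}" and ?M = "\<lambda>(x,y). X $$ (x,y) \<cdot>\<^sub>m q_unit d x y"
  have "X = mat_sum d d ?M ?I"
  proof (rule eq_mat_dimI)
    fix i j assume ij: "i < d" "j < d"
    have "mat_sum d d ?M ?I $$ (i,j) = (\<Sum>x<d. \<Sum>y<d. (if i = x \<and> j = y then 1 else 0) * X $$ (x,y))"
      unfolding mat_sum_index[OF ij] sum.cartesian_product
      by (intro sum.cong refl) (use ij in \<open>auto simp: q_unit_def\<close>)
    then show "X $$ (i,j) = mat_sum d d ?M ?I $$ (i,j)" by (simp add: sum_unit_pick[OF ij])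
  qed (use X in \<open>auto simp: mat_sum_def\<close>)
  then have "L X = L (mat_sum d d ?M ?I)" by simp
  also have "\<dots> = mat_sum e e (\<lambda>i. L (?M i)) ?I"
    by (rule linear_mat_sum[OF L]) auto
  finally have "L X $$ (a,b) = (\<Sum>x<d. \<Sum>y<d. L (X $$ (x,y) \<cdot>\<^sub>m q_unit d x y) $$ (a,b))"
    using assms(3,4) by (simp add: mat_sum_index sum.cartesian_product case_prod_beta)
  also have "\<dots> = (\<Sum>x<d. \<Sum>y<d. X $$ (x,y) * L (q_unit d x y) $$ (a,b))"
    using assms(3,4) linearD(1)[OF L unit_carrier] 
    by (intro sum.cong refl) (simp add: linearD(3)[OF L] carrier_matD[OF linearD(1)[OF L unit_carrier]])
  finally show ?thesis .
qed

abbreviation choi_mat :: "nat \<Rightarrow> nat \<Rightarrow> (complex mat \<Rightarrow> complex mat) \<Rightarrow> complex mat" where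
  "choi_mat D E L \<equiv> q_id_tensor D D E L (q_maxent D)"

lemma maxent_block:
  assumes "x < d" "y < d"
  shows "q_block d (q_maxent d) x y = (1 / of_nat d) \<cdot>\<^sub>m q_unit d x y"
  using assms by (intro eq_matI) (auto simp: q_block_def q_maxent_def q_unit_def mult_add_less_mult)

lemma choi_index:
  assumes L: "q_linear D E L" and "x < D" "y < D" "a < E" "b < E"
  shows "choi_mat D E L $$ (x*E + a, y*E + b) = L (q_unit D x y) $$ (a,b) / of_nat D"
  using assms(2-) linearD(1)[OF L unit_carrier, of x y]
  by (simp add: id_tensor_index maxent_block linearD(3)[OF L])

subsection \<open>Teleportation simulation of covariant maps\<close>

text \<open>As a tensor product, sqrt(D/c) times (S_m times the transpose of U_k) \<otimes> the
  adjoint of T_k, where S_m is column m of S reshaped to an n x D matrix. It is the Bell-type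
  outcome k of joining the input to the reference of the Choi matrix, followed by the correction of
  the output. The label m runs over the vectors whose projectors add up to the input.\<close>

definition tele_kraus :: "nat \<Rightarrow> nat \<Rightarrow> nat \<Rightarrow> nat \<Rightarrow> ('k \<Rightarrow> complex mat) \<Rightarrow> ('k \<Rightarrow> complex mat) \<Rightarrow> complex mat
    \<Rightarrow> 'k \<times> nat \<Rightarrow> complex mat" where
  "tele_kraus c n D E U T S = (\<lambda>(k,m). mat (n*E) (D*E) (\<lambda>(p,s).
     of_real (sqrt (real D / real c)) * (\<Sum>y<D. U k $$ (s div E, y) * S $$ ((p div E)*D + y, m))
       * cnj (T k $$ (s mod E, p mod E))))"

text \<open>What teleportation uses of a group is only the orthogonality of matrix entries: it says
  that the D^2 coordinates of the U_k are orthogonal, hence that the maximally entangled vectors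
  twisted by the U_k resolve the identity after scaling.\<close>

locale one_design_family =
  fixes D E :: nat and Ks :: "'k set" and U T :: "'k \<Rightarrow> complex mat"
  assumes finite_Ks: "finite Ks" and Ks_nonempty: "Ks \<noteq> {}" and D_pos: "D > 0"
    and U: "\<And>k. k \<in> Ks \<Longrightarrow> q_unitary D (U k)" and T: "\<And>k. k \<in> Ks \<Longrightarrow> q_unitary E (T k)"
    and orth: "\<And>x y x' y'. x < D \<Longrightarrow> y < D \<Longrightarrow> x' < D \<Longrightarrow> y' < D \<Longrightarrow>
      (\<Sum>k\<in>Ks. U k $$ (x,y) * cnj (U k $$ (x',y'))) = (if x = x' \<and> y = y' then of_nat (card Ks) / of_nat D else 0)"
begin

abbreviation "tele n S \<equiv> tele_kraus (card Ks) n D E U T S"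

definition alpha :: "complex mat \<Rightarrow> 'k \<Rightarrow> nat \<Rightarrow> nat \<Rightarrow> nat \<Rightarrow> complex" where
  "alpha S k m r x = (\<Sum>y<D. U k $$ (x,y) * S $$ (r*D + y, m))"

definition kappa :: complex where
  "kappa = of_real (sqrt (real D / real (card Ks)))"

lemma card_pos: "card Ks > 0"
  using finite_Ks Ks_nonempty by (simp add: card_gt_0_iff)

lemma kappa_square: "kappa * kappa = of_nat D / of_nat (card Ks)" "cnj kappa = kappa"
  using card_pos by (simp_all add: kappa_def flip: of_real_mult)

lemma tele_carrier: "tele n S km \<in> carrier_mat (n*E) (D*E)"
  by (cases km) (simp add: tele_kraus_def)

lemma tele_index:
  assumes "r < n" "a < E" "x < D" "c < E"
  shows "tele n S (k,m) $$ (r*E + a, x*E + c) = kappa * alpha S k m r x * cnj (T k $$ (c,a))"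
  using assms by (simp add: tele_kraus_def kappa_def alpha_def mult_add_less_mult)

text \<open>Unitarity of T_k removes the output factor. Orthogonality of the U_k then forces x = x'
  and leaves (card Ks)/D times the squared Frobenius norm of S, which is the trace of the input. The
  factor D/(card Ks) in \<open>kappa\<close> squared is chosen to cancel this.\<close>

lemma tele_complete:
  assumes S: "S \<in> carrier_mat (n*D) M" and tr: "q_trace (S * q_adj S) = 1"
  shows "mat_sum (D*E) (D*E) (\<lambda>i. q_adj (tele n S i) * tele n S i) (Ks \<times> {..<M}) = 1\<^sub>m (D*E)"
proof (rule eq_mat_dimI)
  fix p p' assume pp: "p < D*E" "p' < D*E"
  define x c x' c' where xc: "x = p div E" "c = p mod E" "x' = p' div E" "c' = p' mod E"
  have b: "x < D" "c < E" "x' < D" "c' < E" and p: "p = x*E + c" "p' = x'*E + c'"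
    unfolding xc using less_mult_div_mod[OF pp(1)] less_mult_div_mod[OF pp(2)] by auto
  have KK: "(q_adj (tele n S (k,m)) * tele n S (k,m)) $$ (p,p')
      = kappa * kappa * (\<Sum>r<n. cnj (alpha S k m r x) * alpha S k m r x') * (if c = c' then 1 else 0)"
    if k: "k \<in> Ks" for k m
  proof -
    note t = unitaryD[OF T[OF k]]
    have TT: "(\<Sum>a<E. T k $$ (c,a) * cnj (T k $$ (c',a))) = (if c = c' then 1 else 0)"
      using gram_index[OF t(1) b(2,4)] b by (simp add: t(3))
    have "(q_adj (tele n S (k,m)) * tele n S (k,m)) $$ (p,p')
        = (\<Sum>q<n*E. cnj (tele n S (k,m) $$ (q,p)) * tele n S (k,m) $$ (q,p'))"
      using pp tele_carrier[of n S "(k,m)"] by (subst index_mult_carrier[OF adj_carrier]) auto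
    also have "\<dots> = (\<Sum>r<n. \<Sum>a<E. (kappa * kappa * (cnj (alpha S k m r x) * alpha S k m r x'))
          * (T k $$ (c,a) * cnj (T k $$ (c',a))))"
      unfolding sum_lessThan_mult p using b by (intro sum.cong refl, simp add: tele_index kappa_square(2), (simp add: mult_ac)?)
    also have "\<dots> = (\<Sum>r<n. (kappa * kappa * (cnj (alpha S k m r x) * alpha S k m r x')) * (if c = c' then 1 else 0))"
      by (simp only: sum_distrib_left[symmetric] TT)
    finally show ?thesis by (simp add: sum_distrib_left sum_distrib_right mult_ac)
  qed
  have alpha_sum: "(\<Sum>k\<in>Ks. cnj (alpha S k m r x) * alpha S k m r x')
      = (if x = x' then of_nat (card Ks) / of_nat D else 0) * (\<Sum>y<D. of_real ((cmod (S $$ (r*D + y, m)))\<^sup>2))" for m r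
  proof -
    have "(\<Sum>k\<in>Ks. cnj (alpha S k m r x) * alpha S k m r x')
       = (\<Sum>k\<in>Ks. \<Sum>y'<D. \<Sum>y<D. (U k $$ (x',y') * cnj (U k $$ (x,y))) * (S $$ (r*D + y', m) * cnj (S $$ (r*D + y, m))))"
      by (intro sum.cong refl) (simp add: alpha_def sum_product mult_ac)
    also have "\<dots> = (\<Sum>y'<D. \<Sum>y<D. (\<Sum>k\<in>Ks. U k $$ (x',y') * cnj (U k $$ (x,y))) * (S $$ (r*D + y', m) * cnj (S $$ (r*D + y, m))))"
      by (simp add: sum.swap[of _ "{..<D}" Ks] sum_distrib_right)
    also have "\<dots> = (\<Sum>y'<D. \<Sum>y<D. if y' = y then (if x = x' then of_nat (card Ks) / of_nat D else 0) *
         (S $$ (r*D + y, m) * cnj (S $$ (r*D + y, m))) else 0)"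
      using b by (intro sum.cong refl) (auto simp: orth)
    also have "\<dots> = (if x = x' then of_nat (card Ks) / of_nat D else 0) * (\<Sum>y<D. of_real ((cmod (S $$ (r*D + y, m)))\<^sup>2))"
      by (simp add: sum_if_eq sum_distrib_left complex_norm_square del: of_real_power)
    finally show ?thesis .
  qed
  have trS: "(\<Sum>m<M. \<Sum>r<n. \<Sum>y<D. complex_of_real ((cmod (S $$ (r*D + y, m)))\<^sup>2)) = 1"
  proof -
    have "1 = complex_of_real (\<Sum>i<n*D. \<Sum>m<M. (cmod (S $$ (i,m)))\<^sup>2)"
      using tr unfolding trace_mult_adj[OF S] by simp
    also have "\<dots> = complex_of_real (\<Sum>m<M. \<Sum>i<n*D. (cmod (S $$ (i,m)))\<^sup>2)"
      by (subst sum.swap) simp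
    finally show ?thesis unfolding sum_lessThan_mult by simp
  qed
  have "mat_sum (D*E) (D*E) (\<lambda>i. q_adj (tele n S i) * tele n S i) (Ks \<times> {..<M}) $$ (p,p')
     = (\<Sum>k\<in>Ks. \<Sum>m<M. kappa * kappa * (\<Sum>r<n. cnj (alpha S k m r x) * alpha S k m r x') * (if c = c' then 1 else 0))"
    unfolding mat_sum_index[OF pp] sum.cartesian_product by (intro sum.cong refl) (auto simp: KK)
  also have "\<dots> = kappa * kappa * (\<Sum>m<M. \<Sum>r<n. \<Sum>k\<in>Ks. cnj (alpha S k m r x) * alpha S k m r x') * (if c = c' then 1 else 0)"
    by (simp add: sum.swap[of _ "{..<M}" Ks] sum.swap[of _ "{..<n}" Ks] flip: sum_distrib_left sum_distrib_right)
  also have "\<dots> = kappa * kappa * (if x = x' then of_nat (card Ks) / of_nat D else 0) * (if c = c' then 1 else 0)"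
    unfolding alpha_sum using trS by (simp flip: sum_distrib_left)
  also have "\<dots> = 1\<^sub>m (D*E) $$ (p,p')"
  proof -
    have "p = p' \<longleftrightarrow> x = x' \<and> c = c'" unfolding xc by (metis div_mult_mod_eq)
    then show ?thesis using pp card_pos D_pos by (simp add: kappa_square)
  qed
  finally show "mat_sum (D*E) (D*E) (\<lambda>i. q_adj (tele n S i) * tele n S i) (Ks \<times> {..<M}) $$ (p,p') = 1\<^sub>m (D*E) $$ (p,p')" .
qed (auto simp: mat_sum_def)

text \<open>Every outcome k yields the same operator, the desired output divided by the number of
  outcomes: covariance turns the twist U_k of the input into T_k on the output, and the correction
  undoes it.\<close>

lemma tele_simulates:
  assumes L: "q_linear D E L"
    and cov: "\<And>k X. k \<in> Ks \<Longrightarrow> X \<in> carrier_mat D D \<Longrightarrow> L (U k * X * q_adj (U k)) = T k * L X * q_adj (T k)"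
    and S: "S \<in> carrier_mat (n*D) M"
  shows "q_id_tensor n D E L (S * q_adj S)
    = kraus (n*E) (tele n S) (Ks \<times> {..<M}) (choi_mat D E L)"
proof (rule eq_mat_dimI)
  let ?C = "choi_mat D E L" and ?\<rho> = "S * q_adj S"
  fix p p' assume pp: "p < n*E" "p' < n*E"
  define r a s b where ra: "r = p div E" "a = p mod E" "s = p' div E" "b = p' mod E"
  have bd: "r < n" "a < E" "s < n" "b < E" and p: "p = r*E + a" "p' = s*E + b"
    unfolding ra using less_mult_div_mod[OF pp(1)] less_mult_div_mod[OF pp(2)] by auto
  let ?B = "q_block D ?\<rho> r s"
  have LB: "L ?B \<in> carrier_mat E E" by (rule linearD(1)[OF L]) simp
  have one: "(\<Sum>m<M. (tele n S (k,m) * ?C * q_adj (tele n S (k,m))) $$ (p,p')) = L ?B $$ (a,b) / of_nat (card Ks)"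
    if k: "k \<in> Ks" for k
  proof -
    note u = unitaryD[OF U[OF k]] and t = unitaryD[OF T[OF k]]
    let ?X = "U k * ?B * q_adj (U k)"
    have X: "?X \<in> carrier_mat D D" using u by simp
    \<comment> \<open>Summing over m multiplies S by its adjoint, so the coefficients reassemble the
      block (r,s) of the input, conjugated by U_k.\<close>
    have G: "(\<Sum>m<M. alpha S k m r x * cnj (alpha S k m s x')) = ?X $$ (x,x')" if "x < D" "x' < D" for x x'
    proof -
      have "(\<Sum>m<M. alpha S k m r x * cnj (alpha S k m s x'))
         = (\<Sum>m<M. \<Sum>y<D. \<Sum>y'<D. U k $$ (x,y) * cnj (U k $$ (x',y')) * (S $$ (r*D + y, m) * cnj (S $$ (s*D + y', m))))"
        by (intro sum.cong refl) (simp add: alpha_def sum_product mult_ac)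
      also have "\<dots> = (\<Sum>y<D. \<Sum>y'<D. U k $$ (x,y) * cnj (U k $$ (x',y')) * (\<Sum>m<M. S $$ (r*D + y, m) * cnj (S $$ (s*D + y', m))))"
        by (simp add: sum.swap[of _ "{..<D}" "{..<M}"] sum_distrib_left)
      also have "\<dots> = (\<Sum>y<D. \<Sum>y'<D. U k $$ (x,y) * ?B $$ (y,y') * q_adj (U k) $$ (y',x'))"
        using u(1) that bd by (intro sum.cong refl) (simp add: block_index gram_index[OF S] mult_add_less_mult)
      also have "\<dots> = ?X $$ (x,x')"
        using u(1) that by (subst index_mult3_carrier[of _ D D _ D _ D]) auto
      finally show ?thesis .
    qed
    have "(tele n S (k,m) * ?C * q_adj (tele n S (k,m))) $$ (p,p')
      = (\<Sum>x<D. \<Sum>c<E. \<Sum>x'<D. \<Sum>c'<E. kappa * kappa / of_nat D * (cnj (T k $$ (c,a)) * T k $$ (c',b) *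
          L (q_unit D x x') $$ (c,c')) * (alpha S k m r x * cnj (alpha S k m s x')))" for m
    proof -
      have "(tele n S (k,m) * ?C * q_adj (tele n S (k,m))) $$ (p,p')
         = (\<Sum>i<D*E. \<Sum>j<D*E. tele n S (k,m) $$ (p,i) * ?C $$ (i,j) * cnj (tele n S (k,m) $$ (p',j)))"
        using tele_carrier[of n S "(k,m)"] pp
        by (subst index_mult3_carrier[OF _ id_tensor_carrier adj_carrier]) (auto intro!: sum.cong)
      also have "\<dots> = (\<Sum>x<D. \<Sum>c<E. \<Sum>x'<D. \<Sum>c'<E. kappa * kappa / of_nat D * (cnj (T k $$ (c,a)) * T k $$ (c',b) *
          L (q_unit D x x') $$ (c,c')) * (alpha S k m r x * cnj (alpha S k m s x')))"
        unfolding sum_lessThan_mult p using bd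
        by (intro sum.cong refl, simp add: tele_index choi_index[OF L] kappa_square(2), (simp add: mult_ac)?)
      finally show ?thesis .
    qed
    then have "(\<Sum>m<M. (tele n S (k,m) * ?C * q_adj (tele n S (k,m))) $$ (p,p'))
      = (\<Sum>x<D. \<Sum>c<E. \<Sum>x'<D. \<Sum>c'<E. kappa * kappa / of_nat D * (cnj (T k $$ (c,a)) * T k $$ (c',b) *
          L (q_unit D x x') $$ (c,c')) * (\<Sum>m<M. alpha S k m r x * cnj (alpha S k m s x')))"
      by (simp only: sum.swap[of _ "{..<D}" "{..<M}"] sum.swap[of _ "{..<E}" "{..<M}"] sum_distrib_left)
    also have "\<dots> = (\<Sum>x<D. \<Sum>c<E. \<Sum>x'<D. \<Sum>c'<E. kappa * kappa / of_nat D * (cnj (T k $$ (c,a)) * T k $$ (c',b)) *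
          (?X $$ (x,x') * L (q_unit D x x') $$ (c,c')))"
      by (intro sum.cong refl) (simp add: G mult_ac)
    also have "\<dots> = (\<Sum>c<E. \<Sum>c'<E. \<Sum>x<D. \<Sum>x'<D. kappa * kappa / of_nat D * (cnj (T k $$ (c,a)) * T k $$ (c',b)) *
          (?X $$ (x,x') * L (q_unit D x x') $$ (c,c')))"
      by (simp only: sum.swap[of _ "{..<E}" "{..<D}"])
    \<comment> \<open>The Choi matrix stores the values of L on matrix units; contracting them with
      the coefficients of the twisted block evaluates L there by linearity.\<close>
    also have "\<dots> = (\<Sum>c<E. \<Sum>c'<E. kappa * kappa / of_nat D * (cnj (T k $$ (c,a)) * T k $$ (c',b)) * L ?X $$ (c,c'))"
      by (intro sum.cong refl) (simp add: linear_expand[OF L X] sum_distrib_left)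
    also have "\<dots> = kappa * kappa / of_nat D * (q_adj (T k) * L ?X * T k) $$ (a,b)"
      using t(1) bd linearD(1)[OF L X]
      by (subst index_mult3_carrier[of _ E E _ E _ E]) (auto simp: sum_distrib_left mult_ac intro!: sum.cong)
    also have "q_adj (T k) * L ?X * T k = (q_adj (T k) * T k) * L ?B * (q_adj (T k) * T k)"
      unfolding cov[OF k block_carrier] using t(1) LB by (simp add: assoc_mult_mat[of _ E E _ E _ E])
    also have "\<dots> = L ?B" using t(2) LB by simp
    finally show ?thesis using D_pos by (simp add: kappa_square)
  qed
  have "kraus (n*E) (tele n S) (Ks \<times> {..<M}) ?C $$ (p,p')
     = (\<Sum>k\<in>Ks. \<Sum>m<M. (tele n S (k,m) * ?C * q_adj (tele n S (k,m))) $$ (p,p'))"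
    unfolding kraus_def mat_sum_index[OF pp] sum.cartesian_product by (intro sum.cong refl) auto
  also have "\<dots> = L ?B $$ (a,b)" using card_pos by (simp add: one)
  also have "\<dots> = q_id_tensor n D E L ?\<rho> $$ (p,p')" unfolding p by (simp add: id_tensor_index bd)
  finally show "q_id_tensor n D E L ?\<rho> $$ (p,p') = kraus (n*E) (tele n S) (Ks \<times> {..<M}) ?C $$ (p,p')" by simp
qed (auto simp: kraus_def mat_sum_def carrier_matD[OF id_tensor_carrier])

text \<open>The operators \<open>tele n S\<close> involve the factor S of the input and the families
  U and T, but neither N nor L. Both outputs are thus images under one complete family, and data
  processing applies to the pair of Choi matrices.\<close>

theorem channel_div_le_choi:
  assumes N: "q_linear D E N" "\<And>k X. k \<in> Ks \<Longrightarrow> X \<in> carrier_mat D D \<Longrightarrow> N (U k * X * q_adj (U k)) = T k * N X * q_adj (T k)"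
    and L: "q_linear D E L" "\<And>k X. k \<in> Ks \<Longrightarrow> X \<in> carrier_mat D D \<Longrightarrow> L (U k * X * q_adj (U k)) = T k * L X * q_adj (T k)"
    and psd: "q_psd (D*E) (choi_mat D E N)" "q_psd (D*E) (choi_mat D E L)"
    and \<rho>: "q_state (n*D) \<rho>"
  shows "q_rel_entropy (q_id_tensor n D E N \<rho>) (q_id_tensor n D E L \<rho>)
    \<le> q_rel_entropy (choi_mat D E N) (choi_mat D E L)"
proof -
  obtain S where S: "S \<in> carrier_mat (n*D) (n*D)" and \<rho>S: "\<rho> = S * q_adj S"
    using psd_gramE \<rho> unfolding q_state_def by blast
  have "q_trace (S * q_adj S) = 1" using \<rho> \<rho>S by (simp add: q_state_def)
  note mono = rel_entropy_kraus_le[OF tele_carrier tele_complete[OF S this] psd]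
  have simN: "q_id_tensor n D E N \<rho> = kraus (n*E) (tele n S) (Ks \<times> {..<n*D}) (choi_mat D E N)"
    unfolding \<rho>S by (rule tele_simulates[OF N S])
  have simL: "q_id_tensor n D E L \<rho> = kraus (n*E) (tele n S) (Ks \<times> {..<n*D}) (choi_mat D E L)"
    unfolding \<rho>S by (rule tele_simulates[OF L S])
  show ?thesis unfolding simN simL by (rule mono)
qed

end

subsection \<open>Kronecker products and partial traces\<close>

lemma kron_carrier [simp]:
  "A \<in> carrier_mat m n \<Longrightarrow> B \<in> carrier_mat p q \<Longrightarrow> q_kron A B \<in> carrier_mat (m*p) (n*q)"
  by (auto simp: q_kron_def)

lemma kron_index:
  assumes "A \<in> carrier_mat m n" "B \<in> carrier_mat p q" "x < m" "y < p" "x' < n" "y' < q"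
  shows "q_kron A B $$ (x*p + y, x'*q + y') = A $$ (x,x') * B $$ (y,y')"
  using assms by (auto simp: q_kron_def mult_add_less_mult)

lemma eq_mat_prodI:
  assumes "A \<in> carrier_mat (m*p) (n*q)" "B \<in> carrier_mat (m*p) (n*q)"
    and "\<And>x y x' y'. x < m \<Longrightarrow> y < p \<Longrightarrow> x' < n \<Longrightarrow> y' < q \<Longrightarrow> A $$ (x*p + y, x'*q + y') = B $$ (x*p + y, x'*q + y')"
  shows "A = B"
proof (rule eq_matI)
  fix i j assume "i < dim_row B" "j < dim_col B"
  then have "i < m*p" "j < n*q" using assms(2) by auto
  then show "A $$ (i,j) = B $$ (i,j)"
    using assms(3)[of "i div p" "i mod p" "j div q" "j mod q"] less_mult_div_mod[of i m p] less_mult_div_mod[of j n q] by simp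
qed (use assms in auto)

lemma kron_mult:
  assumes "A \<in> carrier_mat m n" "B \<in> carrier_mat p q" "C \<in> carrier_mat n r" "G \<in> carrier_mat q s"
  shows "q_kron A B * q_kron C G = q_kron (A * C) (B * G)"
proof (rule eq_mat_prodI[where m = m and p = p and n = r and q = s])
  fix x y x' y' assume b: "x < m" "y < p" "x' < r" "y' < s"
  have AC: "A * C \<in> carrier_mat m r" and BG: "B * G \<in> carrier_mat p s"
    using assms by (auto intro: mult_carrier_mat)
  have "(q_kron A B * q_kron C G) $$ (x*p + y, x'*s + y')
      = (\<Sum>u<n. \<Sum>w<q. (A $$ (x,u) * C $$ (u,x')) * (B $$ (y,w) * G $$ (w,y')))"
    using b assms unfolding index_mult_carrier[OF kron_carrier[OF assms(1,2)] kron_carrier[OF assms(3,4)]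
        mult_add_less_mult[OF b(1,2)] mult_add_less_mult[OF b(3,4)]] sum_lessThan_mult
    by (intro sum.cong refl) (simp add: kron_index[OF assms(1,2)] kron_index[OF assms(3,4)])
  also have "\<dots> = (A * C) $$ (x,x') * (B * G) $$ (y,y')"
    unfolding index_mult_carrier[OF assms(1,3) b(1,3)] index_mult_carrier[OF assms(2,4) b(2,4)] sum_product ..
  finally show "(q_kron A B * q_kron C G) $$ (x*p + y, x'*s + y') = q_kron (A * C) (B * G) $$ (x*p + y, x'*s + y')"
    by (simp add: kron_index[OF AC BG b])
qed (intro mult_carrier_mat[OF kron_carrier[OF assms(1,2)] kron_carrier[OF assms(3,4)]]
    kron_carrier mult_carrier_mat[OF assms(1,3)] mult_carrier_mat[OF assms(2,4)])+

lemma kron_one_sandwich: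
  assumes "A \<in> carrier_mat F F" "B \<in> carrier_mat F F" "C \<in> carrier_mat F F"
  shows "q_kron (1\<^sub>m H) A * q_kron (1\<^sub>m H) B * q_kron (1\<^sub>m H) C = q_kron (1\<^sub>m H) (A * B * C)"
proof -
  have "q_kron (1\<^sub>m H) A * q_kron (1\<^sub>m H) B * q_kron (1\<^sub>m H) C = q_kron (1\<^sub>m H * 1\<^sub>m H) (A * B) * q_kron (1\<^sub>m H) C"
    using assms by (simp only: kron_mult[OF one_carrier_mat _ one_carrier_mat])
  also have "\<dots> = q_kron (1\<^sub>m H * 1\<^sub>m H * 1\<^sub>m H) (A * B * C)"
    using assms by (intro kron_mult[of _ H H _ F F _ H _ F]) auto
  finally show ?thesis by simp
qed

lemma adj_kron:
  assumes "A \<in> carrier_mat m n" "B \<in> carrier_mat p q"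
  shows "q_adj (q_kron A B) = q_kron (q_adj A) (q_adj B)"
proof (rule eq_mat_prodI[where m = n and p = q and n = m and q = p])
  fix x y x' y' assume b: "x < n" "y < q" "x' < m" "y' < p"
  have "q_adj (q_kron A B) $$ (x*q + y, x'*p + y') = cnj (q_kron A B $$ (x'*p + y', x*q + y))"
    using carrier_matD[OF kron_carrier[OF assms]] b by (intro adj_index) (auto simp: mult_add_less_mult)
  then show "q_adj (q_kron A B) $$ (x*q + y, x'*p + y') = q_kron (q_adj A) (q_adj B) $$ (x*q + y, x'*p + y')"
    using b assms by (simp add: kron_index[OF assms] kron_index[OF adj_carrier[OF assms(1)] adj_carrier[OF assms(2)]])
qed (use assms in auto)

lemma mult_add_eq_iff:
  assumes "y < n" "y' < (n::nat)" shows "x*n + y = x'*n + y' \<longleftrightarrow> x = x' \<and> y = y'"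
  using div_mult_add[OF assms(1), of x] div_mult_add[OF assms(2), of x']
    mod_mult_add[OF assms(1), of x] mod_mult_add[OF assms(2), of x'] by metis

lemma kron_one_diag: "q_kron (1\<^sub>m H) (q_diag F g) = q_diag (H*F) (\<lambda>i. g (i mod F))"
proof (rule eq_mat_prodI[where m = H and p = F and n = H and q = F])
  fix x y x' y' assume b: "x < H" "y < F" "x' < H" "y' < F"
  show "q_kron (1\<^sub>m H) (q_diag F g) $$ (x*F + y, x'*F + y') = q_diag (H*F) (\<lambda>i. g (i mod F)) $$ (x*F + y, x'*F + y')"
    using b by (simp add: kron_index[OF one_carrier_mat diag_carrier] mult_add_less_mult mult_add_eq_iff)
qed auto

lemma kron_one_one: "q_kron (1\<^sub>m H) (1\<^sub>m F) = 1\<^sub>m (H*F)"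
proof (rule eq_mat_prodI[where m = H and p = F and n = H and q = F])
  fix x y x' y' assume b: "x < H" "y < F" "x' < H" "y' < F"
  show "q_kron (1\<^sub>m H) (1\<^sub>m F) $$ (x*F + y, x'*F + y') = (1\<^sub>m (H*F) :: complex mat) $$ (x*F + y, x'*F + y')"
    using b by (simp add: kron_index[OF one_carrier_mat one_carrier_mat] mult_add_less_mult mult_add_eq_iff)
qed auto

lemma unitary_one: "q_unitary d (1\<^sub>m d)"
  by (simp add: q_unitary_def)

lemma unitary_kron:
  assumes "q_unitary m A" "q_unitary p B" shows "q_unitary (m*p) (q_kron A B)"
proof -
  note a = unitaryD[OF assms(1)] and b = unitaryD[OF assms(2)]
  have "q_adj (q_kron A B) * q_kron A B = q_kron (q_adj A * A) (q_adj B * B)"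
    using a(1) b(1) by (simp add: adj_kron kron_mult[of _ m m _ p p])
  then show ?thesis using a b by (simp add: q_unitary_def kron_one_one)
qed

lemma psd_decomp_kron_one:
  assumes "psd_decomp F \<sigma> V q"
  shows "psd_decomp (H*F) (q_kron (1\<^sub>m H) \<sigma>) (q_kron (1\<^sub>m H) V) (\<lambda>i. q (i mod F))"
proof -
  note v = psd_decompD[OF assms]
  have V: "q_kron (1\<^sub>m H) V \<in> carrier_mat (H*F) (H*F)" using v(1) by simp
  have "q_kron (1\<^sub>m H) V * q_diag (H*F) (\<lambda>i. q (i mod F)) * q_adj (q_kron (1\<^sub>m H) V) = q_kron (1\<^sub>m H) \<sigma>"
    unfolding kron_one_diag[symmetric] v(4) using v(1)
    by (simp add: adj_kron[of _ H H _ F F] kron_one_sandwich)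
  moreover have "0 \<le> q (i mod F)" if "i < H*F" for i using v(5) less_mult_div_mod[OF that] by simp
  moreover have "q_unitary (H*F) (q_kron (1\<^sub>m H) V)"
    using assms by (intro unitary_kron unitary_one) (simp add: psd_decomp_def)
  ultimately show ?thesis unfolding psd_decomp_def by metis
qed

lemma ptrace1_carrier [simp]: "q_ptrace1 m n X \<in> carrier_mat n n"
  by (simp add: q_ptrace1_def)

lemma ptrace1_index: "i < n \<Longrightarrow> j < n \<Longrightarrow> q_ptrace1 m n X $$ (i,j) = (\<Sum>k<m. X $$ (k*n + i, k*n + j))"
  by (simp add: q_ptrace1_def)

lemma trace_ptrace1:
  assumes "X \<in> carrier_mat (m*n) (m*n)" shows "q_trace (q_ptrace1 m n X) = q_trace X"
  unfolding trace_carrier[OF assms] trace_carrier[OF ptrace1_carrier] sum_lessThan_mult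
  by (simp add: ptrace1_index sum.swap[of _ "{..<n}" "{..<m}"])

lemma trace_mult_kron_one:
  assumes C: "C \<in> carrier_mat (H*F) (H*F)" and Y: "Y \<in> carrier_mat F F"
  shows "q_trace (C * q_kron (1\<^sub>m H) Y) = q_trace (q_ptrace1 H F C * Y)"
proof -
  have "q_trace (C * q_kron (1\<^sub>m H) Y)
     = (\<Sum>x<H. \<Sum>y<F. \<Sum>x'<H. \<Sum>y'<F. C $$ (x*F + y, x'*F + y') * ((if x' = x then 1 else 0) * Y $$ (y',y)))"
    unfolding trace_mult[OF C kron_carrier[OF one_carrier_mat Y]] sum_lessThan_mult
    by (intro sum.cong refl) (simp add: kron_index[OF one_carrier_mat Y])
  also have "\<dots> = (\<Sum>x<H. \<Sum>y<F. \<Sum>x'<H. if x' = x then (\<Sum>y'<F. C $$ (x*F + y, x'*F + y') * Y $$ (y',y)) else 0)"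
    by (intro sum.cong refl) simp
  also have "\<dots> = (\<Sum>x<H. \<Sum>y<F. \<Sum>y'<F. C $$ (x*F + y, x*F + y') * Y $$ (y',y))"
    by (rule sum.cong[OF refl], rule sum.cong[OF refl]) (simp add: sum_if_eq)
  also have "\<dots> = (\<Sum>y<F. \<Sum>y'<F. \<Sum>x<H. C $$ (x*F + y, x*F + y') * Y $$ (y',y))"
    by (simp only: sum.swap[of _ "{..<F}" "{..<H}"])
  also have "\<dots> = q_trace (q_ptrace1 H F C * Y)"
    unfolding trace_mult[OF ptrace1_carrier Y] by (intro sum.cong refl) (simp add: ptrace1_index sum_distrib_right)
  finally show ?thesis .
qed

text \<open>This is conjugation by a matrix whose row i is w_i times the coordinate functional at f
  i. Since f may repeat values or be partial, it covers submatrices, permutations, scaling, and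
  padding by a further tensor factor.\<close>

lemma psd_pullback:
  assumes "q_psd d A" "\<And>i. i < m \<Longrightarrow> f i < d"
  shows "q_psd m (mat m m (\<lambda>(i,j). w i * cnj (w j) * A $$ (f i, f j)))"
proof -
  obtain S where S: "S \<in> carrier_mat d d" and A: "A = S * q_adj S" using psd_gramE[OF assms(1)] .
  let ?R = "mat m d (\<lambda>(i,l). w i * S $$ (f i, l))"
  have "mat m m (\<lambda>(i,j). w i * cnj (w j) * A $$ (f i, f j)) = ?R * q_adj ?R"
  proof (rule eq_mat_dimI)
    fix i j assume ij: "i < m" "j < m"
    have R: "?R \<in> carrier_mat m d" by simp
    show "mat m m (\<lambda>(i,j). w i * cnj (w j) * A $$ (f i, f j)) $$ (i,j) = (?R * q_adj ?R) $$ (i,j)"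
      using ij unfolding A gram_index[OF R ij]
      by (simp add: gram_index[OF S assms(2) assms(2)] sum_distrib_left mult_ac)
  qed auto
  then show ?thesis using psd_gramI[of ?R m d] by simp
qed

lemma psd_mat_sum:
  assumes "\<And>i. i \<in> I \<Longrightarrow> q_psd d (M i)" shows "q_psd d (mat_sum d d M I)"
proof (rule psdI)
  fix v :: "nat \<Rightarrow> complex"
  have "\<forall>i\<in>I. \<exists>r. r \<ge> 0 \<and> (\<Sum>a<d. \<Sum>b<d. cnj (v a) * M i $$ (a,b) * v b) = complex_of_real r"
    using psdD(2)[OF assms] by blast
  from bchoice[OF this] obtain r where r: "\<And>i. i \<in> I \<Longrightarrow> 0 \<le> r i"
      "\<And>i. i \<in> I \<Longrightarrow> (\<Sum>a<d. \<Sum>b<d. cnj (v a) * M i $$ (a,b) * v b) = complex_of_real (r i)"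
    by blast
  have "(\<Sum>a<d. \<Sum>b<d. cnj (v a) * mat_sum d d M I $$ (a,b) * v b)
     = (\<Sum>a<d. \<Sum>b<d. \<Sum>i\<in>I. cnj (v a) * M i $$ (a,b) * v b)"
    by (intro sum.cong refl) (simp add: mat_sum_index sum_distrib_left sum_distrib_right)
  also have "\<dots> = (\<Sum>i\<in>I. \<Sum>a<d. \<Sum>b<d. cnj (v a) * M i $$ (a,b) * v b)"
    by (simp add: sum.swap[of _ I "{..<d}"])
  also have "\<dots> = complex_of_real (\<Sum>i\<in>I. r i)" by (simp add: r(2))
  finally show "\<exists>r\<ge>0. (\<Sum>a<d. \<Sum>b<d. cnj (v a) * mat_sum d d M I $$ (a,b) * v b) = complex_of_real r"
    using r(1) by (intro exI[of _ "\<Sum>i\<in>I. r i"]) (auto intro: sum_nonneg)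
qed simp

lemma psd_ptrace1:
  assumes "q_psd (m*n) X" shows "q_psd n (q_ptrace1 m n X)"
proof -
  let ?M = "\<lambda>k. mat n n (\<lambda>(i,j). 1 * cnj 1 * X $$ (k*n + i, k*n + j))"
  have "q_ptrace1 m n X = mat_sum n n ?M {..<m}"
    by (rule eq_matI) (auto simp: ptrace1_index mat_sum_def q_ptrace1_def)
  moreover have "q_psd n (?M k)" if "k \<in> {..<m}" for k
    using that by (intro psd_pullback[OF assms]) (auto simp: mult_add_less_mult)
  ultimately show ?thesis using psd_mat_sum[of "{..<m}" n ?M] by simp
qed

lemma psd_smult:
  assumes "q_psd d A" "c \<ge> 0" shows "q_psd d (complex_of_real c \<cdot>\<^sub>m A)"
proof -
  have "complex_of_real c \<cdot>\<^sub>m A = mat d d (\<lambda>(i,j). complex_of_real (sqrt c) * cnj (complex_of_real (sqrt c)) * A $$ (i,j))"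
    using psdD(1)[OF assms(1)] assms(2) by (intro eq_matI) (auto simp flip: of_real_mult)
  then show ?thesis using psd_pullback[OF assms(1), of d "\<lambda>i. i" "\<lambda>_. complex_of_real (sqrt c)"] by simp
qed

subsection \<open>Entropic quantities under reindexing and tensoring with an identity\<close>

text \<open>Permuting basis labels permutes the rows of both eigenbases and leaves their inner
  products, hence all overlaps and eigenvalues, unchanged.\<close>

lemma rel_entropy_reindex:
  assumes psd: "q_psd d \<rho>" "q_psd d \<sigma>" and bij: "bij_betw f {..<d} {..<d}"
  shows "q_rel_entropy (mat d d (\<lambda>(i,j). \<rho> $$ (f i, f j))) (mat d d (\<lambda>(i,j). \<sigma> $$ (f i, f j))) = q_rel_entropy \<rho> \<sigma>"
proof -
  have fd: "f i < d" if "i < d" for i using bij_betwE[OF bij] that by auto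
  have shift: "q_adj (mat d d (\<lambda>(i,j). A $$ (f i, j))) * mat d d (\<lambda>(i,j). B $$ (f i, j)) = q_adj A * B"
    if A: "A \<in> carrier_mat d d" and B: "B \<in> carrier_mat d d" for A B
  proof (rule eq_mat_dimI)
    fix i j assume ij: "i < d" "j < d"
    have "(\<Sum>l<d. cnj (A $$ (f l, i)) * B $$ (f l, j)) = (\<Sum>l<d. cnj (A $$ (l, i)) * B $$ (l, j))"
      by (rule sum.reindex_bij_betw[OF bij])
    then show "(q_adj (mat d d (\<lambda>(i,j). A $$ (f i, j))) * mat d d (\<lambda>(i,j). B $$ (f i, j))) $$ (i,j) = (q_adj A * B) $$ (i,j)"
      using ij A B by (simp add: index_mult_carrier[of _ d d _ d])
  qed (use A B in auto)
  have decomp: "psd_decomp d (mat d d (\<lambda>(i,j). A $$ (f i, f j))) (mat d d (\<lambda>(i,j). U $$ (f i, j))) p"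
    if "psd_decomp d A U p" for A U p
  proof -
    note u = psd_decompD[OF that]
    let ?U = "mat d d (\<lambda>(i,j). U $$ (f i, j))"
    have U: "?U \<in> carrier_mat d d" by simp
    have "q_unitary d ?U" using shift[OF u(1) u(1)] u(2) by (simp add: q_unitary_def)
    moreover have "mat d d (\<lambda>(i,j). A $$ (f i, f j)) = ?U * q_diag d p * q_adj ?U"
    proof (rule eq_mat_dimI)
      fix i j assume ij: "i < d" "j < d"
      have "A $$ (f i, f j) = (\<Sum>l<d. p l * U $$ (f i,l) * cnj (U $$ (f j,l)))"
        using sandwich_diag_index[OF u(1) u(1) fd[OF ij(1)] fd[OF ij(2)]] u(4) by metis
      then show "mat d d (\<lambda>(i,j). A $$ (f i, f j)) $$ (i,j) = (?U * q_diag d p * q_adj ?U) $$ (i,j)"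
        unfolding sandwich_diag_index[OF U U ij] using ij by simp
    qed auto
    ultimately show ?thesis using u(5) unfolding psd_decomp_def by blast
  qed
  obtain U p where dU: "psd_decomp d \<rho> U p" using psd_decomp_exists[OF psd(1)] .
  obtain V q where dV: "psd_decomp d \<sigma> V q" using psd_decomp_exists[OF psd(2)] .
  show ?thesis
    unfolding rel_entropy_spectral[OF dU dV] rel_entropy_spectral[OF decomp[OF dU] decomp[OF dV]]
    by (simp add: overlap_def shift[OF psd_decompD(1)[OF dU] psd_decompD(1)[OF dV]])
qed

lemma entropy_eq_trace:
  assumes "q_psd d \<rho>" shows "q_entropy \<rho> = - Re (q_trace (\<rho> * q_mfun q_lnsupp \<rho>))"
proof -
  obtain U p where dU: "psd_decomp d \<rho> U p" using psd_decomp_exists[OF assms] .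
  note u = psd_decompD[OF dU]
  have "\<rho> * q_mfun q_lnsupp \<rho> = U * q_diag d p * (q_adj U * U) * q_diag d (q_lnsupp \<circ> p) * q_adj U"
    unfolding u(7) using u(1) u(4) by (simp add: assoc_mult_mat[of _ d d _ d _ d])
  also have "\<dots> = U * (q_diag d p * q_diag d (q_lnsupp \<circ> p)) * q_adj U"
    unfolding u(2) using u(1) by (simp add: assoc_mult_mat[of _ d d _ d _ d])
  also have "q_diag d p * q_diag d (q_lnsupp \<circ> p) = q_diag d (q_xlnx \<circ> p)"
    unfolding diag_mult_diag by (rule diag_cong) (simp add: q_lnsupp_def q_xlnx_def)
  finally show ?thesis by (simp add: q_entropy_def u(7))
qed

lemma kron_one_mult_vec:
  assumes \<sigma>: "\<sigma> \<in> carrier_mat F F" and v: "v \<in> carrier_vec (H*F)" and "x < H" "y < F"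
  shows "(q_kron (1\<^sub>m H) \<sigma> *\<^sub>v v) $ (x*F + y) = (\<sigma> *\<^sub>v vec F (\<lambda>y. v $ (x*F + y))) $ y"
proof -
  have "(q_kron (1\<^sub>m H) \<sigma> *\<^sub>v v) $ (x*F + y)
     = (\<Sum>x'<H. \<Sum>y'<F. (if x = x' then 1 else 0) * \<sigma> $$ (y,y') * v $ (x'*F + y'))"
    unfolding index_mult_vec[OF kron_carrier[OF one_carrier_mat \<sigma>] v mult_add_less_mult[OF assms(3,4)]] sum_lessThan_mult
    by (intro sum.cong refl) (use assms in \<open>simp add: kron_index[OF one_carrier_mat \<sigma>]\<close>)
  also have "\<dots> = (\<Sum>x'<H. if x = x' then (\<Sum>y'<F. \<sigma> $$ (y,y') * v $ (x'*F + y')) else 0)"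
    by (intro sum.cong refl) simp
  also have "\<dots> = (\<Sum>y'<F. \<sigma> $$ (y,y') * v $ (x*F + y'))" using assms by (simp add: sum_if_eq)
  finally show ?thesis
    using assms by (subst index_mult_vec[OF \<sigma> vec_carrier assms(4)]) simp
qed

text \<open>The logarithm on the support commutes with tensoring by the identity, and the partial
  trace is adjoint to that tensoring, so the cross term depends only on the marginal. The remaining
  work is to see that both sides are infinite simultaneously.\<close>

lemma rel_entropy_kron_one:
  assumes C: "q_psd (H*F) C" and \<sigma>: "q_psd F \<sigma>"
  shows "q_rel_entropy C (q_kron (1\<^sub>m H) \<sigma>)
    = q_rel_entropy (q_ptrace1 H F C) \<sigma> + ereal (q_entropy (q_ptrace1 H F C) - q_entropy C)"
proof -
  let ?\<omega> = "q_ptrace1 H F C" and ?S = "q_kron (1\<^sub>m H) \<sigma>"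
  note Cc = psdD(1)[OF C] and \<sigma>c = psdD(1)[OF \<sigma>]
  have \<omega>: "q_psd F ?\<omega>" by (rule psd_ptrace1[OF C])
  have Sc: "?S \<in> carrier_mat (H*F) (H*F)" using \<sigma>c by simp
  have dims: "dim_row C = H*F" "dim_row ?S = H*F" "dim_row ?\<omega> = F" "dim_row \<sigma> = F"
    using Cc \<sigma>c carrier_matD[OF Sc] carrier_matD[OF ptrace1_carrier] by auto
  \<comment> \<open>The vector e_k \<otimes> w in coordinates.\<close>
  define slice where "slice = (\<lambda>k (w :: complex vec). vec (H*F) (\<lambda>i. if i div F = k then w $ (i mod F) else 0))"
  have slice: "slice k w \<in> carrier_vec (H*F)" for k w by (simp add: slice_def)
  have slice_idx: "slice k w $ (x*F + y) = (if x = k then w $ y else 0)" if "x < H" "y < F" for k w x y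
    using that by (simp add: slice_def mult_add_less_mult)
  have C_slice: "(C *\<^sub>v slice k w) $ (x*F + y) = (\<Sum>y'<F. C $$ (x*F + y, k*F + y') * w $ y')"
    if "x < H" "y < F" "k < H" for k w x y
  proof -
    have "(C *\<^sub>v slice k w) $ (x*F + y) = (\<Sum>x'<H. if x' = k then (\<Sum>y'<F. C $$ (x*F + y, x'*F + y') * w $ y') else 0)"
      unfolding index_mult_vec[OF Cc slice mult_add_less_mult[OF that(1,2)]] sum_lessThan_mult
      by (intro sum.cong refl) (simp add: slice_idx)
    then show ?thesis using that by (simp add: sum_if_eq)
  qed
  have \<omega>w: "(?\<omega> *\<^sub>v w) $ y = (\<Sum>k<H. (C *\<^sub>v slice k w) $ (k*F + y))" if "w \<in> carrier_vec F" "y < F" for w y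
  proof -
    have "(?\<omega> *\<^sub>v w) $ y = (\<Sum>y'<F. \<Sum>k<H. C $$ (k*F + y, k*F + y') * w $ y')"
      unfolding index_mult_vec[OF ptrace1_carrier that] by (intro sum.cong refl) (simp add: ptrace1_index that sum_distrib_right)
    also have "\<dots> = (\<Sum>k<H. \<Sum>y'<F. C $$ (k*F + y, k*F + y') * w $ y')" by (rule sum.swap)
    finally show ?thesis by (simp add: C_slice that)
  qed
  have supp: "(\<forall>v \<in> carrier_vec (H*F). ?S *\<^sub>v v = 0\<^sub>v (H*F) \<longrightarrow> C *\<^sub>v v = 0\<^sub>v (H*F)) \<longleftrightarrow>
    (\<forall>w \<in> carrier_vec F. \<sigma> *\<^sub>v w = 0\<^sub>v F \<longrightarrow> ?\<omega> *\<^sub>v w = 0\<^sub>v F)" (is "?P \<longleftrightarrow> ?Q")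
  proof
    assume P: ?P
    show ?Q
    proof (intro ballI impI)
      fix w :: "complex vec" assume w: "w \<in> carrier_vec F" and z: "\<sigma> *\<^sub>v w = 0\<^sub>v F"
      have Ck: "C *\<^sub>v slice k w = 0\<^sub>v (H*F)" if k: "k < H" for k
      proof -
        have "?S *\<^sub>v slice k w = 0\<^sub>v (H*F)"
        proof (rule eq_vecI)
          fix i assume "i < dim_vec (0\<^sub>v (H*F) :: complex vec)"
          then have i: "i < H*F" by simp
          note b = less_mult_div_mod[OF i]
          have "vec F (\<lambda>y. slice k w $ ((i div F)*F + y)) = (if i div F = k then w else 0\<^sub>v F)"
            using w b by (intro eq_vecI) (auto simp: slice_idx)
          then have "(?S *\<^sub>v slice k w) $ ((i div F)*F + i mod F) = (\<sigma> *\<^sub>v (if i div F = k then w else 0\<^sub>v F)) $ (i mod F)"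
            using kron_one_mult_vec[OF \<sigma>c slice b] by simp
          also have "\<dots> = 0" using z b(2) \<sigma>c by (auto simp: index_mult_vec[OF \<sigma>c _ b(2)] simp del: index_mult_mat_vec)
          finally show "(?S *\<^sub>v slice k w) $ i = 0\<^sub>v (H*F) $ i" using i by simp
        qed (use Sc in auto)
        then show ?thesis using P slice by blast
      qed
      show "?\<omega> *\<^sub>v w = 0\<^sub>v F"
      proof (rule eq_vecI)
        fix y assume "y < dim_vec (0\<^sub>v F :: complex vec)"
        then have y: "y < F" by simp
        show "(?\<omega> *\<^sub>v w) $ y = 0\<^sub>v F $ y"
          unfolding \<omega>w[OF w y] using y by (auto simp: Ck mult_add_less_mult intro!: sum.neutral)
      qed (simp add: dims)
    qed
  next
    assume Q: ?Q
    show ?P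
    proof (intro ballI impI)
      fix v :: "complex vec" assume v: "v \<in> carrier_vec (H*F)" and z: "?S *\<^sub>v v = 0\<^sub>v (H*F)"
      define w where "w = (\<lambda>x. vec F (\<lambda>y. v $ (x*F + y)))"
      have wc: "w x \<in> carrier_vec F" for x by (simp add: w_def)
      have \<sigma>w: "\<sigma> *\<^sub>v w x = 0\<^sub>v F" if "x < H" for x
      proof (rule eq_vecI)
        fix y assume "y < dim_vec (0\<^sub>v F :: complex vec)"
        then have y: "y < F" by simp
        show "(\<sigma> *\<^sub>v w x) $ y = 0\<^sub>v F $ y"
          using kron_one_mult_vec[OF \<sigma>c v that y] y that unfolding z w_def by (simp add: mult_add_less_mult)
      qed (use \<sigma>c in auto)
      have Cw: "C *\<^sub>v slice x (w x) = 0\<^sub>v (H*F)" if x: "x < H" for x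
      proof -
        have \<omega>0: "?\<omega> *\<^sub>v w x = 0\<^sub>v F" using Q wc \<sigma>w[OF x] by blast
        \<comment> \<open>The expectation of C at e_k \<otimes> w. Over all k these sum to the
          expectation of the marginal at w, which is 0; being nonnegative they all vanish, and
          positivity places each vector in the kernel of C.\<close>
        define r where "r = (\<lambda>k. \<Sum>i<H*F. \<Sum>j<H*F. cnj (slice k (w x) $ i) * C $$ (i,j) * slice k (w x) $ j)"
        have r: "r k = (\<Sum>y<F. cnj (w x $ y) * (C *\<^sub>v slice k (w x)) $ (k*F + y))" if k: "k < H" for k
        proof -
          have "r k = (\<Sum>i<H*F. cnj (slice k (w x) $ i) * (C *\<^sub>v slice k (w x)) $ i)"
            unfolding r_def by (intro sum.cong refl)
              (simp add: index_mult_vec[OF Cc slice] sum_distrib_left mult.assoc del: index_mult_mat_vec)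
          also have "\<dots> = (\<Sum>x'<H. if x' = k then (\<Sum>y<F. cnj (w x $ y) * (C *\<^sub>v slice k (w x)) $ (x'*F + y)) else 0)"
            unfolding sum_lessThan_mult by (intro sum.cong refl) (simp add: slice_idx del: index_mult_mat_vec)
          finally show ?thesis using k by (simp add: sum_if_eq del: index_mult_mat_vec)
        qed
        have "(\<Sum>k<H. r k) = (\<Sum>y<F. cnj (w x $ y) * (?\<omega> *\<^sub>v w x) $ y)"
        proof -
          have "(\<Sum>k<H. r k) = (\<Sum>k<H. \<Sum>y<F. cnj (w x $ y) * (C *\<^sub>v slice k (w x)) $ (k*F + y))"
            by (intro sum.cong refl) (simp add: r del: index_mult_mat_vec)
          also have "\<dots> = (\<Sum>y<F. cnj (w x $ y) * (?\<omega> *\<^sub>v w x) $ y)"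
            by (subst sum.swap, intro sum.cong refl) (simp add: \<omega>w wc sum_distrib_left del: index_mult_mat_vec)
          finally show ?thesis .
        qed
        then have sum0: "(\<Sum>k<H. r k) = 0" by (simp add: \<omega>0)
        have nn: "Re (r k) \<ge> 0 \<and> Im (r k) = 0" for k
          using psdD(2)[OF C, of "\<lambda>i. slice k (w x) $ i"] unfolding r_def by force
        have "(\<Sum>k<H. Re (r k)) = 0" using arg_cong[OF sum0, of Re] by simp
        then have "Re (r x) = 0" using nn x by (subst (asm) sum_nonneg_eq_0_iff) auto
        then have "r x = 0" using nn[of x] by (simp add: complex_eq_iff)
        then show ?thesis using psd_kernel[OF C slice] unfolding r_def by blast
      qed
      show "C *\<^sub>v v = 0\<^sub>v (H*F)"
      proof (rule eq_vecI)
        fix i assume "i < dim_vec (0\<^sub>v (H*F) :: complex vec)"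
        then have i: "i < H*F" by simp
        note b = less_mult_div_mod[OF i]
        \<comment> \<open>Since v is the sum of its slices e_x \<otimes> w_x, its image under C
          vanishes.\<close>
        have "(C *\<^sub>v v) $ i = (\<Sum>x<H. \<Sum>y<F. C $$ ((i div F)*F + i mod F, x*F + y) * w x $ y)"
          unfolding index_mult_vec[OF Cc v i] sum_lessThan_mult by (intro sum.cong refl) (simp add: w_def)
        also have "\<dots> = (\<Sum>x<H. (C *\<^sub>v slice x (w x)) $ ((i div F)*F + i mod F))"
          by (intro sum.cong refl) (simp only: C_slice b lessThan_iff)
        also have "\<dots> = 0" using i by (intro sum.neutral) (simp add: Cw)
        finally show "(C *\<^sub>v v) $ i = 0\<^sub>v (H*F) $ i" using i by simp
      qed (use Cc in auto)
    qed
  qed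
  obtain V q where dV: "psd_decomp F \<sigma> V q" using psd_decomp_exists[OF \<sigma>] .
  note v = psd_decompD[OF dV] and s = psd_decompD[OF psd_decomp_kron_one[OF dV, of H]]
  have "q_mfun q_lnsupp ?S = q_kron (1\<^sub>m H) V * q_kron (1\<^sub>m H) (q_diag F (q_lnsupp \<circ> q)) * q_adj (q_kron (1\<^sub>m H) V)"
    unfolding s(7) kron_one_diag by (simp add: comp_def)
  also have "\<dots> = q_kron (1\<^sub>m H) (q_mfun q_lnsupp \<sigma>)"
    unfolding v(7) using v(1) by (simp add: adj_kron[of _ H H _ F F] kron_one_sandwich)
  finally have mf: "q_mfun q_lnsupp ?S = q_kron (1\<^sub>m H) (q_mfun q_lnsupp \<sigma>)" .
  have "q_mfun q_lnsupp \<sigma> \<in> carrier_mat F F" unfolding v(7) using v(1) by simp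
  then have "q_trace (C * q_mfun q_lnsupp ?S) = q_trace (?\<omega> * q_mfun q_lnsupp \<sigma>)"
    unfolding mf by (rule trace_mult_kron_one[OF Cc])
  then show ?thesis
    unfolding q_rel_entropy_def dims supp entropy_eq_trace[OF C] entropy_eq_trace[OF \<omega>] by simp
qed

text \<open>The bound ln x \<le> x - 1 at x = d q_j / p_i, averaged with the doubly stochastic
  weights. The trace 1/d of sigma is why the minimum is ln d and not 0.\<close>

lemma Klein_inequality:
  assumes \<omega>: "q_psd F \<omega>" "q_trace \<omega> = 1" and \<sigma>: "q_psd F \<sigma>" "q_trace \<sigma> = of_real (1 / d)" and d: "d > 0"
  shows "q_rel_entropy \<omega> \<sigma> \<ge> ereal (ln d)"
proof -
  obtain U p where dU: "psd_decomp F \<omega> U p" using psd_decomp_exists[OF \<omega>(1)] .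
  obtain V q where dV: "psd_decomp F \<sigma> V q" using psd_decomp_exists[OF \<sigma>(1)] .
  have sp: "(\<Sum>i<F. p i) = 1" using \<omega>(2) unfolding trace_psd_decomp[OF dU] by (simp only: of_real_eq_1_iff)
  have sq: "(\<Sum>i<F. q i) = 1 / d" using \<sigma>(2) unfolding trace_psd_decomp[OF dV] by (simp only: of_real_eq_iff)
  let ?w = "\<lambda>i j. weight U V i j"
  have "ln d \<le> (\<Sum>i<F. \<Sum>j<F. ?w i j * (p i * (q_lnsupp (p i) - q_lnsupp (q j))))"
    if supp: "\<forall>i<F. \<forall>j<F. q j = 0 \<longrightarrow> p i = 0 \<or> overlap U V i j = 0"
  proof -
    \<comment> \<open>Row sums turn the first term into 1 + ln d, column sums turn the second into
      1, because the q_j add up to 1/d. The comparison can then be made pair by pair.\<close>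
    have "ln d = (\<Sum>i<F. \<Sum>j<F. ?w i j * (p i * (1 + ln d))) - (\<Sum>j<F. \<Sum>i<F. ?w i j * (d * q j))"
    proof -
      have "(\<Sum>i<F. \<Sum>j<F. ?w i j * (p i * (1 + ln d))) = (\<Sum>i<F. p i * (1 + ln d))"
        by (intro sum.cong refl) (simp add: overlap_sums(1)[OF dU dV] flip: sum_distrib_right)
      moreover have "(\<Sum>j<F. \<Sum>i<F. ?w i j * (d * q j)) = (\<Sum>j<F. d * q j)"
        by (intro sum.cong refl) (simp add: overlap_sums(2)[OF dU dV] flip: sum_distrib_right)
      ultimately show ?thesis using d by (simp add: sp sq flip: sum_distrib_right sum_distrib_left)
    qed
    also have "\<dots> = (\<Sum>i<F. \<Sum>j<F. ?w i j * (p i * (1 + ln d) - d * q j))"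
      by (subst sum.swap[of _ "{..<F}" "{..<F}"]) (simp add: sum_subtractf right_diff_distrib)
    also have "\<dots> \<le> (\<Sum>i<F. \<Sum>j<F. ?w i j * (p i * (q_lnsupp (p i) - q_lnsupp (q j))))"
    proof (intro sum_mono)
      fix i j assume "i \<in> {..<F}" "j \<in> {..<F}"
      then have ij: "i < F" "j < F" by auto
      have pq: "0 \<le> p i" "0 \<le> q j" using psd_decompD(5)[OF dU] psd_decompD(5)[OF dV] ij by auto
      show "?w i j * (p i * (1 + ln d) - d * q j) \<le> ?w i j * (p i * (q_lnsupp (p i) - q_lnsupp (q j)))"
      proof (cases "overlap U V i j = 0")
        case False
        have "p i * (1 + ln d) - d * q j \<le> p i * (q_lnsupp (p i) - q_lnsupp (q j))"
        proof (cases "p i = 0")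
          case True
          then show ?thesis using pq d by simp
        next
          case p0: False
          then have q: "q j > 0" and p: "p i > 0" using supp ij False pq by (auto simp: less_le)
          have "ln (d * q j / p i) \<le> d * q j / p i - 1" using p q d by (intro ln_le_minus_one) simp
          moreover have "ln (d * q j / p i) = ln d + ln (q j) - ln (p i)"
            using p q d by (simp add: ln_divide_pos ln_mult_pos)
          ultimately have "p i * (ln d + ln (q j) - ln (p i)) \<le> p i * (d * q j / p i - 1)"
            using p by (intro mult_left_mono) auto
          also have "\<dots> = d * q j - p i" using p by (simp add: right_diff_distrib)
          finally show ?thesis using p q by (simp add: q_lnsupp_def algebra_simps)
        qed
        then show ?thesis by (intro mult_left_mono) auto
      qed simp
    qed
    finally show ?thesis .
  qed
  then show ?thesis unfolding rel_entropy_spectral[OF dU dV] by auto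
qed

text \<open>The case of equality in the Klein inequality: one eigenbasis serves both operators, so
  only diagonal pairs remain.\<close>

lemma rel_entropy_scaled_self:
  assumes \<omega>: "q_psd F \<omega>" "q_trace \<omega> = 1" and d: "d > 0"
  shows "q_rel_entropy \<omega> (complex_of_real (1 / d) \<cdot>\<^sub>m \<omega>) = ereal (ln d)"
proof -
  obtain U p where dU: "psd_decomp F \<omega> U p" using psd_decomp_exists[OF \<omega>(1)] .
  note u = psd_decompD[OF dU]
  have sp: "(\<Sum>i<F. p i) = 1" using \<omega>(2) unfolding trace_psd_decomp[OF dU] by (simp only: of_real_eq_1_iff)
  have "complex_of_real (1 / d) \<cdot>\<^sub>m \<omega> = U * q_diag F (\<lambda>i. p i / d) * q_adj U"
  proof (rule eq_mat_dimI)
    fix i j assume ij: "i < F" "j < F"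
    have "\<omega> $$ (i,j) = (\<Sum>l<F. p l * U $$ (i,l) * cnj (U $$ (j,l)))"
      using sandwich_diag_index[OF u(1) u(1) ij] u(4) by metis
    then show "(complex_of_real (1 / d) \<cdot>\<^sub>m \<omega>) $$ (i,j) = (U * q_diag F (\<lambda>i. p i / d) * q_adj U) $$ (i,j)"
      unfolding sandwich_diag_index[OF u(1) u(1) ij] using ij u(6) by (simp add: sum_divide_distrib)
  qed (use u in auto)
  then have dV: "psd_decomp F (complex_of_real (1 / d) \<cdot>\<^sub>m \<omega>) U (\<lambda>i. p i / d)"
    using dU d by (simp add: psd_decomp_def)
  have ov: "overlap U U i j = (if i = j then 1 else 0)" if "i < F" "j < F" for i j
    using that u by (simp add: overlap_def)
  have "(\<Sum>j<F. weight U U i j * (p i * (q_lnsupp (p i) - q_lnsupp (p j / d)))) = p i * ln d" if i: "i < F" for i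
  proof -
    have "(\<Sum>j<F. weight U U i j * (p i * (q_lnsupp (p i) - q_lnsupp (p j / d))))
       = (\<Sum>j<F. if i = j then p i * (q_lnsupp (p i) - q_lnsupp (p j / d)) else 0)"
      using i by (intro sum.cong refl) (simp add: ov)
    also have "\<dots> = p i * (q_lnsupp (p i) - q_lnsupp (p i / d))" using i by (simp add: sum_if_eq)
    also have "\<dots> = p i * ln d" using u(5)[OF i] d by (auto simp: q_lnsupp_def ln_divide_pos)
    finally show ?thesis .
  qed
  then have "(\<Sum>i<F. \<Sum>j<F. weight U U i j * (p i * (q_lnsupp (p i) - q_lnsupp (p j / d)))) = ln d"
    by (simp add: sp flip: sum_distrib_right)
  moreover have "\<forall>i<F. \<forall>j<F. p j / d = 0 \<longrightarrow> p i = 0 \<or> overlap U U i j = 0" using d by (auto simp: ov)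
  ultimately show ?thesis
    using rel_entropy_spectral[OF dU dV] if_P by metis
qed

subsection \<open>Covariance and one-designs\<close>

lemma linearI:
  assumes "\<And>X. X \<in> carrier_mat d d \<Longrightarrow> L X \<in> carrier_mat e e"
    "\<And>X Y. X \<in> carrier_mat d d \<Longrightarrow> Y \<in> carrier_mat d d \<Longrightarrow> L (X + Y) = L X + L Y"
    "\<And>X c. X \<in> carrier_mat d d \<Longrightarrow> L (c \<cdot>\<^sub>m X) = c \<cdot>\<^sub>m L X"
  shows "q_linear d e L"
  using assms by (simp add: q_linear_def)

lemma linear_comp:
  assumes "q_linear d e L" "q_linear e f M" shows "q_linear d f (\<lambda>X. M (L X))"
  using linearD[OF assms(1)] linearD[OF assms(2)] by (intro linearI) simp_all

lemma linear_conjugation: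
  assumes "A \<in> carrier_mat d d" shows "q_linear d d (\<lambda>X. A * X * q_adj A)"
proof (rule linearI)
  fix X Y :: "complex mat" and c assume X: "X \<in> carrier_mat d d" and Y: "Y \<in> carrier_mat d d"
  show "A * X * q_adj A \<in> carrier_mat d d" using X assms by simp
  show "A * (X + Y) * q_adj A = A * X * q_adj A + A * Y * q_adj A"
    using X Y assms by (simp add: mult_add_distrib_mat[of _ d d _ d] add_mult_distrib_mat[of _ d d _ _ d] del: assoc_mult_mat)
next
  fix X :: "complex mat" and c assume X: "X \<in> carrier_mat d d"
  show "A * (c \<cdot>\<^sub>m X) * q_adj A = c \<cdot>\<^sub>m (A * X * q_adj A)"
    using X assms by (simp add: mult_smult_distrib[of _ d d _ d] mult_smult_assoc_mat[of _ d d _ d] del: assoc_mult_mat)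
qed

text \<open>Covariance is assumed on states, whereas teleportation needs it on all matrices, in
  particular on off-diagonal blocks. Normalised rank-one matrices are states, and polarisation
  obtains the matrix units from them.\<close>

lemma linear_eq_on_states:
  assumes P: "q_linear d e P" and Q: "q_linear d e Q"
    and eq: "\<And>\<rho>. q_state d \<rho> \<Longrightarrow> P \<rho> = Q \<rho>" and X: "X \<in> carrier_mat d d"
  shows "P X = Q X"
proof -
  have rank1: "P (mat d d (\<lambda>(i,j). v i * cnj (v j))) = Q (mat d d (\<lambda>(i,j). v i * cnj (v j)))"
    if v: "l < d" "v l \<noteq> 0" for v l
  proof -
    let ?R = "mat d 1 (\<lambda>(i,_). v i)" and ?A = "mat d d (\<lambda>(i,j). v i * cnj (v j))"
    have R: "?R \<in> carrier_mat d 1" by simp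
    have A: "?A = ?R * q_adj ?R"
    proof (rule eq_mat_dimI)
      fix i j assume ij: "i < d" "j < d"
      show "?A $$ (i,j) = (?R * q_adj ?R) $$ (i,j)" unfolding gram_index[OF R ij] using ij by simp
    qed auto
    define t where "t = (\<Sum>i<d. (cmod (v i))\<^sup>2)"
    have tr: "q_trace ?A = of_real t" unfolding A trace_mult_adj[OF R] by (simp add: t_def)
    have "0 < (cmod (v l))\<^sup>2" using v by simp
    also have "\<dots> \<le> t" unfolding t_def using v by (intro member_le_sum) auto
    finally have t: "t > 0" .
    have "q_psd d (complex_of_real (1/t) \<cdot>\<^sub>m ?A)" unfolding A using t by (intro psd_smult psd_gramI[OF R]) simp
    then have st: "q_state d (complex_of_real (1/t) \<cdot>\<^sub>m ?A)"
      using t trace_smult[of ?A d "complex_of_real (1/t)"] by (simp add: q_state_def tr)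
    have "?A = complex_of_real t \<cdot>\<^sub>m (complex_of_real (1/t) \<cdot>\<^sub>m ?A)" using t by (intro eq_matI) auto
    then have "P ?A = complex_of_real t \<cdot>\<^sub>m P (complex_of_real (1/t) \<cdot>\<^sub>m ?A)"
       "Q ?A = complex_of_real t \<cdot>\<^sub>m Q (complex_of_real (1/t) \<cdot>\<^sub>m ?A)"
      using linearD(3)[OF P, of "complex_of_real (1/t) \<cdot>\<^sub>m ?A" "complex_of_real t"]
        linearD(3)[OF Q, of "complex_of_real (1/t) \<cdot>\<^sub>m ?A" "complex_of_real t"] by simp_all
    then show ?thesis by (simp only: eq[OF st])
  qed
  have unit_eq: "P (q_unit d x y) $$ (a,b) = Q (q_unit d x y) $$ (a,b)" if xy: "x < d" "y < d" and ab: "a < e" "b < e" for x y a b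
  proof -
    define p q where "p = (\<lambda>i j. P (q_unit d i j) $$ (a,b))" and "q = (\<lambda>i j. Q (q_unit d i j) $$ (a,b))"
    \<comment> \<open>The test vector is e_x + c e_y. The side condition keeps it nonzero, as x = y
      with c = -1 would cancel it.\<close>
    have form: "p x x + cnj c * p x y + c * p y x + c * cnj c * p y y = q x x + cnj c * q x y + c * q y x + c * cnj c * q y y"
      if "x \<noteq> y \<or> c = 0" for c
    proof -
      define v where "v = (\<lambda>k. (if k = x then 1 else 0) + (if k = y then c else 0))"
      let ?A = "mat d d (\<lambda>(i,j). v i * cnj (v j))"
      have "v x \<noteq> 0" using that by (auto simp: v_def)
      then have "P ?A = Q ?A" by (rule rank1[OF xy(1)])
      moreover have "R ?A $$ (a,b) = f x x + cnj c * f x y + c * f y x + c * cnj c * f y y"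
        if R: "q_linear d e R" and f: "f = (\<lambda>i j. R (q_unit d i j) $$ (a,b))" for R f
      proof -
        have inner: "(\<Sum>l<d. cnj (v l) * g l) = g x + cnj c * g y" for g
          unfolding v_def using xy
          by (simp add: distrib_right sum.distrib if_distrib[of cnj] if_distrib[of "\<lambda>y. y * _"] sum_if_eq cong: if_cong)
        have outer: "(\<Sum>l<d. v l * g l) = g x + c * g y" for g
          unfolding v_def using xy
          by (simp add: distrib_right sum.distrib if_distrib[of "\<lambda>y. y * _"] sum_if_eq cong: if_cong)
        have "R ?A $$ (a,b) = (\<Sum>i<d. v i * (\<Sum>j<d. cnj (v j) * f i j))"
          unfolding linear_expand[OF R mat_carrier ab] f by (simp add: sum_distrib_left mult.assoc)
        also have "\<dots> = f x x + cnj c * f x y + c * (f y x + cnj c * f y y)" unfolding inner outer ..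
        finally show ?thesis by (simp add: algebra_simps)
      qed
      from this[OF P p_def] this[OF Q q_def] show ?thesis using calculation by simp
    qed
    show ?thesis
    proof (cases "x = y")
      case True
      then show ?thesis using form[of 0] by (simp add: p_def q_def)
    next
      case False
      \<comment> \<open>The family above always contains e_x, so the diagonal unit at y needs its
        own test vector e_y.\<close>
      have yy: "p y y = q y y"
      proof -
        let ?A = "mat d d (\<lambda>(i,j). (if i = y then 1 else 0) * cnj (if j = y then 1 else 0))"
        have "?A = q_unit d y y" by (rule eq_matI) (auto simp: q_unit_def)
        then show ?thesis using rank1[of y "\<lambda>i. if i = y then 1 else 0"] xy by (simp add: p_def q_def)
      qed
      have xx: "p x x = q x x" using form[of 0] by simp
      have 1: "p x y + p y x = q x y + q y x" using form[of 1] False xx yy by simp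
      have "- \<i> * p x y + \<i> * p y x = - \<i> * q x y + \<i> * q y x" using form[of \<i>] False xx yy by simp
      then have "\<i> * (p y x - p x y) = \<i> * (q y x - q x y)" by (simp add: algebra_simps)
      then have 2: "p y x - p x y = q y x - q x y" by simp
      have "2 * p x y = (p x y + p y x) - (p y x - p x y)" by simp
      also have "\<dots> = 2 * q x y" unfolding 1 2 by simp
      finally show ?thesis by (simp add: p_def q_def)
    qed
  qed
  show ?thesis
  proof (rule eq_mat_dimI)
    fix a b assume ab: "a < e" "b < e"
    show "P X $$ (a,b) = Q X $$ (a,b)"
      unfolding linear_expand[OF P X ab] linear_expand[OF Q X ab] by (intro sum.cong refl) (simp add: unit_eq ab)
  qed (use linearD(1)[OF P X] linearD(1)[OF Q X] in auto)
qed

text \<open>The entry (x,x') of the one-design identity at the matrix unit E_yy'; these are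
  Schur-type relations, read off directly from the design property.\<close>

lemma one_design_orthogonality:
  assumes design: "q_one_design G d U" and U: "\<And>g. g \<in> carrier G \<Longrightarrow> U g \<in> carrier_mat d d"
    and card: "card (carrier G) > 0" and b: "x < d" "y < d" "x' < d" "y' < d"
  shows "(\<Sum>g\<in>carrier G. U g $$ (x,y) * cnj (U g $$ (x',y')))
    = (if x = x' \<and> y = y' then of_nat (card (carrier G)) / of_nat d else 0)"
proof -
  let ?X = "q_unit d y y'"
  have conj: "(U g * ?X * q_adj (U g)) $$ (x,x') = U g $$ (x,y) * cnj (U g $$ (x',y'))" if g: "g \<in> carrier G" for g
  proof -
    have "(U g * ?X * q_adj (U g)) $$ (x,x')
       = (\<Sum>i<d. \<Sum>j<d. (if y = i \<and> y' = j then 1 else 0) * (U g $$ (x,i) * cnj (U g $$ (x',j))))"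
      using U[OF g] b by (subst index_mult3_carrier[of _ d d _ d _ d]) (auto simp: unit_index intro!: sum.cong)
    then show ?thesis by (simp add: sum_unit_pick b)
  qed
  have "((1 / of_nat (card (carrier G))) \<cdot>\<^sub>m
          mat d d (\<lambda>(k,l). \<Sum>g \<in> carrier G. (U g * ?X * q_adj (U g)) $$ (k,l))) $$ (x,x')
        = ((q_trace ?X / of_nat d) \<cdot>\<^sub>m 1\<^sub>m d) $$ (x,x')"
    by (rule arg_cong[OF bspec[OF design[unfolded q_one_design_def] unit_carrier], of "\<lambda>M. M $$ (x,x')"])
  then have "(\<Sum>g\<in>carrier G. U g $$ (x,y) * cnj (U g $$ (x',y'))) / of_nat (card (carrier G))
     = (if x = x' \<and> y = y' then 1 / of_nat d else 0)"
    using b by (simp add: conj trace_unit split: if_splits)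
  then show ?thesis using card by (auto simp: field_simps split: if_splits)
qed

text \<open>Entries of Kronecker products factor, so the sum over pairs is the product of two sums,
  and a product of one-designs is again one.\<close>

lemma kron_orthogonality:
  assumes UA: "\<And>g. g \<in> I \<Longrightarrow> UA g \<in> carrier_mat m m" and UB: "\<And>h. h \<in> J \<Longrightarrow> UB h \<in> carrier_mat n n"
    and oA: "\<And>x y x' y'. x < m \<Longrightarrow> y < m \<Longrightarrow> x' < m \<Longrightarrow> y' < m \<Longrightarrow>
      (\<Sum>g\<in>I. UA g $$ (x,y) * cnj (UA g $$ (x',y'))) = (if x = x' \<and> y = y' then cA / of_nat m else 0)"
    and oB: "\<And>x y x' y'. x < n \<Longrightarrow> y < n \<Longrightarrow> x' < n \<Longrightarrow> y' < n \<Longrightarrow>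
      (\<Sum>h\<in>J. UB h $$ (x,y) * cnj (UB h $$ (x',y'))) = (if x = x' \<and> y = y' then cB / of_nat n else 0)"
    and b: "x < m*n" "y < m*n" "x' < m*n" "y' < m*n"
  shows "(\<Sum>k\<in>I \<times> J. (case k of (g,h) \<Rightarrow> q_kron (UA g) (UB h)) $$ (x,y) * cnj ((case k of (g,h) \<Rightarrow> q_kron (UA g) (UB h)) $$ (x',y')))
    = (if x = x' \<and> y = y' then cA * cB / of_nat (m*n) else 0)"
proof -
  note b' = less_mult_div_mod[OF b(1)] less_mult_div_mod[OF b(2)] less_mult_div_mod[OF b(3)] less_mult_div_mod[OF b(4)]
  have idx: "q_kron (UA g) (UB h) $$ (i,j) = UA g $$ (i div n, j div n) * UB h $$ (i mod n, j mod n)"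
    if "g \<in> I" "h \<in> J" "i < m*n" "j < m*n" for g h i j
    using UA[OF that(1)] UB[OF that(2)] that by (auto simp: q_kron_def)
  have "(\<Sum>k\<in>I \<times> J. (case k of (g,h) \<Rightarrow> q_kron (UA g) (UB h)) $$ (x,y) * cnj ((case k of (g,h) \<Rightarrow> q_kron (UA g) (UB h)) $$ (x',y')))
     = (\<Sum>(g,h)\<in>I \<times> J. (UA g $$ (x div n, y div n) * cnj (UA g $$ (x' div n, y' div n))) *
         (UB h $$ (x mod n, y mod n) * cnj (UB h $$ (x' mod n, y' mod n))))"
    by (intro sum.cong refl) (auto simp: idx b)
  also have "\<dots> = (\<Sum>g\<in>I. UA g $$ (x div n, y div n) * cnj (UA g $$ (x' div n, y' div n))) *
         (\<Sum>h\<in>J. UB h $$ (x mod n, y mod n) * cnj (UB h $$ (x' mod n, y' mod n)))"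
    unfolding sum_product sum.cartesian_product ..
  also have "\<dots> = (if x = x' \<and> y = y' then cA * cB / of_nat (m*n) else 0)"
  proof -
    have "x = x' \<longleftrightarrow> x div n = x' div n \<and> x mod n = x' mod n" "y = y' \<longleftrightarrow> y div n = y' div n \<and> y mod n = y' mod n"
      by (metis div_mult_mod_eq)+
    then show ?thesis using b' by (auto simp: oA oB)
  qed
  finally show ?thesis .
qed

subsection \<open>The reduced channel and the map it induces\<close>

lemma kron_add_right:
  assumes "A \<in> carrier_mat m n" "B \<in> carrier_mat p q" "C \<in> carrier_mat p q"
  shows "q_kron A (B + C) = q_kron A B + q_kron A C"
proof (rule eq_mat_prodI[where m = m and p = p and n = n and q = q])
  fix x y x' y' assume b: "x < m" "y < p" "x' < n" "y' < q"
  note ka = kron_carrier[OF assms(1,2)] kron_carrier[OF assms(1,3)]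
  show "q_kron A (B + C) $$ (x*p + y, x'*q + y') = (q_kron A B + q_kron A C) $$ (x*p + y, x'*q + y')"
    using b assms carrier_matD[OF ka(2)]
    by (simp add: kron_index[OF assms(1,2) b] kron_index[OF assms(1,3) b] kron_index[OF assms(1) _ b] mult_add_less_mult distrib_left)
qed (use assms in auto)

lemma kron_smult_right:
  assumes "A \<in> carrier_mat m n" "B \<in> carrier_mat p q"
  shows "q_kron A (c \<cdot>\<^sub>m B) = c \<cdot>\<^sub>m q_kron A B"
proof (rule eq_mat_prodI[where m = m and p = p and n = n and q = q])
  fix x y x' y' assume b: "x < m" "y < p" "x' < n" "y' < q"
  show "q_kron A (c \<cdot>\<^sub>m B) $$ (x*p + y, x'*q + y') = (c \<cdot>\<^sub>m q_kron A B) $$ (x*p + y, x'*q + y')"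
    using b assms carrier_matD[OF kron_carrier[OF assms]]
    by (simp add: kron_index[OF assms b] kron_index[OF assms(1) _ b] mult_add_less_mult)
qed (use assms in auto)

lemma linear_kron: "A \<in> carrier_mat m m \<Longrightarrow> q_linear p (m*p) (q_kron A)"
  by (rule linearI) (auto simp: kron_add_right[of _ m m _ p p] kron_smult_right[of _ m m _ p p])

lemma linear_ptrace1: "q_linear (m*n) n (q_ptrace1 m n)"
proof (rule linearI)
  fix X Y :: "complex mat" and c assume X: "X \<in> carrier_mat (m*n) (m*n)" and Y: "Y \<in> carrier_mat (m*n) (m*n)"
  show "q_ptrace1 m n X \<in> carrier_mat n n" by simp
  show "q_ptrace1 m n (X + Y) = q_ptrace1 m n X + q_ptrace1 m n Y"
    using X Y by (intro eq_matI) (auto simp: q_ptrace1_def mult_add_less_mult sum.distrib)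
next
  fix X :: "complex mat" and c assume X: "X \<in> carrier_mat (m*n) (m*n)"
  show "q_ptrace1 m n (c \<cdot>\<^sub>m X) = c \<cdot>\<^sub>m q_ptrace1 m n X"
    using X by (intro eq_matI) (auto simp: q_ptrace1_def mult_add_less_mult sum_distrib_left)
qed

lemma trace_kron:
  assumes "A \<in> carrier_mat m m" "B \<in> carrier_mat p p" shows "q_trace (q_kron A B) = q_trace A * q_trace B"
  unfolding trace_carrier[OF kron_carrier[OF assms]] trace_carrier[OF assms(1)] trace_carrier[OF assms(2)]
    sum_lessThan_mult sum_product
  by (intro sum.cong refl) (simp add: kron_index[OF assms])

lemma kron_sandwich:
  assumes "A \<in> carrier_mat m m" "B \<in> carrier_mat p p" "X \<in> carrier_mat m m" "Y \<in> carrier_mat p p"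
  shows "q_kron A B * q_kron X Y * q_adj (q_kron A B) = q_kron (A * X * q_adj A) (B * Y * q_adj B)"
proof -
  have "q_kron A B * q_kron X Y * q_adj (q_kron A B) = q_kron (A * X) (B * Y) * q_kron (q_adj A) (q_adj B)"
    unfolding adj_kron[OF assms(1,2)] kron_mult[OF assms] ..
  also have "\<dots> = q_kron (A * X * q_adj A) (B * Y * q_adj B)"
    using assms by (intro kron_mult[of _ m m _ p p _ m _ p]) auto
  finally show ?thesis .
qed

text \<open>Summing the traced-out index k first produces the adjoint of A times A, so the unitary
  on that factor disappears.\<close>

lemma ptrace1_conjugation:
  assumes A: "q_unitary m A" and B: "B \<in> carrier_mat n n" and X: "X \<in> carrier_mat (m*n) (m*n)"
  shows "q_ptrace1 m n (q_kron A B * X * q_adj (q_kron A B)) = B * q_ptrace1 m n X * q_adj B"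
proof (rule eq_mat_dimI)
  note a = unitaryD[OF A]
  have AA: "(\<Sum>k<m. A $$ (k,x) * cnj (A $$ (k,x'))) = (if x = x' then 1 else 0)" if "x < m" "x' < m" for x x'
  proof -
    have "(\<Sum>k<m. A $$ (k,x) * cnj (A $$ (k,x'))) = (q_adj A * A) $$ (x',x)"
      using a(1) that by (subst index_mult_carrier[of _ m m _ m]) (auto intro!: sum.cong)
    then show ?thesis unfolding a(2) using that by auto
  qed
  note K = kron_carrier[OF a(1) B]
  fix i j assume ij: "i < n" "j < n"
  have "q_ptrace1 m n (q_kron A B * X * q_adj (q_kron A B)) $$ (i,j)
    = (\<Sum>k<m. \<Sum>x<m. \<Sum>y<n. \<Sum>x'<m. \<Sum>y'<n. (B $$ (i,y) * X $$ (x*n + y, x'*n + y') * cnj (B $$ (j,y'))) * (A $$ (k,x) * cnj (A $$ (k,x'))))"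
    unfolding ptrace1_index[OF ij]
  proof (rule sum.cong[OF refl])
    fix k assume "k \<in> {..<m}"
    then have k: "k < m" by simp
    have "(q_kron A B * X * q_adj (q_kron A B)) $$ (k*n + i, k*n + j)
      = (\<Sum>x<m*n. \<Sum>y<m*n. q_kron A B $$ (k*n + i, x) * X $$ (x,y) * cnj (q_kron A B $$ (k*n + j, y)))"
      using K X k ij carrier_matD[OF K] unfolding index_mult3_carrier[OF K X adj_carrier[OF K] mult_add_less_mult[OF k ij(1)] mult_add_less_mult[OF k ij(2)]]
      by (intro sum.cong refl) (simp add: mult_add_less_mult)
    also have "\<dots> = (\<Sum>x<m. \<Sum>y<n. \<Sum>x'<m. \<Sum>y'<n. (B $$ (i,y) * X $$ (x*n + y, x'*n + y') * cnj (B $$ (j,y'))) * (A $$ (k,x) * cnj (A $$ (k,x'))))"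
      unfolding sum_lessThan_mult
      by (intro sum.cong refl, simp add: kron_index[OF a(1) B] k ij, (simp add: mult_ac)?)
    finally show "(q_kron A B * X * q_adj (q_kron A B)) $$ (k*n + i, k*n + j) = \<dots>" .
  qed
  also have "\<dots> = (\<Sum>x<m. \<Sum>y<n. \<Sum>x'<m. \<Sum>y'<n. \<Sum>k<m. (B $$ (i,y) * X $$ (x*n + y, x'*n + y') * cnj (B $$ (j,y'))) * (A $$ (k,x) * cnj (A $$ (k,x'))))"
  proof -
    have swap: "(\<Sum>k<m. \<Sum>x<m. \<Sum>y<n. \<Sum>x'<m. \<Sum>y'<n. f k x y x' y') = (\<Sum>x<m. \<Sum>y<n. \<Sum>x'<m. \<Sum>y'<n. \<Sum>k<m. f k x y x' y')"
      for f :: "nat \<Rightarrow> nat \<Rightarrow> nat \<Rightarrow> nat \<Rightarrow> nat \<Rightarrow> complex"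
      by (rule trans[OF sum.swap sum.cong[OF refl]], rule trans[OF sum.swap sum.cong[OF refl]],
          rule trans[OF sum.swap sum.cong[OF refl]], rule sum.swap)
    show ?thesis by (rule swap)
  qed
  also have "\<dots> = (\<Sum>x<m. \<Sum>y<n. \<Sum>x'<m. if x = x' then (\<Sum>y'<n. B $$ (i,y) * X $$ (x*n + y, x'*n + y') * cnj (B $$ (j,y'))) else 0)"
    by (intro sum.cong refl) (simp add: AA flip: sum_distrib_left)
  also have "\<dots> = (\<Sum>x<m. \<Sum>y<n. \<Sum>y'<n. B $$ (i,y) * X $$ (x*n + y, x*n + y') * cnj (B $$ (j,y')))"
    by (rule sum.cong[OF refl], rule sum.cong[OF refl]) (simp add: sum_if_eq)
  also have "\<dots> = (\<Sum>y<n. \<Sum>y'<n. \<Sum>x<m. B $$ (i,y) * X $$ (x*n + y, x*n + y') * cnj (B $$ (j,y')))"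
    by (simp only: sum.swap[of _ "{..<n}" "{..<m}"])
  also have "\<dots> = (B * q_ptrace1 m n X * q_adj B) $$ (i,j)"
    using B ij unfolding index_mult3_carrier[OF B ptrace1_carrier adj_carrier[OF B] ij]
    by (intro sum.cong refl) (simp add: ptrace1_index sum_distrib_left sum_distrib_right)
  finally show "q_ptrace1 m n (q_kron A B * X * q_adj (q_kron A B)) $$ (i,j) = (B * q_ptrace1 m n X * q_adj B) $$ (i,j)" .
qed (use B in \<open>auto simp: q_ptrace1_def\<close>)

text \<open>Since tr E_ij vanishes off the diagonal, only the diagonal blocks of X survive, and by
  linearity M sees their sum, the partial trace. This replaces the block formula by a composition of
  three linear maps.\<close>

lemma replace_tensor_eq:
  assumes M: "q_linear dB' dB M" and X: "X \<in> carrier_mat (dA' * dB') (dA' * dB')"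
  shows "q_map_tensor dA' dB' dA dB (q_replace dA) M X = q_kron (1\<^sub>m dA) (M (q_ptrace1 dA' dB' X))"
proof (rule eq_mat_prodI[where m = dA and p = dB and n = dA and q = dB])
  have Mc: "M (q_ptrace1 dA' dB' X) \<in> carrier_mat dB dB" by (rule linearD(1)[OF M]) simp
  show "q_kron (1\<^sub>m dA) (M (q_ptrace1 dA' dB' X)) \<in> carrier_mat (dA*dB) (dA*dB)" using Mc by simp
  fix a b a' b' assume bd: "a < dA" "b < dB" "a' < dA" "b' < dB"
  have "q_ptrace1 dA' dB' X = mat_sum dB' dB' (\<lambda>i. q_block dB' X i i) {..<dA'}"
    by (rule eq_matI) (auto simp: q_ptrace1_def mat_sum_def block_index)
  then have MX: "M (q_ptrace1 dA' dB' X) = mat_sum dB dB (\<lambda>i. M (q_block dB' X i i)) {..<dA'}"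
    using linear_mat_sum[OF M, of "{..<dA'}" "\<lambda>i. q_block dB' X i i"] by simp
  have "q_map_tensor dA' dB' dA dB (q_replace dA) M X $$ (a*dB + b, a'*dB + b')
     = (\<Sum>i<dA'. \<Sum>j<dA'. q_replace dA (q_unit dA' i j) $$ (a,a') * M (q_block dB' X i j) $$ (b,b'))"
    using bd by (simp add: q_map_tensor_def mult_add_less_mult)
  also have "\<dots> = (\<Sum>i<dA'. \<Sum>j<dA'. if i = j then (if a = a' then 1 else 0) * M (q_block dB' X i j) $$ (b,b') else 0)"
    using bd by (intro sum.cong refl) (simp add: q_replace_def trace_unit)
  also have "\<dots> = (if a = a' then 1 else 0) * (\<Sum>i<dA'. M (q_block dB' X i i) $$ (b,b'))"
    by (simp add: sum_if_eq sum_distrib_left)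
  also have "\<dots> = q_kron (1\<^sub>m dA) (M (q_ptrace1 dA' dB' X)) $$ (a*dB + b, a'*dB + b')"
    unfolding kron_index[OF one_carrier_mat Mc bd] using bd by (simp add: MX mat_sum_index)
  finally show "q_map_tensor dA' dB' dA dB (q_replace dA) M X $$ (a*dB + b, a'*dB + b')
      = q_kron (1\<^sub>m dA) (M (q_ptrace1 dA' dB' X)) $$ (a*dB + b, a'*dB + b')" .
qed (simp add: q_map_tensor_def)

lemma linear_replace_tensor:
  assumes M: "q_linear dB' dB M"
  shows "q_linear (dA' * dB') (dA * dB) (q_map_tensor dA' dB' dA dB (q_replace dA) M)"
proof -
  have "q_linear (dA' * dB') (dA * dB) (\<lambda>X. q_kron (1\<^sub>m dA) (M (q_ptrace1 dA' dB' X)))"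
    by (rule linear_comp[OF linear_comp[OF linear_ptrace1 M] linear_kron]) simp
  from linearD[OF this] show ?thesis
    by (intro linearI) (simp_all add: replace_tensor_eq[OF M])
qed

definition mixed :: "nat \<Rightarrow> complex mat" where
  "mixed d = (1 / of_nat d) \<cdot>\<^sub>m 1\<^sub>m d"

lemma mixed_carrier [simp]: "mixed d \<in> carrier_mat d d"
  by (simp add: mixed_def)

definition reduced_channel :: "nat \<Rightarrow> nat \<Rightarrow> nat \<Rightarrow> (complex mat \<Rightarrow> complex mat) \<Rightarrow> complex mat \<Rightarrow> complex mat" where
  "reduced_channel dA' dA dB N Y = q_ptrace1 dA dB (N (q_kron (mixed dA') Y))"

lemma linear_reduced_channel:
  assumes "q_linear (dA' * dB') (dA * dB) N" shows "q_linear dB' dB (reduced_channel dA' dA dB N)"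
  unfolding reduced_channel_def
  by (rule linear_comp[OF linear_comp[OF linear_kron assms] linear_ptrace1]) simp

text \<open>Complete positivity is inherited in three moves: insert the mixed state of A' between
  the reference and B', apply N with the same reference, trace out A. The outer two are weighted
  selections of indices.\<close>

lemma channel_reduced_channel:
  assumes N: "q_channel (dA' * dB') (dA * dB) N" and dA': "dA' > 0"
  shows "q_channel dB' dB (reduced_channel dA' dA dB N)"
proof -
  let ?M = "reduced_channel dA' dA dB N" and ?D = "dA' * dB'" and ?E = "dA * dB"
  have lin: "q_linear ?D ?E N" using N by (simp add: q_channel_def q_CP_def)
  have "q_trace (?M Y) = q_trace Y" if Y: "Y \<in> carrier_mat dB' dB'" for Y
  proof -
    have k: "q_kron (mixed dA') Y \<in> carrier_mat ?D ?D" using Y by simp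
    have "q_trace (?M Y) = q_trace (q_kron (mixed dA') Y)"
      unfolding reduced_channel_def trace_ptrace1[OF linearD(1)[OF lin k]] using N k by (simp add: q_channel_def)
    also have "\<dots> = q_trace (mixed dA') * q_trace Y" by (rule trace_kron[OF mixed_carrier Y])
    also have "q_trace (mixed dA') = 1" using dA' by (simp add: mixed_def q_trace_def)
    finally show ?thesis by simp
  qed
  moreover have "q_psd (n*dB) (q_id_tensor n dB' dB ?M X)" if n: "n > 0" and X: "q_psd (n*dB') X" for n X
  proof -
    \<comment> \<open>For an index p of R A' B', \<open>w k\<close> keeps the label k of A' with
      amplitude 1/sqrt|A'| and \<open>f\<close> deletes that label. Summing over k places the
      maximally mixed state on A'.\<close>
    define w where "w = (\<lambda>k p. if (p mod ?D) div dB' = k then complex_of_real (sqrt (1 / real dA')) else 0)"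
    define f where "f = (\<lambda>p. (p div ?D)*dB' + (p mod ?D) mod dB')"
    define Z where "Z = mat_sum (n*?D) (n*?D) (\<lambda>k. mat (n*?D) (n*?D) (\<lambda>(p,p'). w k p * cnj (w k p') * X $$ (f p, f p'))) {..<dA'}"
    have "q_psd (n*?D) Z"
      unfolding Z_def
    proof (intro psd_mat_sum psd_pullback[OF X])
      fix p assume p: "p < n*?D"
      show "f p < n*dB'" unfolding f_def
        by (rule mult_add_less_mult[OF less_mult_div_mod(1)[OF p] less_mult_div_mod(2)[OF less_mult_div_mod(2)[OF p]]])
    qed
    then have N1: "q_psd (n*?E) (q_id_tensor n ?D ?E N Z)" using N n by (simp add: q_channel_def q_CP_def)
    have blk: "q_block ?D Z r s = q_kron (mixed dA') (q_block dB' X r s)" if rs: "r < n" "s < n" for r s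
    proof (rule eq_mat_prodI[where m = dA' and p = dB' and n = dA' and q = dB'])
      fix k y k' y' assume b: "k < dA'" "y < dB'" "k' < dA'" "y' < dB'"
      have kb: "k*dB' + y < ?D" "k'*dB' + y' < ?D" using b by (auto simp: mult_add_less_mult)
      have sq: "complex_of_real (sqrt (1 / real dA')) * complex_of_real (sqrt (1 / real dA')) = 1 / of_nat dA'"
        by (simp flip: of_real_mult)
      have wv: "w l (r*?D + (k*dB' + y)) = (if k = l then complex_of_real (sqrt (1 / real dA')) else 0)"
        "w l (s*?D + (k'*dB' + y')) = (if k' = l then complex_of_real (sqrt (1 / real dA')) else 0)" for l
        unfolding w_def mod_mult_add[OF kb(1)] mod_mult_add[OF kb(2)] div_mult_add[OF b(2)] div_mult_add[OF b(4)] by simp_all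
      have fv: "f (r*?D + (k*dB' + y)) = r*dB' + y" "f (s*?D + (k'*dB' + y')) = s*dB' + y'"
        unfolding f_def mod_mult_add[OF kb(1)] mod_mult_add[OF kb(2)] div_mult_add[OF kb(1)] div_mult_add[OF kb(2)]
          mod_mult_add[OF b(2)] mod_mult_add[OF b(4)] by simp_all
      have bd: "r*?D + (k*dB' + y) < n*?D" "s*?D + (k'*dB' + y') < n*?D"
        by (rule mult_add_less_mult[OF rs(1) kb(1)], rule mult_add_less_mult[OF rs(2) kb(2)])
      have "q_block ?D Z r s $$ (k*dB' + y, k'*dB' + y')
         = (\<Sum>l<dA'. w l (r*?D + (k*dB' + y)) * cnj (w l (s*?D + (k'*dB' + y'))) * X $$ (r*dB' + y, s*dB' + y'))"
        unfolding block_index[OF kb] Z_def mat_sum_index[OF bd] using bd by (simp add: fv)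
      also have "\<dots> = (\<Sum>l<dA'. if k = l then (if k' = k then 1 / of_nat dA' * X $$ (r*dB' + y, s*dB' + y') else 0) else 0)"
        unfolding wv by (intro sum.cong refl) (auto simp: sq)
      also have "\<dots> = mixed dA' $$ (k,k') * q_block dB' X r s $$ (y,y')"
        using b by (simp add: sum_if_eq mixed_def block_index)
      finally show "q_block ?D Z r s $$ (k*dB' + y, k'*dB' + y') = q_kron (mixed dA') (q_block dB' X r s) $$ (k*dB' + y, k'*dB' + y')"
        unfolding kron_index[OF mixed_carrier block_carrier b] .
    qed auto
    \<comment> \<open>Inserts the label a of A into an index of R B, so that the sum over a is the
      partial trace over A.\<close>
    define h where "h = (\<lambda>a i. (i div dB)*?E + (a*dB + i mod dB))"
    let ?R = "mat_sum (n*dB) (n*dB) (\<lambda>a. mat (n*dB) (n*dB) (\<lambda>(i,j). 1 * cnj 1 * q_id_tensor n ?D ?E N Z $$ (h a i, h a j))) {..<dA}"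
    have "q_psd (n*dB) ?R"
    proof (intro psd_mat_sum psd_pullback[OF N1])
      fix a i assume "a \<in> {..<dA}" and i: "i < n*dB"
      then show "h a i < n*?E" unfolding h_def
        by (intro mult_add_less_mult less_mult_div_mod[OF i]) auto
    qed
    moreover have "q_id_tensor n dB' dB ?M X = ?R"
    proof (rule eq_mat_prodI[where m = n and p = dB and n = n and q = dB])
      fix r b s b' assume bd: "r < n" "b < dB" "s < n" "b' < dB"
      have "q_id_tensor n dB' dB ?M X $$ (r*dB + b, s*dB + b')
          = (\<Sum>a<dA. N (q_kron (mixed dA') (q_block dB' X r s)) $$ (a*dB + b, a*dB + b'))"
        by (simp add: id_tensor_index bd reduced_channel_def ptrace1_index)
      also have "\<dots> = (\<Sum>a<dA. q_id_tensor n ?D ?E N Z $$ (r*?E + (a*dB + b), s*?E + (a*dB + b')))"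
        by (intro sum.cong refl) (simp add: id_tensor_index bd blk mult_add_less_mult)
      also have "\<dots> = ?R $$ (r*dB + b, s*dB + b')"
        using bd by (simp add: mat_sum_index mult_add_less_mult h_def)
      finally show "q_id_tensor n dB' dB ?M X $$ (r*dB + b, s*dB + b') = ?R $$ (r*dB + b, s*dB + b')" .
    qed auto
    ultimately show ?thesis by simp
  qed
  ultimately show ?thesis
    unfolding q_channel_def q_CP_def using linear_reduced_channel[OF lin] by blast
qed

lemma unitary_conj_mixed:
  assumes "q_unitary d A" shows "A * mixed d * q_adj A = mixed d"
proof -
  note a = unitaryD[OF assms]
  have "A * mixed d * q_adj A = (1 / of_nat d) \<cdot>\<^sub>m (A * q_adj A)"
    unfolding mixed_def using a(1) by (simp add: mult_smult_distrib[of _ d d _ d] mult_smult_assoc_mat[of _ d d _ d])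
  then show ?thesis by (simp add: a(3) mixed_def)
qed

text \<open>The mixed state is invariant under A, so B alone acts like A \<otimes> B on the input of
  N; on the output side the partial trace discards V.\<close>

lemma reduced_channel_covariant:
  assumes N: "q_linear (dA' * dB') (dA * dB) N"
    and cov: "\<And>X. X \<in> carrier_mat (dA' * dB') (dA' * dB') \<Longrightarrow>
      N (q_kron A B * X * q_adj (q_kron A B)) = q_kron V W * N X * q_adj (q_kron V W)"
    and A: "q_unitary dA' A" and B: "B \<in> carrier_mat dB' dB'" and V: "q_unitary dA V" and W: "W \<in> carrier_mat dB dB"
    and Y: "Y \<in> carrier_mat dB' dB'"
  shows "reduced_channel dA' dA dB N (B * Y * q_adj B) = W * reduced_channel dA' dA dB N Y * q_adj W"
proof -
  have "q_kron (mixed dA') (B * Y * q_adj B) = q_kron A B * q_kron (mixed dA') Y * q_adj (q_kron A B)"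
    using kron_sandwich[OF unitaryD(1)[OF A] B mixed_carrier Y] by (simp add: unitary_conj_mixed[OF A])
  then show ?thesis
    unfolding reduced_channel_def
    using cov[of "q_kron (mixed dA') Y"] ptrace1_conjugation[OF V W linearD(1)[OF N, of "q_kron (mixed dA') Y"]] Y
    by simp
qed

text \<open>The partial trace on the input absorbs A, and the identity on the output is invariant
  under V.\<close>

lemma replace_tensor_covariant:
  assumes M: "q_linear dB' dB M"
    and cov: "\<And>Y. Y \<in> carrier_mat dB' dB' \<Longrightarrow> M (B * Y * q_adj B) = W * M Y * q_adj W"
    and A: "q_unitary dA' A" and B: "B \<in> carrier_mat dB' dB'" and V: "q_unitary dA V" and W: "W \<in> carrier_mat dB dB"
    and X: "X \<in> carrier_mat (dA' * dB') (dA' * dB')"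
  defines "L \<equiv> q_map_tensor dA' dB' dA dB (q_replace dA) M"
  shows "L (q_kron A B * X * q_adj (q_kron A B)) = q_kron V W * L X * q_adj (q_kron V W)"
proof -
  have K: "q_kron A B * X * q_adj (q_kron A B) \<in> carrier_mat (dA' * dB') (dA' * dB')"
    using unitaryD(1)[OF A] B X by simp
  have MY: "M (q_ptrace1 dA' dB' X) \<in> carrier_mat dB dB" by (rule linearD(1)[OF M]) simp
  have "L (q_kron A B * X * q_adj (q_kron A B)) = q_kron (1\<^sub>m dA) (W * M (q_ptrace1 dA' dB' X) * q_adj W)"
    unfolding L_def replace_tensor_eq[OF M K] ptrace1_conjugation[OF A B X] by (simp add: cov)
  also have "\<dots> = q_kron V W * q_kron (1\<^sub>m dA) (M (q_ptrace1 dA' dB' X)) * q_adj (q_kron V W)"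
    unfolding kron_sandwich[OF unitaryD(1)[OF V] W one_carrier_mat MY] using unitaryD[OF V] by simp
  finally show ?thesis unfolding L_def replace_tensor_eq[OF M X] .
qed

subsection \<open>The reordered Choi matrices\<close>

lemma maxent_carrier [simp]: "q_maxent d \<in> carrier_mat (d*d) (d*d)"
  by (simp add: q_maxent_def)

lemma state_maxent:
  assumes "d > 0" shows "q_state (d*d) (q_maxent d)"
proof -
  let ?S = "mat (d*d) 1 (\<lambda>(i,_). if i div d = i mod d then complex_of_real (sqrt (1 / real d)) else 0)"
  have S: "?S \<in> carrier_mat (d*d) 1" by simp
  have sq: "complex_of_real (sqrt (1 / real d)) * complex_of_real (sqrt (1 / real d)) = 1 / of_nat d"
    by (simp flip: of_real_mult)
  have "q_maxent d = ?S * q_adj ?S"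
  proof (rule eq_mat_dimI)
    fix i j assume ij: "i < d*d" "j < d*d"
    show "q_maxent d $$ (i,j) = (?S * q_adj ?S) $$ (i,j)"
      unfolding gram_index[OF S ij] using ij sq by (simp add: q_maxent_def)
  qed (auto simp: q_maxent_def)
  then have "q_psd (d*d) (q_maxent d)" using psd_gramI[OF S] by simp
  moreover have "q_trace (q_maxent d) = (\<Sum>x<d. \<Sum>y<d. if x = y then 1 / of_nat d else 0)"
    unfolding trace_carrier[OF maxent_carrier] sum_lessThan_mult
    by (intro sum.cong refl) (simp add: q_maxent_def mult_add_less_mult)
  ultimately show ?thesis using assms by (simp add: q_state_def sum_if_eq)
qed

lemma trace_id_tensor:
  assumes L: "q_linear D E L" "\<And>X. X \<in> carrier_mat D D \<Longrightarrow> q_trace (L X) = q_trace X" and X: "X \<in> carrier_mat (n*D) (n*D)"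
  shows "q_trace (q_id_tensor n D E L X) = q_trace X"
proof -
  have "q_trace (q_id_tensor n D E L X) = (\<Sum>r<n. q_trace (L (q_block D X r r)))"
    unfolding trace_carrier[OF id_tensor_carrier] sum_lessThan_mult trace_carrier[OF linearD(1)[OF L(1) block_carrier]]
    by (intro sum.cong refl) (simp add: id_tensor_index)
  also have "\<dots> = q_trace X"
    unfolding L(2)[OF block_carrier] trace_carrier[OF block_carrier] trace_carrier[OF X] sum_lessThan_mult
    by (intro sum.cong refl) (simp add: block_index)
  finally show ?thesis .
qed

text \<open>In terms of labels, the middle two are exchanged: R_A A R_B B is read from R_A R_B A
  B.\<close>

lemma reorder_idx_eq:
  assumes "a < dA" "rb < dB'" "b < dB"
  shows "q_reorder_idx dB' dA dB ((ra*dA + a)*(dB'*dB) + (rb*dB + b)) = (ra*dB' + rb)*(dA*dB) + (a*dB + b)"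
proof -
  have "rb*dB + b < dB'*dB" using assms by (intro mult_add_less_mult)
  then have "q_reorder_idx dB' dA dB ((ra*dA + a)*(dB'*dB) + (rb*dB + b)) = ((ra*dB' + rb)*dA + a)*dB + b"
    using assms by (simp only: q_reorder_idx_def Let_def div_mult_add mod_mult_add)
  then show ?thesis by (simp add: algebra_simps)
qed

lemma reorder_idx_bij:
  assumes pos: "dA > 0" "dB > 0" "dB' > 0"
  shows "bij_betw (q_reorder_idx dB' dA dB) {..<dA'*dA*(dB'*dB)} {..<dA'*dA*(dB'*dB)}"
proof -
  let ?f = "q_reorder_idx dB' dA dB" and ?n = "dA'*dA*(dB'*dB)"
  have dec: "\<exists>ra a rb b. ra < dA' \<and> a < dA \<and> rb < dB' \<and> b < dB \<and> i = (ra*dA + a)*(dB'*dB) + (rb*dB + b)"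
    if i: "i < ?n" for i
  proof -
    note x = less_mult_div_mod[OF i]
    note y = less_mult_div_mod[OF x(1)] and z = less_mult_div_mod[OF x(2)]
    have "i = (i div (dB'*dB) div dA * dA + i div (dB'*dB) mod dA)*(dB'*dB) + (i mod (dB'*dB) div dB * dB + i mod (dB'*dB) mod dB)"
      by (simp only: div_mult_mod_eq)
    then show ?thesis using y z by blast
  qed
  have "inj_on ?f {..<?n}"
  proof (rule inj_onI)
    fix i j assume "i \<in> {..<?n}" "j \<in> {..<?n}" and eq: "?f i = ?f j"
    then obtain ra a rb b ra' a' rb' b' where
      i: "a < dA" "rb < dB'" "b < dB" "i = (ra*dA + a)*(dB'*dB) + (rb*dB + b)" and
      j: "a' < dA" "rb' < dB'" "b' < dB" "j = (ra'*dA + a')*(dB'*dB) + (rb'*dB + b')"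
      using dec[of i] dec[of j] by auto
    have ab: "a*dB + b < dA*dB" "a'*dB + b' < dA*dB" using i j by (auto intro: mult_add_less_mult)
    have "(ra*dB' + rb)*(dA*dB) + (a*dB + b) = (ra'*dB' + rb')*(dA*dB) + (a'*dB + b')"
      using eq unfolding i(4) j(4) reorder_idx_eq[OF i(1-3)] reorder_idx_eq[OF j(1-3)] .
    then have "ra*dB' + rb = ra'*dB' + rb'" "a*dB + b = a'*dB + b'" unfolding mult_add_eq_iff[OF ab] by auto
    then show "i = j" unfolding mult_add_eq_iff[OF i(2) j(2)] mult_add_eq_iff[OF i(3) j(3)] i(4) j(4) by simp
  qed
  moreover have "?f ` {..<?n} \<subseteq> {..<?n}"
  proof
    fix k assume "k \<in> ?f ` {..<?n}"
    then obtain i where "i < ?n" and k: "k = ?f i" by auto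
    then obtain ra a rb b where i: "ra < dA'" "a < dA" "rb < dB'" "b < dB" "i = (ra*dA + a)*(dB'*dB) + (rb*dB + b)"
      using dec by blast
    have "(ra*dB' + rb)*(dA*dB) + (a*dB + b) < (dA'*dB')*(dA*dB)"
      using i by (intro mult_add_less_mult)
    also have "(dA'*dB')*(dA*dB) = ?n" by (simp add: mult_ac)
    finally show "k \<in> {..<?n}" unfolding k i(5) reorder_idx_eq[OF i(2-4)] by simp
  qed
  ultimately show ?thesis
    using endo_inj_surj[of "{..<?n}" ?f] by (simp add: bij_betw_def)
qed

text \<open>The permutation of \<open>q_choi\<close> as an operation on matrices. The size is
  bracketed as (R_A A)(R_B B), the bipartition along which the partial trace is taken.\<close>

definition reorder :: "nat \<Rightarrow> nat \<Rightarrow> nat \<Rightarrow> nat \<Rightarrow> complex mat \<Rightarrow> complex mat" where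
  "reorder dA' dB' dA dB C = mat (dA'*dA*(dB'*dB)) (dA'*dA*(dB'*dB))
     (\<lambda>(i,j). C $$ (q_reorder_idx dB' dA dB i, q_reorder_idx dB' dA dB j))"

lemma choi_eq_reorder:
  "q_choi dA' dB' dA dB N = reorder dA' dB' dA dB (choi_mat (dA'*dB') (dA*dB) N)"
  by (simp add: q_choi_def reorder_def q_choi_raw_def Let_def mult.assoc)

lemma reorder_carrier [simp]: "reorder dA' dB' dA dB C \<in> carrier_mat (dA'*dA*(dB'*dB)) (dA'*dA*(dB'*dB))"
  by (simp add: reorder_def)

lemma reorder_index:
  assumes "ra < dA'" "a < dA" "rb < dB'" "b < dB" "ra' < dA'" "a' < dA" "rb' < dB'" "b' < dB"
  shows "reorder dA' dB' dA dB C $$ ((ra*dA + a)*(dB'*dB) + (rb*dB + b), (ra'*dA + a')*(dB'*dB) + (rb'*dB + b'))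
    = C $$ ((ra*dB' + rb)*(dA*dB) + (a*dB + b), (ra'*dB' + rb')*(dA*dB) + (a'*dB + b'))"
proof -
  have "(ra*dA + a)*(dB'*dB) + (rb*dB + b) < dA'*dA*(dB'*dB)" "(ra'*dA + a')*(dB'*dB) + (rb'*dB + b') < dA'*dA*(dB'*dB)"
    using assms by (auto intro!: mult_add_less_mult)
  then show ?thesis using assms by (simp add: reorder_def reorder_idx_eq)
qed

lemma size_eq: "dA'*dB'*(dA*dB) = dA'*dA*(dB'*(dB::nat))"
  by (simp add: mult_ac)

text \<open>The forward direction serves the Choi matrix of N. The backward one gives positivity for
  R \<otimes> M, whose reordered Choi matrix is visibly a tensor product.\<close>

lemma reorder_psd_iff:
  assumes pos: "dA > 0" "dB > 0" "dB' > 0" and C: "C \<in> carrier_mat (dA'*dB'*(dA*dB)) (dA'*dB'*(dA*dB))"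
  shows "q_psd (dA'*dA*(dB'*dB)) (reorder dA' dB' dA dB C) \<longleftrightarrow> q_psd (dA'*dB'*(dA*dB)) C"
proof
  let ?n = "dA'*dA*(dB'*dB)" and ?f = "q_reorder_idx dB' dA dB"
  note bij = reorder_idx_bij[OF pos, of dA']
  have fn: "?f i < ?n" if "i < ?n" for i using bij_betwE[OF bij] that by auto
  show "q_psd ?n (reorder dA' dB' dA dB C)" if "q_psd (dA'*dB'*(dA*dB)) C"
    using psd_pullback[OF that[unfolded size_eq], of ?n ?f "\<lambda>_. 1"] fn by (simp add: reorder_def)
  assume R: "q_psd ?n (reorder dA' dB' dA dB C)"
  let ?g = "inv_into {..<?n} ?f"
  have gn: "?g i < ?n" if "i < ?n" for i using bij_betwE[OF bij_betw_inv_into[OF bij]] that by auto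
  have fg: "?f (?g i) = i" if "i < ?n" for i using bij_betw_inv_into_right[OF bij] that by simp
  have "C = mat ?n ?n (\<lambda>(i,j). 1 * cnj 1 * reorder dA' dB' dA dB C $$ (?g i, ?g j))"
    using C by (intro eq_matI) (auto simp: reorder_def gn fg size_eq)
  then show "q_psd (dA'*dB'*(dA*dB)) C"
    unfolding size_eq using psd_pullback[OF R, of ?n ?g "\<lambda>_. 1"] gn by metis
qed

lemma trace_reorder:
  assumes pos: "dA > 0" "dB > 0" "dB' > 0" and C: "C \<in> carrier_mat (dA'*dB'*(dA*dB)) (dA'*dB'*(dA*dB))"
  shows "q_trace (reorder dA' dB' dA dB C) = q_trace C"
proof -
  have "q_trace (reorder dA' dB' dA dB C)
     = (\<Sum>i<dA'*dA*(dB'*dB). C $$ (q_reorder_idx dB' dA dB i, q_reorder_idx dB' dA dB i))"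
    unfolding trace_carrier[OF reorder_carrier] by (simp add: reorder_def)
  also have "\<dots> = (\<Sum>i<dA'*dA*(dB'*dB). C $$ (i,i))"
    by (rule sum.reindex_bij_betw[OF reorder_idx_bij[OF pos], of "\<lambda>i. C $$ (i,i)"])
  finally show ?thesis unfolding trace_carrier[OF C] size_eq .
qed

lemma ptrace1_unit:
  assumes "ra < dA'" "rb < dB'" "ra' < dA'" "rb' < dB'"
  shows "q_ptrace1 dA' dB' (q_unit (dA'*dB') (ra*dB' + rb) (ra'*dB' + rb'))
    = (if ra = ra' then 1 else 0) \<cdot>\<^sub>m q_unit dB' rb rb'"
proof (rule eq_mat_dimI)
  fix i j assume ij: "i < dB'" "j < dB'"
  have "q_ptrace1 dA' dB' (q_unit (dA'*dB') (ra*dB' + rb) (ra'*dB' + rb')) $$ (i,j)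
     = (\<Sum>k<dA'. if ra = k then (if ra = ra' \<and> i = rb \<and> j = rb' then 1 else 0) else 0)"
    unfolding ptrace1_index[OF ij] using ij assms
    by (intro sum.cong refl) (auto simp: unit_index mult_add_less_mult mult_add_eq_iff)
  then show "q_ptrace1 dA' dB' (q_unit (dA'*dB') (ra*dB' + rb) (ra'*dB' + rb')) $$ (i,j)
     = ((if ra = ra' then 1 else 0) \<cdot>\<^sub>m q_unit dB' rb rb') $$ (i,j)"
    using ij assms by (simp add: sum_if_eq q_unit_def)
qed (auto simp: q_unit_def q_ptrace1_def)

text \<open>The normalisation of the Choi matrix is 1/(|A'| |B'|), of which the Choi matrix of M
  takes 1/|B'|. The identity on R_A comes from the trace of the matrix units and the one on A from
  the replacer; the leftover 1/|A'| is the source of the logarithm in the theorem.\<close>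

lemma reorder_replace_choi:
  assumes M: "q_linear dB' dB M"
  shows "reorder dA' dB' dA dB (choi_mat (dA'*dB') (dA*dB) (q_map_tensor dA' dB' dA dB (q_replace dA) M))
    = q_kron (1\<^sub>m (dA'*dA)) (complex_of_real (1 / real dA') \<cdot>\<^sub>m choi_mat dB' dB M)"
proof (rule eq_mat_prodI[where m = "dA'*dA" and p = "dB'*dB" and n = "dA'*dA" and q = "dB'*dB"])
  let ?L = "q_map_tensor dA' dB' dA dB (q_replace dA) M" and ?\<tau> = "choi_mat dB' dB M"
  let ?l = "reorder dA' dB' dA dB (choi_mat (dA'*dB') (dA*dB) ?L)"
  let ?r = "q_kron (1\<^sub>m (dA'*dA)) (complex_of_real (1 / real dA') \<cdot>\<^sub>m ?\<tau>)"
  have \<tau>: "complex_of_real (1 / real dA') \<cdot>\<^sub>m ?\<tau> \<in> carrier_mat (dB'*dB) (dB'*dB)" by simp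
  show "?r \<in> carrier_mat (dA'*dA*(dB'*dB)) (dA'*dA*(dB'*dB))"
    using \<tau> by simp
  fix x y x' y' assume b: "x < dA'*dA" "y < dB'*dB" "x' < dA'*dA" "y' < dB'*dB"
  define ra a ra' a' rb bb rb' bb' where defs: "ra = x div dA" "a = x mod dA" "ra' = x' div dA" "a' = x' mod dA"
    "rb = y div dB" "bb = y mod dB" "rb' = y' div dB" "bb' = y' mod dB"
  have bd: "ra < dA'" "a < dA" "rb < dB'" "bb < dB" "ra' < dA'" "a' < dA" "rb' < dB'" "bb' < dB"
    unfolding defs using less_mult_div_mod[OF b(1)] less_mult_div_mod[OF b(2)] less_mult_div_mod[OF b(3)] less_mult_div_mod[OF b(4)] by auto
  have xy: "x = ra*dA + a" "x' = ra'*dA + a'" "y = rb*dB + bb" "y' = rb'*dB + bb'" unfolding defs by simp_all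
  have in1: "ra*dB' + rb < dA'*dB'" "ra'*dB' + rb' < dA'*dB'" "a*dB + bb < dA*dB" "a'*dB + bb' < dA*dB"
    using bd by (auto intro: mult_add_less_mult)
  have Mu: "M (q_unit dB' rb rb') \<in> carrier_mat dB dB" by (rule linearD(1)[OF M]) simp
  have "?l $$ (x*(dB'*dB) + y, x'*(dB'*dB) + y')
     = ?L (q_unit (dA'*dB') (ra*dB' + rb) (ra'*dB' + rb')) $$ (a*dB + bb, a'*dB + bb') / of_nat (dA'*dB')"
    unfolding xy reorder_index[OF bd] by (rule choi_index[OF linear_replace_tensor[OF M] in1])
  also have "?L (q_unit (dA'*dB') (ra*dB' + rb) (ra'*dB' + rb'))
      = q_kron (1\<^sub>m dA) ((if ra = ra' then 1 else 0) \<cdot>\<^sub>m M (q_unit dB' rb rb'))"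
    unfolding replace_tensor_eq[OF M unit_carrier] ptrace1_unit[OF bd(1,3,5,7)] linearD(3)[OF M unit_carrier] ..
  also have "\<dots> $$ (a*dB + bb, a'*dB + bb')
      = (if a = a' then 1 else 0) * ((if ra = ra' then 1 else 0) * M (q_unit dB' rb rb') $$ (bb,bb'))"
    using Mu bd by (subst kron_index[OF one_carrier_mat, of _ dB dB]) auto
  also have "\<dots> / of_nat (dA'*dB') = (if x = x' then 1 else 0) * (complex_of_real (1 / real dA') * (M (q_unit dB' rb rb') $$ (bb,bb') / of_nat dB'))"
    unfolding xy mult_add_eq_iff[OF bd(2,6)] by simp
  also have "\<dots> = ?r $$ (x*(dB'*dB) + y, x'*(dB'*dB) + y')"
    unfolding kron_index[OF one_carrier_mat \<tau> b] using b
    by (simp add: carrier_matD[OF id_tensor_carrier] choi_index[OF M] xy(3,4) bd)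
  finally show "?l $$ (x*(dB'*dB) + y, x'*(dB'*dB) + y')
     = ?r $$ (x*(dB'*dB) + y, x'*(dB'*dB) + y')" .
qed simp

text \<open>Tracing out R_A feeds the maximally mixed state into A'. Hence the Choi state of the
  reduced channel is the R_B B marginal of that of N, just what equality in the Klein inequality
  asks for.\<close>

lemma choi_reduced_channel:
  assumes N: "q_linear (dA'*dB') (dA*dB) N"
  shows "choi_mat dB' dB (reduced_channel dA' dA dB N)
    = q_ptrace1 (dA'*dA) (dB'*dB) (q_choi dA' dB' dA dB N)"
proof (rule eq_mat_prodI[where m = dB' and p = dB and n = dB' and q = dB])
  fix rb b rb' b' assume bd: "rb < dB'" "b < dB" "rb' < dB'" "b' < dB"
  let ?u = "\<lambda>k. q_unit (dA'*dB') (k*dB' + rb) (k*dB' + rb')"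
  have yy: "rb*dB + b < dB'*dB" "rb'*dB + b' < dB'*dB" using bd by (auto intro: mult_add_less_mult)
  have "q_kron (mixed dA') (q_unit dB' rb rb') = (1 / of_nat dA') \<cdot>\<^sub>m mat_sum (dA'*dB') (dA'*dB') ?u {..<dA'}"
  proof (rule eq_mat_prodI[where m = dA' and p = dB' and n = dA' and q = dB'])
    fix k y k' y' assume c: "k < dA'" "y < dB'" "k' < dA'" "y' < dB'"
    have kb: "k*dB' + y < dA'*dB'" "k'*dB' + y' < dA'*dB'" using c by (auto intro: mult_add_less_mult)
    have "mat_sum (dA'*dB') (dA'*dB') ?u {..<dA'} $$ (k*dB' + y, k'*dB' + y')
       = (\<Sum>l<dA'. if k = l then (if k = k' \<and> y = rb \<and> y' = rb' then 1 else 0) else 0)"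
      unfolding mat_sum_index[OF kb]
      by (intro sum.cong refl) (use c bd kb in \<open>auto simp: unit_index mult_add_eq_iff\<close>)
    then show "q_kron (mixed dA') (q_unit dB' rb rb') $$ (k*dB' + y, k'*dB' + y')
        = ((1 / of_nat dA') \<cdot>\<^sub>m mat_sum (dA'*dB') (dA'*dB') ?u {..<dA'}) $$ (k*dB' + y, k'*dB' + y')"
      unfolding kron_index[OF mixed_carrier unit_carrier c] using c kb
      by (simp add: carrier_matD[OF mat_sum_carrier] sum_if_eq mixed_def unit_index)
  qed auto
  then have Nk: "N (q_kron (mixed dA') (q_unit dB' rb rb')) = (1 / of_nat dA') \<cdot>\<^sub>m mat_sum (dA*dB) (dA*dB) (\<lambda>k. N (?u k)) {..<dA'}"
    using linear_mat_sum[OF N, of "{..<dA'}" ?u] by (simp add: linearD(3)[OF N])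
  have "choi_mat dB' dB (reduced_channel dA' dA dB N) $$ (rb*dB + b, rb'*dB + b')
    = (\<Sum>a<dA. N (q_kron (mixed dA') (q_unit dB' rb rb')) $$ (a*dB + b, a*dB + b')) / of_nat dB'"
    unfolding choi_index[OF linear_reduced_channel[OF N] bd(1,3,2,4)]
    by (simp add: reduced_channel_def ptrace1_index bd)
  also have "\<dots> = (\<Sum>a<dA. \<Sum>k<dA'. N (?u k) $$ (a*dB + b, a*dB + b') / of_nat (dA'*dB'))"
    unfolding Nk sum_divide_distrib using bd
    by (intro sum.cong refl) (simp add: carrier_matD[OF mat_sum_carrier] mat_sum_index mult_add_less_mult sum_divide_distrib)
  also have "\<dots> = (\<Sum>k<dA'. \<Sum>a<dA. N (?u k) $$ (a*dB + b, a*dB + b') / of_nat (dA'*dB'))"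
    by (rule sum.swap)
  also have "\<dots> = (\<Sum>k<dA'. \<Sum>a<dA. q_choi dA' dB' dA dB N $$ ((k*dA + a)*(dB'*dB) + (rb*dB + b), (k*dA + a)*(dB'*dB) + (rb'*dB + b')))"
    unfolding choi_eq_reorder using bd
    by (intro sum.cong refl) (simp add: reorder_index choi_index[OF N] mult_add_less_mult)
  also have "\<dots> = q_ptrace1 (dA'*dA) (dB'*dB) (q_choi dA' dB' dA dB N) $$ (rb*dB + b, rb'*dB + b')"
    unfolding ptrace1_index[OF yy] sum_lessThan_mult ..
  finally show "choi_mat dB' dB (reduced_channel dA' dA dB N) $$ (rb*dB + b, rb'*dB + b')
     = q_ptrace1 (dA'*dA) (dB'*dB) (q_choi dA' dB' dA dB N) $$ (rb*dB + b, rb'*dB + b')" .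
qed auto

text \<open>At the maximally entangled input, M enters only through a relative entropy on R_B B; the
  other summand is minus the conditional entropy of the Choi state.\<close>

lemma rel_entropy_choi:
  assumes pos: "dA' > 0" "dB' > 0" "dA > 0" "dB > 0"
    and N: "q_channel (dA'*dB') (dA*dB) N" and M: "q_channel dB' dB M"
  defines "C \<equiv> choi_mat (dA'*dB') (dA*dB) N"
    and "S \<equiv> choi_mat (dA'*dB') (dA*dB) (q_map_tensor dA' dB' dA dB (q_replace dA) M)"
    and "\<omega> \<equiv> q_ptrace1 (dA'*dA) (dB'*dB) (q_choi dA' dB' dA dB N)"
    and "\<tau> \<equiv> choi_mat dB' dB M"
  shows "q_psd (dA'*dB'*(dA*dB)) C" "q_psd (dA'*dB'*(dA*dB)) S"
    "q_psd (dB'*dB) \<omega>" "q_trace \<omega> = 1" "q_psd (dB'*dB) \<tau>" "q_trace \<tau> = 1"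
    "q_rel_entropy C S = q_rel_entropy \<omega> (complex_of_real (1 / real dA') \<cdot>\<^sub>m \<tau>)
      + ereal (- q_cond_entropy (dA'*dA) (dB'*dB) (q_choi dA' dB' dA dB N))"
proof -
  have linN: "q_linear (dA'*dB') (dA*dB) N" and linM: "q_linear dB' dB M"
    using N M by (auto simp: q_channel_def q_CP_def)
  have stD: "q_psd (dA'*dB'*(dA'*dB')) (q_maxent (dA'*dB'))" "q_trace (q_maxent (dA'*dB')) = 1"
    using state_maxent[of "dA'*dB'"] pos by (auto simp: q_state_def)
  have stB: "q_psd (dB'*dB') (q_maxent dB')" "q_trace (q_maxent dB') = 1"
    using state_maxent[of dB'] pos by (auto simp: q_state_def)
  have DD: "dA'*dB' > 0" using pos by simp
  show C: "q_psd (dA'*dB'*(dA*dB)) C"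
    using N stD(1) DD unfolding C_def q_channel_def q_CP_def by blast
  have Cc: "C \<in> carrier_mat (dA'*dB'*(dA*dB)) (dA'*dB'*(dA*dB))" and Sc: "S \<in> carrier_mat (dA'*dB'*(dA*dB)) (dA'*dB'*(dA*dB))"
    by (simp_all add: C_def S_def)
  have trC: "q_trace C = 1"
    using trace_id_tensor[OF linN _ maxent_carrier] N stD(2) unfolding C_def by (simp add: q_channel_def)
  have choi: "q_choi dA' dB' dA dB N = reorder dA' dB' dA dB C" by (simp add: choi_eq_reorder C_def)
  have psd_choi: "q_psd (dA'*dA*(dB'*dB)) (q_choi dA' dB' dA dB N)"
    unfolding choi reorder_psd_iff[OF pos(3,4,2) Cc] by (rule C)
  show \<omega>: "q_psd (dB'*dB) \<omega>" unfolding \<omega>_def by (rule psd_ptrace1[OF psd_choi])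
  show "q_trace \<omega> = 1"
    using trace_ptrace1[OF psdD(1)[OF psd_choi]] trace_reorder[OF pos(3,4,2) Cc] trC by (simp add: \<omega>_def choi)
  show \<tau>: "q_psd (dB'*dB) \<tau>"
    using M stB(1) pos(2) unfolding \<tau>_def q_channel_def q_CP_def by blast
  show "q_trace \<tau> = 1"
    using trace_id_tensor[OF linM _ maxent_carrier] M stB(2) unfolding \<tau>_def by (simp add: q_channel_def)
  let ?\<sigma> = "complex_of_real (1 / real dA') \<cdot>\<^sub>m \<tau>"
  have \<sigma>: "q_psd (dB'*dB) ?\<sigma>" by (rule psd_smult[OF \<tau>]) simp
  have RS: "reorder dA' dB' dA dB S = q_kron (1\<^sub>m (dA'*dA)) ?\<sigma>"
    unfolding S_def \<tau>_def by (rule reorder_replace_choi[OF linM])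
  \<comment> \<open>Positivity of S is read off a spectral decomposition of its reordered form, so
    complete positivity of R \<otimes> M need not be established.\<close>
  obtain V q where "psd_decomp (dB'*dB) ?\<sigma> V q" using psd_decomp_exists[OF \<sigma>] .
  then have psdRS: "q_psd (dA'*dA*(dB'*dB)) (reorder dA' dB' dA dB S)"
    unfolding RS by (rule psd_decomp_psd[OF psd_decomp_kron_one])
  then show S: "q_psd (dA'*dB'*(dA*dB)) S" unfolding reorder_psd_iff[OF pos(3,4,2) Sc] .
  have "q_rel_entropy C S = q_rel_entropy (reorder dA' dB' dA dB C) (reorder dA' dB' dA dB S)"
    unfolding reorder_def
    by (rule rel_entropy_reindex[OF C[unfolded size_eq] S[unfolded size_eq] reorder_idx_bij[OF pos(3,4,2)], symmetric])
  also have "\<dots> = q_rel_entropy \<omega> ?\<sigma> + ereal (q_entropy \<omega> - q_entropy (q_choi dA' dB' dA dB N))"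
    unfolding RS choi[symmetric] \<omega>_def by (rule rel_entropy_kron_one[OF psd_choi \<sigma>])
  finally show "q_rel_entropy C S = q_rel_entropy \<omega> ?\<sigma> + ereal (- q_cond_entropy (dA'*dA) (dB'*dB) (q_choi dA' dB' dA dB N))"
    by (simp add: q_cond_entropy_def \<omega>_def)
qed

section \<open>The two bounds and the theorem\<close>

lemma channel_div_ge_choi:
  assumes "D > 0"
  shows "q_rel_entropy (choi_mat D E K) (choi_mat D E L) \<le> q_channel_div D E K L"
proof -
  have "dim_row (q_maxent D) div D = D" using assms by (simp add: q_maxent_def)
  then show ?thesis
    unfolding q_channel_div_def using state_maxent[OF assms] assms
    by (intro SUP_upper2[of "q_maxent D"]) auto
qed

theorem mainTheorem6:
  fixes dA' dB' dA dB :: nat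
    and N :: "complex mat \<Rightarrow> complex mat"
    and G :: "('g, 'b) monoid_scheme" and H :: "('h, 'c) monoid_scheme"
    and UA :: "'g \<Rightarrow> complex mat" and UB :: "'h \<Rightarrow> complex mat"
    and V :: "'g \<Rightarrow> complex mat" and W :: "'h \<Rightarrow> complex mat"
  assumes "dA' > 0" "dB' > 0" "dA > 0" "dB > 0"
    and "q_channel (dA' * dB') (dA * dB) N"
    and "q_tele_covariant dA' dB' dA dB N G H UA UB V W"
  shows "q_channel_cond_entropy dA' dB' dA dB N =
         ereal (q_cond_entropy (dA' * dA) (dB' * dB) (q_choi dA' dB' dA dB N) - ln (real dA'))"
proof -
  let ?D = "dA' * dB'" and ?E = "dA * dB"
  let ?c = "q_cond_entropy (dA' * dA) (dB' * dB) (q_choi dA' dB' dA dB N)"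
  let ?L = "\<lambda>M. q_map_tensor dA' dB' dA dB (q_replace dA) M"
  let ?M = "reduced_channel dA' dA dB N"
  let ?U = "\<lambda>(g,h). q_kron (UA g) (UB h)" and ?T = "\<lambda>(g,h). q_kron (V g) (W h)"
  note pos = assms(1-4) and N = assms(5)
  have linN: "q_linear ?D ?E N" using N by (simp add: q_channel_def q_CP_def)
  have grp: "group G" "group H" and fin: "finite (carrier G)" "finite (carrier H)"
    and rep: "q_unitary_rep G dA' UA" "q_unitary_rep H dB' UB" "q_unitary_rep G dA V" "q_unitary_rep H dB W"
    and des: "q_one_design G dA' UA" "q_one_design H dB' UB"
    and cov_state: "\<And>\<rho> g h. q_state ?D \<rho> \<Longrightarrow> g \<in> carrier G \<Longrightarrow> h \<in> carrier H \<Longrightarrow>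
        N (q_kron (UA g) (UB h) * \<rho> * q_adj (q_kron (UA g) (UB h)))
        = q_kron (V g) (W h) * N \<rho> * q_adj (q_kron (V g) (W h))"
    using assms(6) unfolding q_tele_covariant_def by blast+
  have UA: "q_unitary dA' (UA g)" and V: "q_unitary dA (V g)" if "g \<in> carrier G" for g
    using rep that by (auto simp: q_unitary_rep_def)
  have UB: "q_unitary dB' (UB h)" and W: "q_unitary dB (W h)" if "h \<in> carrier H" for h
    using rep that by (auto simp: q_unitary_rep_def)
  have ne: "carrier G \<noteq> {}" "carrier H \<noteq> {}"
    using monoid.one_closed[OF group.is_monoid[OF grp(1)]] monoid.one_closed[OF group.is_monoid[OF grp(2)]] by blast+
  then have cards: "card (carrier G) > 0" "card (carrier H) > 0" using fin by (auto simp: card_gt_0_iff)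
  interpret one_design_family ?D ?E "carrier G \<times> carrier H" ?U ?T
  proof
    show "finite (carrier G \<times> carrier H)" using fin by simp
    show "carrier G \<times> carrier H \<noteq> {}" using ne by simp
    show "?D > 0" using pos by simp
    show "q_unitary ?D (?U k)" if "k \<in> carrier G \<times> carrier H" for k
      using that UA UB by (auto intro: unitary_kron)
    show "q_unitary ?E (?T k)" if "k \<in> carrier G \<times> carrier H" for k
      using that V W by (auto intro: unitary_kron)
    fix x y x' y' assume b: "x < ?D" "y < ?D" "x' < ?D" "y' < ?D"
    note oA = one_design_orthogonality[OF des(1) unitaryD(1)[OF UA] cards(1)]
    note oB = one_design_orthogonality[OF des(2) unitaryD(1)[OF UB] cards(2)]
    show "(\<Sum>k\<in>carrier G \<times> carrier H. ?U k $$ (x,y) * cnj (?U k $$ (x',y')))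
      = (if x = x' \<and> y = y' then of_nat (card (carrier G \<times> carrier H)) / of_nat ?D else 0)"
      using kron_orthogonality[OF unitaryD(1)[OF UA] unitaryD(1)[OF UB] oA oB b]
      by (simp add: card_cartesian_product)
  qed
  \<comment> \<open>Both sides are linear in X, so covariance extends from states to all
    matrices.\<close>
  have cov: "N (q_kron (UA g) (UB h) * X * q_adj (q_kron (UA g) (UB h)))
        = q_kron (V g) (W h) * N X * q_adj (q_kron (V g) (W h))"
    if g: "g \<in> carrier G" and h: "h \<in> carrier H" and X: "X \<in> carrier_mat ?D ?D" for g h X
  proof (rule linear_eq_on_states[OF _ _ _ X])
    show "q_linear ?D ?E (\<lambda>X. N (q_kron (UA g) (UB h) * X * q_adj (q_kron (UA g) (UB h))))"
      by (rule linear_comp[OF linear_conjugation linN]) (simp add: unitaryD[OF UA[OF g]] unitaryD[OF UB[OF h]])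
    show "q_linear ?D ?E (\<lambda>X. q_kron (V g) (W h) * N X * q_adj (q_kron (V g) (W h)))"
      by (rule linear_comp[OF linN linear_conjugation]) (simp add: unitaryD[OF V[OF g]] unitaryD[OF W[OF h]])
  qed (rule cov_state[OF _ g h])
  have chM: "q_channel dB' dB ?M" by (rule channel_reduced_channel[OF N pos(1)])
  have linM: "q_linear dB' dB ?M" by (rule linear_reduced_channel[OF linN])
  have covN: "N (?U k * X * q_adj (?U k)) = ?T k * N X * q_adj (?T k)"
    if "k \<in> carrier G \<times> carrier H" "X \<in> carrier_mat ?D ?D" for k X
    using that cov by auto
  have covL: "?L ?M (?U k * X * q_adj (?U k)) = ?T k * ?L ?M X * q_adj (?T k)"
    if k: "k \<in> carrier G \<times> carrier H" and X: "X \<in> carrier_mat ?D ?D" for k X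
  proof -
    obtain g h where gh: "k = (g,h)" "g \<in> carrier G" "h \<in> carrier H" using k by auto
    have "?M (UB h * Y * q_adj (UB h)) = W h * ?M Y * q_adj (W h)" if "Y \<in> carrier_mat dB' dB'" for Y
      by (rule reduced_channel_covariant[OF linN cov[OF gh(2,3)] UA[OF gh(2)] unitaryD(1)[OF UB[OF gh(3)]]
          V[OF gh(2)] unitaryD(1)[OF W[OF gh(3)]] that])
    then show ?thesis unfolding gh(1) prod.case
      by (intro replace_tensor_covariant linM UA[OF gh(2)] V[OF gh(2)] unitaryD(1)[OF UB[OF gh(3)]] unitaryD(1)[OF W[OF gh(3)]] X)
  qed
  have lower: "ereal (ln (real dA') - ?c) \<le> q_channel_div ?D ?E N (?L M)" if M: "q_channel dB' dB M" for M
  proof -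
    note r = rel_entropy_choi[OF pos N M]
    let ?\<sigma> = "complex_of_real (1 / real dA') \<cdot>\<^sub>m choi_mat dB' dB M"
    have "q_trace ?\<sigma> = of_real (1 / real dA')"
      using trace_smult[OF psdD(1)[OF r(5)]] r(6) by simp
    then have "ereal (ln (real dA')) \<le> q_rel_entropy (q_ptrace1 (dA'*dA) (dB'*dB) (q_choi dA' dB' dA dB N)) ?\<sigma>"
      using pos by (intro Klein_inequality[OF r(3,4) psd_smult[OF r(5)]]) auto
    then have "ereal (ln (real dA')) + ereal (- ?c) \<le> q_rel_entropy (q_ptrace1 (dA'*dA) (dB'*dB) (q_choi dA' dB' dA dB N)) ?\<sigma> + ereal (- ?c)"
      by (rule add_right_mono)
    also have "\<dots> \<le> q_channel_div ?D ?E N (?L M)"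
      unfolding r(7)[symmetric] using pos by (intro channel_div_ge_choi) simp
    finally show ?thesis by simp
  qed
  have upper: "q_channel_div ?D ?E N (?L ?M) \<le> ereal (ln (real dA') - ?c)"
    unfolding q_channel_div_def
  proof (rule SUP_least, clarify)
    fix \<rho> and n :: nat assume n: "n > 0" and \<rho>: "q_state (n*?D) \<rho>"
    note r = rel_entropy_choi[OF pos N chM]
    have dim: "dim_row \<rho> div ?D = n" using \<rho> pos by (auto simp: q_state_def q_psd_def)
    have "q_rel_entropy (q_id_tensor n ?D ?E N \<rho>) (q_id_tensor n ?D ?E (?L ?M) \<rho>)
      \<le> q_rel_entropy (choi_mat ?D ?E N) (choi_mat ?D ?E (?L ?M))"
      by (rule channel_div_le_choi[OF linN covN linear_replace_tensor[OF linM] covL r(1,2) \<rho>])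
    \<comment> \<open>For the reduced channel the operator on R_B B is the marginal itself divided
      by |A'|, so the relative entropy is exactly ln|A'|.\<close>
    also have "\<dots> = ereal (ln (real dA') - ?c)"
      unfolding r(7) choi_reduced_channel[OF linN] using rel_entropy_scaled_self[OF r(3,4), of "real dA'"] pos by simp
    finally show "q_rel_entropy (q_id_tensor (dim_row \<rho> div ?D) ?D ?E N \<rho>) (q_id_tensor (dim_row \<rho> div ?D) ?D ?E (?L ?M) \<rho>)
      \<le> ereal (ln (real dA') - ?c)" unfolding dim .
  qed
  have "(INF M \<in> {M. q_channel dB' dB M}. q_channel_div ?D ?E N (?L M)) = ereal (ln (real dA') - ?c)"
  proof (rule antisym)
    show "(INF M \<in> {M. q_channel dB' dB M}. q_channel_div ?D ?E N (?L M)) \<le> ereal (ln (real dA') - ?c)"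
      using chM upper by (intro INF_lower2[of ?M]) auto
    show "ereal (ln (real dA') - ?c) \<le> (INF M \<in> {M. q_channel dB' dB M}. q_channel_div ?D ?E N (?L M))"
      by (rule INF_greatest) (simp add: lower)
  qed
  then show ?thesis unfolding q_channel_cond_entropy_def by simp
qed

end
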